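(* Let $f:\mathbb{C}\to\mathbb{C}$ be a polynomial of degree $d\geq 2$ whose Julia set $J_f$ is locally connected. Then for any continuum $C\subseteq J_f$ there exist integers $m\geq 0$ and $n\geq 1$ such that $f^{m}(C)\cap f^{m+n}(C)\neq\emptyset$.
   Context: A continuum means a compact, connected, non-singleton subset of $\mathbb{C}$. The Julia set $J_f$ is the boundary of the set of points whose orbits tend to infinity; $f^n$ denotes the $n$-th iterate. *)

theory Defs
  imports "HOL-Analysis.Analysis" "HOL-Computational_Algebra.Polynomial"
begin

definition escaping_set :: "(complex \<Rightarrow> complex) \<Rightarrow> complex set" where
  "escaping_set f = {z. filterlim (\<lambda>n. (f ^^ n) z) at_infinity sequentially}"

definition julia_set :: "(complex \<Rightarrow> complex) \<Rightarrow> complex set" where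
  "julia_set f = frontier (escaping_set f)"

(* The library's connected holds of the empty set, which is not a continuum. *)
definition continuum :: "complex set \<Rightarrow> bool" where
  "continuum C \<longleftrightarrow> compact C \<and> connected C \<and> C \<noteq> {} \<and> \<not> is_singleton C"

end

theory Submission
  imports Defs "HOL-Complex_Analysis.Complex_Analysis"
    "HOL-Computational_Algebra.Fundamental_Theorem_Algebra"
begin

text \<open>Suppose that the images of \<open>C\<close> under the iterates of \<open>f\<close> are pairwise disjoint. External angles turn
this into a statement about finitely many points on a circle, and there it is a counting argument.

Angles. Let \<open>K\<close> be the complement of the basin of infinity; its frontier is the Julia set \<open>J\<close>. Since
\<open>J\<close> is locally connected, it has finitely many components, and this forces \<open>K\<close> to be connected
(\<open>connected_filled_julia\<close>). Hence the basin together with infinity is simply connected, and its Riemann map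
provides the Boettcher coordinate (\<open>boettcher_coordinate\<close>), written here on the right half-plane: a map
\<open>\<Phi>\<close> onto the basin, periodic under \<open>2 \<pi> \<i>\<close>, with \<open>f (\<Phi> w) = \<Phi> (m w)\<close> for some \<open>m \<ge> 2\<close>. Local
connectivity of \<open>J\<close> extends \<open>\<Phi>\<close> continuously to the imaginary axis (Caratheodory's theorem): a length-area
estimate gives small crosscuts, and Janiszewski's theorem shows that what a small crosscut cuts off has
small image (\<open>crosscut_image_small\<close>). The boundary values, with the period rescaled to 1, form a
surjection \<open>\<phi>\<close> from the circle onto \<open>J\<close> with \<open>\<phi> (m x) = f (\<phi> x)\<close>.

Unlinking. If \<open>C\<close> and \<open>C'\<close> are disjoint subcontinua of \<open>J\<close>, then no two angles of \<open>C\<close> separate two angles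
of \<open>C'\<close> on the circle (\<open>boundary_values_unlinked\<close>): a crosscut of the basin joining the first two, together
with \<open>C\<close>, would separate the plane between the other two, which are joined by \<open>C'\<close>. A wandering continuum
thus has a set of angles whose images under multiplication by \<open>m\<close> are pairwise disjoint and unlinked. This
set is uncountable because \<open>C\<close> is, so it contains arbitrarily large finite sets \<open>F\<close> whose points never
collide.

Counting. Such an \<open>F\<close> has bounded cardinality (\<open>card_wandering_angles\<close>). Multiplication by \<open>m\<close> expands
small distances, so two points of \<open>F\<close> can only become close by a collapse: at some time they are nearly
\<open>j / m\<close> apart, \<open>m\<close> not dividing \<open>j\<close>. Two collapses at different times and at nearly the same place are
nested, since chords of unlinked sets do not cross, and then a whole image of \<open>F\<close> is caught in \<open>m\<close> tiny
arcs. So, if \<open>F\<close> is large, collapses happen only boundedly often, and a few points of \<open>F\<close> stay apart from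
one another forever. But infinitely many disjoint unlinked triangles cannot all be fat.\<close>

section \<open>Wandering finite sets of angles\<close>

text \<open>No two points of one set separate two points of the other on the circle. The circle is cut open at 0, so
linked pairs interleave on the line, and the two conjuncts are the two possible orders.\<close>
definition unlinked :: "real set \<Rightarrow> real set \<Rightarrow> bool" where
  "unlinked A B \<longleftrightarrow> A \<inter> B = {} \<and>
     (\<forall>a\<in>A. \<forall>b\<in>A. \<forall>c\<in>B. \<forall>e\<in>B. \<not> (a < c \<and> c < b \<and> b < e) \<and> \<not> (c < a \<and> a < e \<and> e < b))"

definition near_mod1 :: "real \<Rightarrow> real \<Rightarrow> real \<Rightarrow> bool" where
  "near_mod1 \<epsilon> x y \<longleftrightarrow> (\<exists>m::int. \<bar>x - y + of_int m\<bar> < \<epsilon>)"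

definition angle_mult :: "nat \<Rightarrow> real \<Rightarrow> real" where
  "angle_mult d x = frac (real d * x)"

lemma unlinkedD:
  assumes "unlinked A B" "a \<in> A" "b \<in> A" "c \<in> B" "e \<in> B"
  shows "\<not> (a < c \<and> c < b \<and> b < e)" "\<not> (c < a \<and> a < e \<and> e < b)"
proof -
  note * = assms(1)[unfolded unlinked_def, THEN conjunct2, THEN bspec, OF assms(2), THEN bspec, OF assms(3),
      THEN bspec, OF assms(4), THEN bspec, OF assms(5)]
  show "\<not> (a < c \<and> c < b \<and> b < e)" "\<not> (c < a \<and> a < e \<and> e < b)"
    using * by (rule conjunct1, rule conjunct2)
qed

lemma unlinked_disjoint: "unlinked A B \<Longrightarrow> a \<in> A \<Longrightarrow> b \<in> B \<Longrightarrow> a \<noteq> b"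
  by (metis disjoint_iff unlinked_def)

lemma near_mod1_mono: "near_mod1 \<epsilon> x y \<Longrightarrow> \<epsilon> \<le> \<delta> \<Longrightarrow> near_mod1 \<delta> x y"
  unfolding near_mod1_def using less_le_trans by metis

text \<open>A point \<open>w\<close> outside the arc from \<open>u\<close> to \<open>u + s\<close> would be separated from \<open>v\<close>, which is inside, by the two ends
of the arc. The integer \<open>i\<close> picks the representative of \<open>w\<close> on the arc, which may wrap around 0.\<close>
lemma unlinked_arc:
  fixes u v w s :: real
  assumes unl: "unlinked A B" and s: "0 < s" "s < 1" and v: "u < v" "v < u + s"
    and A: "frac u \<in> A" "frac (u + s) \<in> A" and B: "frac v \<in> B" "frac w \<in> B"
  shows "\<exists>i::int. u < w + of_int i \<and> w + of_int i < u + s"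
proof -
  define U where "U = frac u"
  define V where "V = v - of_int \<lfloor>u\<rfloor>"
  define W where "W = frac w"
  have U: "0 \<le> U" "U < 1" and W: "0 \<le> W" "W < 1" by (auto simp: U_def W_def frac_lt_1)
  have u: "of_int \<lfloor>u\<rfloor> = u - U" by (simp add: U_def frac_def)
  have V: "U < V" "V < U + s" using v u by (auto simp: V_def)
  have "\<exists>i::int. U < W + of_int i \<and> W + of_int i < U + s"
  proof (cases "U + s < 1")
    case True
    have 1: "frac (u + s) = U + s" proof (rule frac_unique_iff[THEN iffD2], intro conjI)
      have "u + s - (U + s) = of_int \<lfloor>u\<rfloor>" using u by simp
      then show "u + s - (U + s) \<in> \<int>" by (metis Ints_of_int)
    qed (use True U s in auto)
    have 2: "frac v = V" using True U V by (simp add: frac_unique_iff V_def)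
    have "U < W" "W < U + s"
    proof -
      have "W \<noteq> U" using unlinked_disjoint[OF unl A(1) B(2)] by (simp add: U_def W_def)
      moreover have "W \<noteq> U + s" using unlinked_disjoint[OF unl A(2) B(2)] 1 by (simp add: W_def)
      moreover have "\<not> W < U"
        using unlinkedD(2)[OF unl A B(2,1)] V unfolding 1 2 U_def[symmetric] W_def[symmetric] by simp
      moreover have "\<not> U + s < W"
        using unlinkedD(1)[OF unl A B] V unfolding 1 2 U_def[symmetric] W_def[symmetric] by simp
      ultimately show "U < W" "W < U + s" by auto
    qed
    then show ?thesis by (intro exI[of _ 0]) auto
  next
    case False
    have 1: "frac (u + s) = U + s - 1" proof (rule frac_unique_iff[THEN iffD2], intro conjI)
      have "u + s - (U + s - 1) = of_int (\<lfloor>u\<rfloor> + 1)" using u by simp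
      then show "u + s - (U + s - 1) \<in> \<int>" by (metis Ints_of_int)
    qed (use False U s in auto)
    show ?thesis
    proof (rule ccontr)
      assume "\<not> ?thesis"
      then have con: "\<not> (U < W + of_int i \<and> W + of_int i < U + s)" for i :: int by blast
      have W1: "\<not> (U < W \<and> W < U + s)" using con[of 0] by simp
      have W2: "\<not> (U < W + 1 \<and> W + 1 < U + s)" using con[of 1] by simp
      have ne: "W \<noteq> U" "W \<noteq> U + s - 1"
        using unlinked_disjoint[OF unl A(1) B(2)] unlinked_disjoint[OF unl A(2) B(2)] 1 by (simp_all add: U_def W_def)
      have Wb: "U + s - 1 < W" "W < U" using W1 W2 W U s False ne by auto
      show False
      proof (cases "V < 1")
        case True
        then have "frac v = V" using U V by (simp add: frac_unique_iff V_def)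
        then show False
          using unlinkedD(1)[OF unl A(2,1) B(2,1)] V Wb unfolding 1 U_def[symmetric] W_def[symmetric] by simp
      next
        case F: False
        have "V - 1 < 1" using U V s by linarith
        then have "frac v = V - 1" using F by (auto simp: frac_unique_iff V_def)
        then show False
          using unlinkedD(2)[OF unl A(2,1) B] V Wb unfolding 1 U_def[symmetric] W_def[symmetric] by simp
      qed
    qed
  qed
  then obtain i :: int where "U < W + of_int i" "W + of_int i < U + s" by blast
  moreover have "of_int \<lfloor>w\<rfloor> = w - W" by (simp add: W_def frac_def)
  ultimately have "u < w + of_int (i - \<lfloor>w\<rfloor> + \<lfloor>u\<rfloor>) \<and> w + of_int (i - \<lfloor>w\<rfloor> + \<lfloor>u\<rfloor>) < u + s"
    using u by simp
  then show ?thesis by blast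
qed

text \<open>In what follows, \<open>F\<close> moves under multiplication by \<open>d\<close> without collisions, and its images are pairwise disjoint
and unlinked, as for the angles of a wandering continuum.\<close>
locale wandering_angles =
  fixes d :: nat and F :: "real set"
  assumes d: "d \<ge> 2"
    and fin: "finite F" and F01: "F \<subseteq> {0..<1}"
    and inj: "\<And>n. inj_on (angle_mult d ^^ n) F"
    and unl: "\<And>m n. m \<noteq> n \<Longrightarrow> unlinked ((angle_mult d ^^ m) ` F) ((angle_mult d ^^ n) ` F)"
begin

abbreviation orb :: "nat \<Rightarrow> real \<Rightarrow> real" where
  "orb n \<equiv> angle_mult d ^^ n"

lemma orb01: "x \<in> F \<Longrightarrow> 0 \<le> orb n x \<and> orb n x < 1"
  using F01 by (cases n) (auto simp: angle_mult_def frac_lt_1)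

text \<open>At time \<open>t\<close> the points \<open>x\<close> and \<open>y\<close> are nearly \<open>j / d\<close> apart, where \<open>d\<close> does not divide \<open>j\<close>, so the next
multiplication by \<open>d\<close> brings them together. The sign condition orients the pair. The class \<open>(j, c)\<close> records
\<open>j\<close> and the cell of length \<open>1 / (4 d)\<close> that contains the first point; it locates the chord from \<open>x\<close> to \<open>y\<close>
well enough to compare two chords of the same class.\<close>
definition collapse :: "real \<Rightarrow> nat \<Rightarrow> int \<times> int \<Rightarrow> real \<Rightarrow> real \<Rightarrow> bool" where
  "collapse \<theta> t q x y \<longleftrightarrow> x \<in> F \<and> y \<in> F \<and> \<not> int d dvd fst q \<and> \<lfloor>4 * real d * orb t x\<rfloor> = snd q \<and>
     0 < real d * orb t y - real d * orb t x - of_int (fst q) \<and>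
     real d * orb t y - real d * orb t x - of_int (fst q) < \<theta>"

definition classes :: "(int \<times> int) set" where
  "classes = {- int d..int d} \<times> {0..4 * int d}"

lemma collapse_class:
  assumes "collapse \<theta> t q x y" "\<theta> \<le> 1"
  shows "q \<in> classes"
proof -
  obtain j c where q: "q = (j, c)" by (cases q)
  have x: "x \<in> F" and y: "y \<in> F" and c: "\<lfloor>4 * real d * orb t x\<rfloor> = c"
    and j: "0 < real d * orb t y - real d * orb t x - of_int j" "real d * orb t y - real d * orb t x - of_int j < 1"
    using assms by (auto simp: collapse_def q)
  have b: "0 \<le> real d * orb t x" "real d * orb t x < real d" "0 \<le> real d * orb t y" "real d * orb t y < real d"
    using orb01[OF x, of t] orb01[OF y, of t] d by auto
  have "c \<ge> 0" using b c by auto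
  moreover have "c \<le> 4 * int d"
  proof -
    have "4 * real d * orb t x < of_int (4 * int d) + 1"
      using b(2) unfolding of_int_mult of_int_numeral of_int_of_nat_eq by linarith
    then show ?thesis unfolding c[symmetric] by (rule floor_le_iff[THEN iffD2])
  qed
  moreover have "real_of_int j < real d" "- real d - 1 < real_of_int j" using b j by linarith+
  then have "j < int d" "- int d - 1 < j" by linarith+
  ultimately show ?thesis by (auto simp: classes_def q)
qed

text \<open>Go back in time from the close pair. As long as no collapse has taken place, each step divides the distance
by \<open>d\<close>, but initially the distance is at least \<open>\<theta>\<close>.\<close>
lemma near_traces_to_collapse:
  assumes x: "x \<in> F" and y: "y \<in> F" and ne: "x \<noteq> y" and \<theta>: "0 < \<theta>" "\<theta> \<le> 1"
    and n0: "\<not> near_mod1 \<theta> x y" and near: "near_mod1 \<theta> (orb n x) (orb n y)"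
  shows "\<exists>t q. t < n \<and> (collapse \<theta> t q x y \<or> collapse \<theta> t q y x)"
proof -
  define k where "k = (LEAST k. near_mod1 \<theta> (orb k x) (orb k y))"
  have k: "near_mod1 \<theta> (orb k x) (orb k y)" "k \<le> n"
    using near unfolding k_def by (auto intro: LeastI Least_le)
  have "k \<noteq> 0" using k(1) n0 by (metis funpow_0)
  then obtain t where t: "k = Suc t" by (cases k) auto
  have nt: "\<not> near_mod1 \<theta> (orb t x) (orb t y)"
    using not_less_Least[of t "\<lambda>k. near_mod1 \<theta> (orb k x) (orb k y)"] t k_def by auto
  obtain m :: int where m: "\<bar>orb k x - orb k y + of_int m\<bar> < \<theta>" using k(1) by (auto simp: near_mod1_def)
  define m' where "m' = m - \<lfloor>real d * orb t x\<rfloor> + \<lfloor>real d * orb t y\<rfloor>"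
  have m': "\<bar>real d * orb t x - real d * orb t y + of_int m'\<bar> < \<theta>"
    using m by (simp add: t angle_mult_def frac_def m'_def algebra_simps)
  have nd: "\<not> int d dvd m'"
  proof
    assume "int d dvd m'"
    then obtain i where i: "m' = int d * i" by auto
    have "real d * (orb t x - orb t y + of_int i) = real d * orb t x - real d * orb t y + of_int m'"
      by (simp add: i algebra_simps)
    then have "real d * \<bar>orb t x - orb t y + of_int i\<bar> < \<theta>" using m' by (metis abs_mult abs_of_nat)
    moreover have "\<bar>orb t x - orb t y + of_int i\<bar> \<le> real d * \<bar>orb t x - orb t y + of_int i\<bar>"
      using d by (simp add: mult_le_cancel_right1)
    ultimately have "\<bar>orb t x - orb t y + of_int i\<bar> < \<theta>" by linarith
    then show False using nt by (auto simp: near_mod1_def)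
  qed
  have "real d * orb t x - real d * orb t y + of_int m' \<noteq> 0"
  proof
    assume "real d * orb t x - real d * orb t y + of_int m' = 0"
    then have "real d * orb t y = real d * orb t x + of_int m'" by simp
    then have "orb k y = orb k x"
      by (simp add: t angle_mult_def frac_def)
    then show False using inj[of k] x y ne by (auto dest: inj_onD)
  qed
  then consider "0 < real d * orb t x - real d * orb t y + of_int m'" | "0 < real d * orb t y - real d * orb t x - of_int m'"
    by linarith
  then show ?thesis
  proof cases
    case 1
    then have "collapse \<theta> t (-m', \<lfloor>4 * real d * orb t y\<rfloor>) y x"
      using m' nd x y by (simp add: collapse_def)
    then show ?thesis using t k(2) by (meson Suc_le_lessD)
  next
    case 2
    then have "collapse \<theta> t (m', \<lfloor>4 * real d * orb t x\<rfloor>) x y"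
      using m' nd x y by (simp add: collapse_def abs_if split: if_splits)
    then show ?thesis using t k(2) by (meson Suc_le_lessD)
  qed
qed

text \<open>The preimage of an arc of length \<open>s\<close> under multiplication by \<open>d\<close> consists of \<open>d\<close> arcs of length \<open>s / d\<close>, so two
of the points share one of them.\<close>
lemma arc_pigeonhole:
  assumes G: "G \<subseteq> F" "card G > d" and s: "s \<le> \<theta>"
    and arc: "\<And>z. z \<in> G \<Longrightarrow> \<exists>i::int. u < real d * orb t z + of_int i \<and> real d * orb t z + of_int i < u + s"
  shows "\<exists>x\<in>G. \<exists>y\<in>G. x \<noteq> y \<and> near_mod1 \<theta> (orb t x) (orb t y)"
proof -
  obtain i :: "real \<Rightarrow> int" where i: "\<And>z. z \<in> G \<Longrightarrow> u < real d * orb t z + of_int (i z) \<and> real d * orb t z + of_int (i z) < u + s"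
    using arc by metis
  have "\<not> inj_on (\<lambda>z. i z mod int d) G"
  proof
    assume *: "inj_on (\<lambda>z. i z mod int d) G"
    have "(\<lambda>z. i z mod int d) ` G \<subseteq> {0..<int d}" using d by auto
    from card_inj_on_le[OF * this] have "card G \<le> d" by simp
    then show False using G by simp
  qed
  then obtain x y where xy: "x \<in> G" "y \<in> G" "x \<noteq> y" "i x mod int d = i y mod int d" by (auto simp: inj_on_def)
  then obtain m where m: "i x - i y = int d * m" by (metis mod_eq_dvd_iff dvd_def)
  have "\<bar>(real d * orb t x + of_int (i x)) - (real d * orb t y + of_int (i y))\<bar> < s"
    using i[OF xy(1)] i[OF xy(2)] by auto
  moreover have "(real d * orb t x + of_int (i x)) - (real d * orb t y + of_int (i y)) = real d * (orb t x - orb t y + of_int m)"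
  proof -
    have "real_of_int (i x) - real_of_int (i y) = real d * of_int m"
      by (metis m of_int_diff of_int_mult of_int_of_nat_eq)
    then show ?thesis by (simp add: algebra_simps)
  qed
  ultimately have "real d * \<bar>orb t x - orb t y + of_int m\<bar> < s" by (simp add: abs_mult)
  moreover have "\<bar>orb t x - orb t y + of_int m\<bar> \<le> real d * \<bar>orb t x - orb t y + of_int m\<bar>"
    using d by (simp add: mult_le_cancel_right1)
  ultimately have "\<bar>orb t x - orb t y + of_int m\<bar> < \<theta>" using s by linarith
  then have "near_mod1 \<theta> (orb t x) (orb t y)" unfolding near_mod1_def by blast
  then show ?thesis using xy by blast
qed

text \<open>The chords from \<open>x\<close> to \<open>y\<close> and from \<open>x'\<close> to \<open>y'\<close> are nearly equal and do not cross, so moving the first end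
forward moves the second end back. Hence the images of \<open>x'\<close> and \<open>y'\<close> lie on the short arc from the image of
\<open>x\<close> to the image of \<open>y\<close>, and by unlinkedness the entire image of \<open>F\<close> at time \<open>t' + 1\<close> does. One step
earlier, at time \<open>t'\<close>, it lies in \<open>d\<close> arcs shorter than \<open>\<theta>\<close>.\<close>
lemma same_class_ordered:
  assumes c: "collapse \<theta> t q x y" and c': "collapse \<theta> t' q x' y'" and ne: "t \<noteq> t'"
    and \<theta>: "\<theta> \<le> 1/2" and lt: "orb t x < orb t' x'" and G: "G \<subseteq> F" "card G > d"
  shows "\<exists>z\<in>G. \<exists>w\<in>G. z \<noteq> w \<and> near_mod1 \<theta> (orb t' z) (orb t' w)"
proof -
  obtain j cc where q: "q = (j, cc)" by (cases q)
  define X where "X = orb t x"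
  define Y where "Y = orb t y"
  define X' where "X' = orb t' x'"
  define Y' where "Y' = orb t' y'"
  define s where "s = real d * Y - real d * X - of_int j"
  define s' where "s' = real d * Y' - real d * X' - of_int j"
  have F: "x \<in> F" "y \<in> F" "x' \<in> F" "y' \<in> F" and nd: "\<not> int d dvd j"
    and s: "0 < s" "s < \<theta>" and s': "0 < s'" "s' < \<theta>"
    and cell: "\<lfloor>4 * real d * X\<rfloor> = cc" "\<lfloor>4 * real d * X'\<rfloor> = cc"
    using c c' by (auto simp: collapse_def q X_def Y_def X'_def Y'_def s_def s'_def)
  have lt: "X < X'" using lt by (simp add: X_def X'_def)
  have d0: "0 < real d" using d by simp
  have close: "real d * X' - real d * X < 1/4"
  proof -
    have "4 * real d * X' - 4 * real d * X < 1" using cell by linarith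
    then show ?thesis by simp
  qed
  have un: "unlinked (orb t ` F) (orb t' ` F)" by (rule unl[OF ne])
  have Y: "Y \<in> orb t ` F" "X \<in> orb t ` F" and Y': "Y' \<in> orb t' ` F" "X' \<in> orb t' ` F"
    using F by (auto simp: X_def Y_def X'_def Y'_def)
  have neY: "Y \<noteq> Y'" using un Y Y' by (auto simp: unlinked_def)
  have "Y' < Y"
  proof (rule ccontr)
    assume "\<not> Y' < Y"
    then have YY: "Y < Y'" using neY by simp
    have "j \<noteq> 0" using nd by auto
    then consider "j \<ge> 1" | "j \<le> -1" by linarith
    then show False
    proof cases
      case 1
      then have "real d * Y - real d * X > 1" using s s_def by linarith
      then have "real d * X' < real d * Y" using close by linarith
      then have "X' < Y" using d0 by simp
      then show False using unlinkedD(1)[OF un Y(2,1) Y'(2,1)] lt YY by simp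
    next
      case 2
      then have "real_of_int j \<le> -1" by linarith
      then have "real d * Y' - real d * X' < -1 + 1/2" using s' s'_def \<theta> by linarith
      then have "real d * Y' < real d * X" using close by linarith
      then have "Y' < X" using d0 by simp
      then show False using unlinkedD(1)[OF un Y(1,2) Y'(1,2)] lt YY by simp
    qed
  qed
  then have dY: "real d * Y' < real d * Y" using d0 by simp
  have dX: "real d * X < real d * X'" using d0 lt by simp
  have arc: "\<exists>i::int. real d * X < real d * orb t' z + of_int i \<and> real d * orb t' z + of_int i < real d * X + s" if "z \<in> G" for z
  proof (rule unlinked_arc[OF unl[of "Suc t" "Suc t'"]])
    show "Suc t \<noteq> Suc t'" using ne by simp
    show "0 < s" "s < 1" using s \<theta> by auto
    show "real d * X < real d * X'" by (rule dX)
    show "real d * X' < real d * X + s" using dY s' by (simp add: s_def s'_def)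
    show "frac (real d * X) \<in> orb (Suc t) ` F" using F by (auto simp: angle_mult_def X_def)
    have "real d * X + s = real d * Y - of_int j" by (simp add: s_def)
    then have "frac (real d * X + s) = orb (Suc t) y"
      by (simp add: angle_mult_def Y_def frac_def)
    then show "frac (real d * X + s) \<in> orb (Suc t) ` F" using F by auto
    show "frac (real d * X') \<in> orb (Suc t') ` F" using F by (auto simp: angle_mult_def X'_def)
    show "frac (real d * orb t' z) \<in> orb (Suc t') ` F" using that G by (auto simp: angle_mult_def)
  qed
  show ?thesis by (rule arc_pigeonhole[OF G _ arc]) (use s in auto)
qed

lemma same_class:
  assumes c: "collapse \<theta> t q x y" and c': "collapse \<theta> t' q x' y'" and ne: "t \<noteq> t'"
    and \<theta>: "\<theta> \<le> 1/2" and G: "G \<subseteq> F" "card G > d"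
  shows "\<exists>u\<in>{t,t'}. \<exists>z\<in>G. \<exists>w\<in>G. z \<noteq> w \<and> near_mod1 \<theta> (orb u z) (orb u w)"
proof -
  have "orb t x \<in> orb t ` F" "orb t' x' \<in> orb t' ` F" using c c' by (auto simp: collapse_def)
  then have "orb t x \<noteq> orb t' x'" using unl[OF ne] by (metis disjoint_iff unlinked_def)
  then consider "orb t x < orb t' x'" | "orb t' x' < orb t x" by linarith
  then show ?thesis
    using same_class_ordered[OF c c' ne \<theta> _ G] same_class_ordered[OF c' c ne[symmetric] \<theta> _ G] by cases auto
qed

text \<open>In a collapse of class \<open>(j, c)\<close> the first point lies in the cell \<open>c\<close> and the second one does not. Keeping the
larger of the two parts of \<open>F\<close>, inside and outside the cell, destroys all collapses of this class and time at
the price of a factor 2.\<close>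
lemma collapse_free_subset:
  assumes "finite E" "\<theta> \<le> 1/2"
  shows "\<exists>G\<subseteq>F. card F \<le> 2 ^ card E * card G \<and> (\<forall>(t,q)\<in>E. \<forall>x\<in>G. \<forall>y\<in>G. \<not> collapse \<theta> t q x y)"
  using assms
proof (induction E rule: finite_induct)
  case empty
  show ?case by (intro exI[of _ F]) auto
next
  case (insert e E)
  then obtain G where G: "G \<subseteq> F" "card F \<le> 2 ^ card E * card G"
    "\<forall>(t,q)\<in>E. \<forall>x\<in>G. \<forall>y\<in>G. \<not> collapse \<theta> t q x y" by auto
  obtain t j c where e: "e = (t, (j, c))" by (cases e) auto
  define X where "X = {x \<in> G. \<lfloor>4 * real d * orb t x\<rfloor> = c}"
  have finG: "finite G" using G fin finite_subset by blast
  have X: "\<not> collapse \<theta> t (j,c) x y" if "x \<in> X" "y \<in> X" for x y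
  proof
    assume "collapse \<theta> t (j,c) x y"
    then have nd: "\<not> int d dvd j" and b: "0 < real d * orb t y - real d * orb t x - of_int j"
      "real d * orb t y - real d * orb t x - of_int j < 1/2" using insert.prems by (auto simp: collapse_def)
    have "\<bar>4 * real d * orb t y - 4 * real d * orb t x\<bar> < 1" using that by (auto simp: X_def) linarith
    then have "\<bar>real d * orb t y - real d * orb t x\<bar> < 1/4" by (simp add: abs_if split: if_splits)
    then have "\<bar>real_of_int j\<bar> < 1" using b by linarith
    then have "j = 0" by linarith
    then show False using nd by simp
  qed
  have Y: "\<not> collapse \<theta> t (j,c) x y" if "x \<in> G - X" for x y
    using that by (auto simp: X_def collapse_def)
  have c: "card G = card X + card (G - X)"
    by (metis (no_types, lifting) X_def card_Un_disjoint Diff_disjoint finG finite_Diff finite_Int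
        Un_Diff_cancel Un_absorb1 finite_subset mem_Collect_eq subsetI)
  define G' where "G' = (if card X \<ge> card (G - X) then X else G - X)"
  have G': "G' \<subseteq> G" by (auto simp: G'_def X_def)
  have c': "card G \<le> 2 * card G'" using c by (auto simp: G'_def)
  have "card F \<le> 2 ^ card (insert e E) * card G'"
  proof -
    have "card F \<le> 2 ^ card E * (2 * card G')"
      using G(2) c' by (meson le_trans mult_le_mono2)
    then show ?thesis using insert.hyps by (simp add: ac_simps)
  qed
  moreover have "\<forall>(t,q)\<in>insert e E. \<forall>x\<in>G'. \<forall>y\<in>G'. \<not> collapse \<theta> t q x y"
  proof (intro ballI)
    fix p x y assume p: "p \<in> insert e E"
    show "case p of (t, q) \<Rightarrow> \<forall>x\<in>G'. \<forall>y\<in>G'. \<not> collapse \<theta> t q x y"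
    proof (cases "p = e")
      case True
      then show ?thesis using X Y e by (auto simp: G'_def)
    next
      case False
      then show ?thesis using G(3) G' p by blast
    qed
  qed
  ultimately show ?case using G' G(1) by (intro exI[of _ G']) auto
qed

lemma initial_gap: "\<exists>\<theta>. 0 < \<theta> \<and> \<theta> \<le> 1/2 \<and> (\<forall>x\<in>F. \<forall>y\<in>F. x \<noteq> y \<longrightarrow> \<not> near_mod1 \<theta> x y)"
proof -
  have "\<exists>\<theta>>0. \<forall>p\<in>P. (case p of (x,y) \<Rightarrow> x \<noteq> y \<longrightarrow> \<not> near_mod1 \<theta> x y)" if "finite P" "P \<subseteq> F \<times> F" for P
    using that
  proof (induction P rule: finite_induct)
    case empty show ?case by (auto intro: exI[of _ 1])
  next
    case (insert p P)
    then obtain \<theta> where \<theta>: "\<theta> > 0" "\<forall>p\<in>P. (case p of (x,y) \<Rightarrow> x \<noteq> y \<longrightarrow> \<not> near_mod1 \<theta> x y)" by auto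
    obtain x y where p: "p = (x, y)" by (cases p)
    have xy: "0 \<le> x" "x < 1" "0 \<le> y" "y < 1" using insert.prems p F01 by auto
    define \<eta> where "\<eta> = (if x = y then 1 else min \<bar>x - y\<bar> (1 - \<bar>x - y\<bar>))"
    have \<eta>: "\<eta> > 0" using xy by (auto simp: \<eta>_def)
    have n: "\<not> near_mod1 \<eta> x y" if "x \<noteq> y"
    proof
      assume "near_mod1 \<eta> x y"
      then obtain m :: int where m: "\<bar>x - y + of_int m\<bar> < \<eta>" by (auto simp: near_mod1_def)
      then have b: "\<bar>x - y + of_int m\<bar> < \<bar>x - y\<bar>" "\<bar>x - y + of_int m\<bar> < 1 - \<bar>x - y\<bar>" using that by (auto simp: \<eta>_def)
      consider "m = 0" | "real_of_int m \<ge> 1" | "real_of_int m \<le> -1" by linarith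
      then show False
      proof cases
        case 1
        then show False using b by simp
      next
        case 2
        then show False using b xy by linarith
      next
        case 3
        then show False using b xy by linarith
      qed
    qed
    have m: "near_mod1 \<theta> a b" "near_mod1 \<eta> a b" if "near_mod1 (min \<theta> \<eta>) a b" for a b
      using that near_mod1_mono by (meson min.cobounded1, meson min.cobounded2 near_mod1_mono)
    show ?case
      using \<theta> \<eta> n m by (intro exI[of _ "min \<theta> \<eta>"]) (auto simp: p)
  qed
  from this[of "F \<times> F"] fin obtain \<theta> where "\<theta> > 0" "\<forall>x\<in>F. \<forall>y\<in>F. x \<noteq> y \<longrightarrow> \<not> near_mod1 \<theta> x y"
    by auto
  then show ?thesis
    by (intro exI[of _ "min \<theta> (1/2)"]) (auto dest: near_mod1_mono[where \<delta>=\<theta>])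
qed

text \<open>At two different times the three points occupy the same three cells of a fine partition. Going around the
two triangles, non-crossing sides force the vertices to move alternately forward and back, which is
impossible for an odd number of vertices.\<close>
lemma three_points_approach:
  assumes xyz: "x \<in> F" "y \<in> F" "z \<in> F" and \<theta>: "\<theta> > 0"
    and sep: "\<And>n. \<theta> \<le> \<bar>orb n x - orb n y\<bar>" "\<And>n. \<theta> \<le> \<bar>orb n y - orb n z\<bar>" "\<And>n. \<theta> \<le> \<bar>orb n x - orb n z\<bar>"
  shows False
proof -
  obtain M :: nat where M: "1 / \<theta> < real M" using reals_Archimedean2 by blast
  then have M0: "real M > 0" using \<theta> by (smt (verit) divide_pos_pos zero_less_one_class.zero_less_one)
  have M\<theta>: "1 < real M * \<theta>" using M \<theta> by (simp add: field_simps)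
  define cell where "cell = (\<lambda>r. \<lfloor>real M * r\<rfloor>)"
  define T where "T = (\<lambda>n. (cell (orb n x), cell (orb n y), cell (orb n z)))"
  have rng: "cell (orb n w) \<in> {0..int M}" if "w \<in> F" for w n
  proof -
    have "0 \<le> real M * orb n w" "real M * orb n w \<le> real M" using orb01[OF that, of n] M0 by (auto simp: mult_le_cancel_left1)
    then show ?thesis unfolding cell_def by (auto simp: floor_le_iff)
  qed
  have "range T \<subseteq> {0..int M} \<times> {0..int M} \<times> {0..int M}" using rng xyz by (auto simp: T_def simp del: atLeastAtMost_iff)
  then have "finite (range T)" by (rule finite_subset) auto
  then have "\<not> inj T" using finite_imageD by blast
  then obtain m n where mn: "m \<noteq> n" "T m = T n" by (auto simp: inj_def)
  have un: "unlinked (orb m ` F) (orb n ` F)" by (rule unl[OF mn(1)])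
  have cl: "\<bar>orb m w - orb n w\<bar> < \<theta>" if "w \<in> {x,y,z}" for w
  proof -
    have "cell (orb m w) = cell (orb n w)" using mn(2) that by (auto simp: T_def)
    then have "\<bar>real M * orb m w - real M * orb n w\<bar> < 1" unfolding cell_def by linarith
    then have "real M * \<bar>orb m w - orb n w\<bar> < 1" using M0 by (metis abs_mult abs_of_nat right_diff_distrib)
    then have "real M * \<bar>orb m w - orb n w\<bar> < real M * \<theta>" using M\<theta> by linarith
    then show ?thesis using M0 by simp
  qed
  have ord: "cell (orb k v) < cell (orb k w)" if "orb k v < orb k w" "v \<in> {x,y,z}" "w \<in> {x,y,z}" for k v w
  proof -
    have "orb k w - orb k v \<ge> \<theta>" using that sep[of k] by auto
    then have "real M * (orb k w - orb k v) \<ge> real M * \<theta>" using M0 by simp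
    then have "real M * orb k w - real M * orb k v > 1" using M\<theta> by (simp add: algebra_simps)
    then show ?thesis unfolding cell_def by linarith
  qed
  have cross: "orb m v < orb n w \<and> orb n v < orb m w" if "orb m v < orb m w" "v \<in> {x,y,z}" "w \<in> {x,y,z}" for v w
  proof -
    have "cell (orb m v) < cell (orb m w)" by (rule ord[OF that])
    moreover have "cell (orb m v) = cell (orb n v)" "cell (orb m w) = cell (orb n w)" using mn(2) that by (auto simp: T_def)
    ultimately have "cell (orb m v) < cell (orb n w)" "cell (orb n v) < cell (orb m w)" by auto
    then show ?thesis unfolding cell_def using M0
      by (meson floor_less_cancel mult_less_cancel_left_pos)
  qed
  have key: "False" if "orb m u < orb m v" "orb m v < orb m w" "u \<in> {x,y,z}" "v \<in> {x,y,z}" "w \<in> {x,y,z}" for u v w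
  proof -
    note c1 = cross[OF that(1,3,4)] and c2 = cross[OF that(2,4,5)]
    have "orb m u < orb m w" using that by simp
    note c3 = cross[OF this that(3,5)]
    have mem: "orb m u \<in> orb m ` F" "orb m v \<in> orb m ` F" "orb m w \<in> orb m ` F"
      "orb n u \<in> orb n ` F" "orb n v \<in> orb n ` F" "orb n w \<in> orb n ` F" using that xyz by auto
    have ne: "orb m u \<noteq> orb n u" "orb m v \<noteq> orb n v" "orb m w \<noteq> orb n w"
      using un mem by (metis disjoint_iff unlinked_def)+
    note l1 = unlinkedD[OF un mem(1,2,4,5)] and l2 = unlinkedD[OF un mem(2,3,5,6)]
      and l3 = unlinkedD[OF un mem(1,3,4,6)]
    show False
    proof (cases "orb m u < orb n u")
      case True
      then have "orb n v < orb m v" using l1(1) c1 ne by force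
      then have "orb m w < orb n w" using l2(2) c2 ne by force
      then show False using l3(1) c3 True by simp
    next
      case False
      then have u: "orb n u < orb m u" using ne by simp
      then have "orb m v < orb n v" using l1(2) c1 ne by force
      then have "orb n w < orb m w" using l2(1) c2 ne by force
      then show False using l3(2) c3 u by simp
    qed
  qed
  have ne: "orb m x \<noteq> orb m y" "orb m y \<noteq> orb m z" "orb m x \<noteq> orb m z" using sep[of m] \<theta> by auto
  have mem: "x \<in> {x,y,z}" "y \<in> {x,y,z}" "z \<in> {x,y,z}" by auto
  show False
  proof (cases "orb m x < orb m y")
    case ab: True
    show False
    proof (cases "orb m y < orb m z")
      case True
      show False by (rule key[OF ab True mem(1,2,3)])
    next
      case False
      then have cb: "orb m z < orb m y" using ne by simp
      show False
      proof (cases "orb m x < orb m z")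
        case True
        show False by (rule key[OF True cb mem(1,3,2)])
      next
        case False
        then have ca: "orb m z < orb m x" using ne by simp
        show False by (rule key[OF ca ab mem(3,1,2)])
      qed
    qed
  next
    case False
    then have ab: "orb m y < orb m x" using ne by simp
    show False
    proof (cases "orb m x < orb m z")
      case True
      show False by (rule key[OF ab True mem(2,1,3)])
    next
      case False
      then have cb: "orb m z < orb m x" using ne by simp
      show False
      proof (cases "orb m y < orb m z")
        case True
        show False by (rule key[OF True cb mem(2,3,1)])
      next
        case False
        then have ca: "orb m z < orb m y" using ne by simp
        show False by (rule key[OF ca ab mem(3,2,1)])
      qed
    qed
  qed
qed

text \<open>A class can host collapses at one time only. At the first repetition at most one collapse time per class has gone
by, so more than \<open>d\<close> points can be selected that have not come close yet, contrary to \<open>same_class\<close>. Therefore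
the number of pairs (time, class) is bounded once and for all, and the same selection yields three points
that never come close, contrary to \<open>three_points_approach\<close>.\<close>
proposition card_wandering_angles: "card F < 2 ^ card classes * (d + 1)"
proof (rule ccontr)
  assume "\<not> ?thesis"
  then have big: "2 ^ card classes * (d + 1) \<le> card F" by simp
  obtain \<theta> where \<theta>: "0 < \<theta>" "\<theta> \<le> 1/2" and gap: "\<And>x y. x \<in> F \<Longrightarrow> y \<in> F \<Longrightarrow> x \<noteq> y \<Longrightarrow> \<not> near_mod1 \<theta> x y"
    using initial_gap by blast
  define Ev where "Ev = {(t, q). \<exists>x y. collapse \<theta> t q x y}"
  have finc: "finite classes" by (simp add: classes_def)
  have large: "\<exists>G\<subseteq>F. card G > d \<and> (\<forall>(t,q)\<in>E. \<forall>x\<in>G. \<forall>y\<in>G. \<not> collapse \<theta> t q x y)"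
    if "inj_on snd E" "E \<subseteq> Ev" for E
  proof -
    have sub: "snd ` E \<subseteq> classes" using that(2) collapse_class \<theta> by (force simp: Ev_def)
    have "finite E" using finite_subset[OF sub finc] that(1) finite_imageD by blast
    moreover have "card E \<le> card classes" by (rule card_inj_on_le[OF that(1) sub finc])
    ultimately obtain G where G: "G \<subseteq> F" "card F \<le> 2 ^ card E * card G"
      "\<forall>(t,q)\<in>E. \<forall>x\<in>G. \<forall>y\<in>G. \<not> collapse \<theta> t q x y" using collapse_free_subset[of E \<theta>] \<theta> by auto
    have "2 ^ card classes * (d + 1) \<le> 2 ^ card E * card G" using big G(2) by linarith
    also have "\<dots> \<le> 2 ^ card classes * card G" using \<open>card E \<le> card classes\<close> by (intro mult_right_mono power_increasing) auto
    finally have "d + 1 \<le> card G" by (rule mult_left_le_imp_le) simp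
    then show ?thesis using G by (intro exI[of _ G]) auto
  qed
  have apart: "\<not> near_mod1 \<theta> (orb n x) (orb n y)"
    if A: "x \<in> G" "y \<in> G" "x \<noteq> y" "G \<subseteq> F" "n \<le> N"
      "\<forall>(t,q)\<in>{e\<in>Ev. fst e < N}. \<forall>x\<in>G. \<forall>y\<in>G. \<not> collapse \<theta> t q x y" for G x y n N
  proof
    assume near: "near_mod1 \<theta> (orb n x) (orb n y)"
    have xy: "x \<in> F" "y \<in> F" using that by auto
    obtain t q where tq: "t < n" "collapse \<theta> t q x y \<or> collapse \<theta> t q y x"
      using near_traces_to_collapse[OF xy A(3) \<theta>(1) _ gap[OF xy A(3)] near] \<theta> by auto
    then have "(t,q) \<in> {e\<in>Ev. fst e < N}" using A(5) by (auto simp: Ev_def)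
    then have "\<forall>x\<in>G. \<forall>y\<in>G. \<not> collapse \<theta> t q x y" using A(6) by blast
    then show False using A tq by blast
  qed
  \<comment> \<open>No class occurs at two different times; t2 is the time of the first repetition.\<close>
  have unique: "inj_on snd Ev"
  proof (rule ccontr)
    assume "\<not> inj_on snd Ev"
    then have ex: "\<exists>t2 t1 q. t1 < t2 \<and> (t1,q) \<in> Ev \<and> (t2,q) \<in> Ev"
      by (auto simp: inj_on_def) (metis linorder_neqE_nat)
    define t2 where "t2 = (LEAST t2. \<exists>t1 q. t1 < t2 \<and> (t1,q) \<in> Ev \<and> (t2,q) \<in> Ev)"
    obtain t1 q where t: "t1 < t2" "(t1,q) \<in> Ev" "(t2,q) \<in> Ev"
      using LeastI_ex[OF ex] unfolding t2_def by blast
    have least: "\<not> (\<exists>t1 q. t1 < t \<and> (t1,q) \<in> Ev \<and> (t,q) \<in> Ev)" if "t < t2" for t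
      using not_less_Least[OF that[unfolded t2_def]] .
    have "inj_on snd {e\<in>Ev. fst e < t2}"
    proof (rule inj_onI)
      fix e e' assume e: "e \<in> {e\<in>Ev. fst e < t2}" "e' \<in> {e\<in>Ev. fst e < t2}" "snd e = snd e'"
      then obtain a b r where "e = (a, r)" "e' = (b, r)" by (metis surjective_pairing)
      then show "e = e'" using e least[of a] least[of b] by (metis (mono_tags, lifting) fst_conv linorder_neqE_nat mem_Collect_eq)
    qed
    from large[OF this] obtain G where G: "G \<subseteq> F" "card G > d"
      "\<forall>(t,q)\<in>{e\<in>Ev. fst e < t2}. \<forall>x\<in>G. \<forall>y\<in>G. \<not> collapse \<theta> t q x y" by auto
    obtain x y x' y' where c: "collapse \<theta> t1 q x y" "collapse \<theta> t2 q x' y'" using t by (auto simp: Ev_def)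
    from same_class[OF c _ \<theta>(2) G(1,2)] t(1)
    obtain u z w where u: "u \<in> {t1,t2}" "z \<in> G" "w \<in> G" "z \<noteq> w" "near_mod1 \<theta> (orb u z) (orb u w)" by auto
    then show False using apart[OF u(2,3,4) G(1) _ G(3), of u] t(1) by auto
  qed
  obtain G where G: "G \<subseteq> F" "card G > d" "\<forall>(t,q)\<in>Ev. \<forall>x\<in>G. \<forall>y\<in>G. \<not> collapse \<theta> t q x y"
    using large[OF unique] by auto
  have "card G \<ge> 3" using G(2) d by simp
  then obtain T where "T \<subseteq> G" "card T = 3" by (meson obtain_subset_with_card_n)
  then obtain x y z where xyz: "x \<in> G" "y \<in> G" "z \<in> G" "x \<noteq> y" "y \<noteq> z" "x \<noteq> z"
    by (auto simp: card_3_iff)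
  have sep: "\<theta> \<le> \<bar>orb n v - orb n w\<bar>" if "v \<in> G" "w \<in> G" "v \<noteq> w" for n v w
  proof -
    have "\<not> near_mod1 \<theta> (orb n v) (orb n w)"
      by (rule apart[OF that G(1) order_refl]) (use G(3) in auto)
    then have "\<not> \<bar>orb n v - orb n w + of_int 0\<bar> < \<theta>" unfolding near_mod1_def by blast
    then show ?thesis by simp
  qed
  show False
    by (rule three_points_approach[of x y z \<theta>]) (use xyz G \<theta> sep in auto)
qed

end

section \<open>Length and area in an exterior coordinate\<close>

text \<open>A coordinate on the complement of \<open>K\<close> in logarithmic form: \<open>\<Phi>\<close> is the universal covering by the right
half-plane, with deck transformations the multiples of \<open>2 \<pi> \<i>\<close>. The imaginary axis corresponds to \<open>K\<close>, and
\<open>Re w\<close> is the value of the Green function at \<open>\<Phi> w\<close>.\<close>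
locale exterior_coordinate =
  fixes K :: "complex set" and \<Phi> :: "complex \<Rightarrow> complex"
  assumes compact_K: "compact K"
    and holo: "\<Phi> holomorphic_on {w. 0 < Re w}"
    and image: "\<Phi> ` {w. 0 < Re w} = - K"
    and fibre: "\<And>w w'. 0 < Re w \<Longrightarrow> 0 < Re w' \<Longrightarrow>
      \<Phi> w = \<Phi> w' \<longleftrightarrow> (\<exists>k::int. w - w' = 2 * of_real pi * of_int k * \<i>)"
    and bounded_strip: "bounded (\<Phi> ` {w. 0 < Re w \<and> Re w \<le> 1})"
    and to_infinity: "\<And>M. \<exists>R. \<forall>w. R < Re w \<longrightarrow> M < norm (\<Phi> w)"
begin

lemma open_RH: "open {w. 0 < Re w}"
  by (simp add: open_halfspace_Re_gt)

lemma Phi_notin: "0 < Re w \<Longrightarrow> \<Phi> w \<notin> K"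
  using image by blast

lemma Phi_onto: "v \<notin> K \<Longrightarrow> \<exists>w. 0 < Re w \<and> \<Phi> w = v"
  using image by (metis (mono_tags, lifting) ComplI imageE mem_Collect_eq)

lemma Re_eq: "0 < Re w \<Longrightarrow> 0 < Re w' \<Longrightarrow> \<Phi> w = \<Phi> w' \<Longrightarrow> Re w = Re w'"
proof -
  assume "0 < Re w" "0 < Re w'" "\<Phi> w = \<Phi> w'"
  then obtain k :: int where k: "w - w' = 2 * of_real pi * of_int k * \<i>" using fibre by auto
  have "Re (w - w') = 0" unfolding k by simp
  then show ?thesis by simp
qed

lemma inj_narrow:
  assumes "0 < Re w" "0 < Re w'" "\<Phi> w = \<Phi> w'" "\<bar>Im w - Im w'\<bar> < 2 * pi"
  shows "w = w'"
proof -
  obtain k :: int where k: "w - w' = 2 * of_real pi * of_int k * \<i>" using fibre assms by auto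
  have "Im (w - w') = 2 * pi * of_int k" unfolding k by simp
  then have "2 * pi * \<bar>of_int k\<bar> < 2 * pi * 1" using assms(4) by (simp add: abs_mult)
  then have "\<bar>real_of_int k\<bar> < 1" by (subst (asm) mult_less_cancel_left_pos) auto
  then have "k = 0" by linarith
  then show ?thesis using k by simp
qed

lemma Phi_periodic: "0 < Re w \<Longrightarrow> \<Phi> (w + 2 * of_real pi * of_int k * \<i>) = \<Phi> w"
  by (subst fibre) auto

lemma cont: "continuous_on {w. 0 < Re w} \<Phi>"
  using holo holomorphic_on_imp_continuous_on by blast

lemma open_Phi_image:
  assumes "open U" "U \<subseteq> {w. 0 < Re w}"
  shows "open (\<Phi> ` U)"
proof (rule open_mapping_thm[OF holo open_RH _ assms])
  show "connected {w. 0 < Re w}" by (intro convex_connected convex_halfspace_Re_gt)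
  show "\<not> \<Phi> constant_on {w. 0 < Re w}"
  proof
    assume "\<Phi> constant_on {w. 0 < Re w}"
    then have "\<Phi> 1 = \<Phi> 2" by (auto simp: constant_on_def)
    then have "Re 1 = Re 2" by (intro Re_eq) auto
    then show False by simp
  qed
qed

text \<open>Since \<open>Re w\<close> is determined by \<open>\<Phi> w\<close>, every point off \<open>K\<close> has a neighbourhood on which it is bounded away
from 0.\<close>
lemma cluster_at_boundary:
  assumes pos: "\<And>n. 0 < Re (u n)" and lim0: "(\<lambda>n. Re (u n)) \<longlonglongrightarrow> 0" and lim: "(\<lambda>n. \<Phi> (u n)) \<longlonglongrightarrow> v"
  shows "v \<in> frontier K"
proof -
  have "v \<in> K"
  proof (rule ccontr)
    assume "v \<notin> K"
    then obtain w where w: "0 < Re w" "\<Phi> w = v" using Phi_onto by blast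
    define U where "U = {z. Re w / 2 < Re z}"
    have U: "open U" "U \<subseteq> {w. 0 < Re w}" "w \<in> U"
      using w open_halfspace_Re_gt[of "Re w / 2"] by (auto simp: U_def)
    have "open (\<Phi> ` U)" by (rule open_Phi_image) (use U in auto)
    moreover have "v \<in> \<Phi> ` U" using U w by blast
    ultimately have ev: "eventually (\<lambda>n. \<Phi> (u n) \<in> \<Phi> ` U) sequentially" using lim topological_tendstoD by blast
    have "Re w / 2 > 0" using w by simp
    then have "eventually (\<lambda>n. Re (u n) < Re w / 2) sequentially" using lim0 order_tendstoD(2) by blast
    with ev have "eventually (\<lambda>n. False) sequentially"
    proof eventually_elim
      case (elim n)
      then obtain z where z: "z \<in> U" "\<Phi> (u n) = \<Phi> z" by auto
      then have "Re (u n) = Re z" using Re_eq pos U by blast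
      then show ?case using z elim by (simp add: U_def)
    qed
    then show False by simp
  qed
  moreover have "v \<in> closure (- K)"
    using lim Phi_notin[OF pos] by (auto simp: closure_sequential intro!: exI[of _ "\<lambda>n. \<Phi> (u n)"])
  ultimately show ?thesis using compact_K by (simp add: frontier_closures compact_imp_closed)
qed

definition collar :: "real \<Rightarrow> complex set" where
  "collar R = \<Phi> ` {w. 0 < Re w \<and> Re w < R}"

lemma collar_fmeasurable:
  assumes "R \<le> 1"
  shows "collar R \<in> fmeasurable lborel"
proof -
  have op: "open {w. 0 < Re w \<and> Re w < R}"
    using open_Int[OF open_halfspace_Re_gt[of 0] open_halfspace_Re_lt[of R]] by (simp add: Collect_conj_eq)
  have "open (collar R)" unfolding collar_def by (rule open_Phi_image[OF op]) auto
  moreover have "bounded (collar R)"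
    by (rule bounded_subset[OF bounded_strip]) (use assms in \<open>auto simp: collar_def\<close>)
  ultimately show ?thesis using emeasure_bounded_finite by (intro fmeasurableI) auto
qed

lemma measure_collar_tendsto: "(\<lambda>n. measure lborel (collar (1 / real (Suc n)))) \<longlonglongrightarrow> 0"
proof -
  have fm: "collar (1 / real (Suc n)) \<in> fmeasurable lborel" for n
    by (rule collar_fmeasurable) (simp add: field_simps)
  have "(\<lambda>n. measure lborel (collar (1 / real (Suc n)))) \<longlonglongrightarrow> measure lborel (\<Inter>n. collar (1 / real (Suc n)))"
  proof (rule Lim_measure_decseq)
    show "range (\<lambda>n. collar (1 / real (Suc n))) \<subseteq> sets lborel" using fm by (auto simp: fmeasurable_def)
    show "decseq (\<lambda>n. collar (1 / real (Suc n)))"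
    proof (unfold decseq_def collar_def, intro allI impI image_mono)
      fix m n :: nat assume "m \<le> n"
      then have "1 / real (Suc n) \<le> 1 / real (Suc m)" by (intro divide_left_mono) auto
      then show "{w. 0 < Re w \<and> Re w < 1 / real (Suc n)} \<subseteq> {w. 0 < Re w \<and> Re w < 1 / real (Suc m)}" by auto
    qed
    show "emeasure lborel (collar (1 / real (Suc i))) \<noteq> \<infinity>" for i using fm[of i] by (auto simp: fmeasurable_def)
  qed
  moreover have "(\<Inter>n. collar (1 / real (Suc n))) = {}"
  proof (rule ccontr)
    assume "\<not> ?thesis"
    then obtain v where v: "\<And>n. v \<in> collar (1 / real (Suc n))" by auto
    then obtain w where w: "0 < Re w" "v = \<Phi> w" by (auto simp: collar_def)
    obtain n where n: "1 / real (Suc n) < Re w" using w(1) reals_Archimedean by (auto simp: inverse_eq_divide)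
    obtain w' where "0 < Re w'" "Re w' < 1 / real (Suc n)" "v = \<Phi> w'" using v[of n] by (auto simp: collar_def)
    then show False using Re_eq[of w w'] w n by auto
  qed
  ultimately show ?thesis by simp
qed

lemma collar_mono: "R \<le> S \<Longrightarrow> collar R \<subseteq> collar S"
  by (auto simp: collar_def)

lemma small_collar:
  assumes "\<epsilon> > 0"
  obtains R where "0 < R" "R \<le> 1" "measure lborel (collar R) < \<epsilon>"
proof -
  have "eventually (\<lambda>n. measure lborel (collar (1 / real (Suc n))) < \<epsilon>) sequentially"
    using order_tendstoD(2)[OF measure_collar_tendsto assms] .
  then obtain n where "measure lborel (collar (1 / real (Suc n))) < \<epsilon>" by (auto simp: eventually_sequentially)
  then show ?thesis by (intro that[of "1 / real (Suc n)"]) (auto simp: field_simps)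
qed

text \<open>By Bloch's theorem the image of the disc of radius \<open>\<rho>\<close> about \<open>c\<close> contains a disc of radius
\<open>\<rho> \<bar>\<Phi>' c\<bar> / 12\<close>. Disjoint images therefore bound a sum of squares of derivatives by an area, which
is the input of the length-area method.\<close>
lemma area_lower_bound:
  assumes I: "finite I" and \<rho>: "0 < \<rho>" and R: "R \<le> 1"
    and sub: "\<And>i. i \<in> I \<Longrightarrow> ball (c i) \<rho> \<subseteq> {w. 0 < Re w \<and> Re w < R}"
    and disj: "\<And>i j. i \<in> I \<Longrightarrow> j \<in> I \<Longrightarrow> i \<noteq> j \<Longrightarrow> \<Phi> ` ball (c i) \<rho> \<inter> \<Phi> ` ball (c j) \<rho> = {}"
  shows "(\<Sum>i\<in>I. (\<rho> * norm (deriv \<Phi> (c i)))\<^sup>2) \<le> 144 * measure lborel (collar R)"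
proof -
  define s where "s = (\<lambda>i. \<rho> * norm (deriv \<Phi> (c i)) / 12)"
  have s0: "s i \<ge> 0" for i using \<rho> by (simp add: s_def)
  have "\<exists>b. ball b (s i) \<subseteq> \<Phi> ` ball (c i) \<rho>" if "i \<in> I" for i
  proof -
    have "\<Phi> holomorphic_on ball (c i) \<rho>" by (rule holomorphic_on_subset[OF holo]) (use sub[OF that] in auto)
    from Bloch[OF this \<rho>, of "s i"] show ?thesis unfolding s_def by blast
  qed
  then obtain b where b: "\<And>i. i \<in> I \<Longrightarrow> ball (b i) (s i) \<subseteq> \<Phi> ` ball (c i) \<rho>" by metis
  have "(\<Sum>i\<in>I. (s i)\<^sup>2) \<le> (\<Sum>i\<in>I. measure lborel (ball (b i) (s i)))"
  proof (rule sum_mono)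
    fix i
    have "measure lborel (ball (b i) (s i)) = pi * (s i)\<^sup>2" using content_ball[OF s0, of "b i" i] by (simp add: unit_ball_vol_2)
    moreover have "1 * (s i)\<^sup>2 \<le> pi * (s i)\<^sup>2" using pi_gt3 by (intro mult_right_mono) auto
    ultimately show "(s i)\<^sup>2 \<le> measure lborel (ball (b i) (s i))" by simp
  qed
  also have "\<dots> = measure lborel (\<Union>i\<in>I. ball (b i) (s i))"
  proof (rule measure_finite_Union[symmetric, OF I])
    show "(\<lambda>i. ball (b i) (s i)) ` I \<subseteq> sets lborel" by auto
    show "disjoint_family_on (\<lambda>i. ball (b i) (s i)) I"
      unfolding disjoint_family_on_def
    proof (intro ballI impI)
      fix i j assume ij: "i \<in> I" "j \<in> I" "i \<noteq> j"
      show "ball (b i) (s i) \<inter> ball (b j) (s j) = {}" using b[OF ij(1)] b[OF ij(2)] disj[OF ij] by blast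
    qed
    show "emeasure lborel (ball (b i) (s i)) \<noteq> \<infinity>" for i
      using emeasure_bounded_finite[of "ball (b i) (s i)"] by auto
  qed
  also have "\<dots> \<le> measure lborel (collar R)"
  proof (rule measure_mono_fmeasurable[OF _ _ collar_fmeasurable[OF R]])
    show "(\<Union>i\<in>I. ball (b i) (s i)) \<subseteq> collar R"
    proof
      fix v assume "v \<in> (\<Union>i\<in>I. ball (b i) (s i))"
      then obtain i where i: "i \<in> I" "v \<in> ball (b i) (s i)" by blast
      then have "v \<in> \<Phi> ` ball (c i) \<rho>" using b by blast
      then show "v \<in> collar R" using sub[OF i(1)] unfolding collar_def by blast
    qed
    show "(\<Union>i\<in>I. ball (b i) (s i)) \<in> sets lborel" by (auto intro!: borel_open)
  qed
  finally have "(\<Sum>i\<in>I. (s i)\<^sup>2) \<le> measure lborel (collar R)" .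
  moreover have "(\<Sum>i\<in>I. (\<rho> * norm (deriv \<Phi> (c i)))\<^sup>2) = 144 * (\<Sum>i\<in>I. (s i)\<^sup>2)"
    by (simp add: s_def sum_distrib_left power_divide)
  ultimately show ?thesis by simp
qed

text \<open>The disc of radius \<open>Re w / 2\<close> about \<open>w\<close> is mapped into a collar, whose area is small.\<close>
lemma deriv_small:
  assumes "\<epsilon> > 0"
  obtains r where "0 < r" "\<And>w. 0 < Re w \<Longrightarrow> Re w \<le> r \<Longrightarrow> Re w * norm (deriv \<Phi> w) \<le> \<epsilon>"
proof -
  obtain R where R: "0 < R" "R \<le> 1" "measure lborel (collar R) < (\<epsilon> / 2)\<^sup>2 / 144"
    using small_collar[of "(\<epsilon> / 2)\<^sup>2 / 144"] assms by auto
  show ?thesis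
  proof (rule that[of "R / 2"])
    show "0 < R / 2" using R by simp
    fix w assume w: "0 < Re w" "Re w \<le> R / 2"
    have "(\<Sum>i\<in>{w}. (Re w / 2 * norm (deriv \<Phi> i))\<^sup>2) \<le> 144 * measure lborel (collar R)"
    proof (rule area_lower_bound)
      show "ball i (Re w / 2) \<subseteq> {w. 0 < Re w \<and> Re w < R}" if "i \<in> {w}" for i
      proof
        fix z assume "z \<in> ball i (Re w / 2)"
        then have "norm (w - z) < Re w / 2" using that by (simp add: dist_norm)
        then have "\<bar>Re w - Re z\<bar> < Re w / 2" using abs_Re_le_cmod[of "w - z"] by simp
        then have "0 < Re z" "Re z < R" using w by linarith+
        then show "z \<in> {w. 0 < Re w \<and> Re w < R}" by simp
      qed
    qed (use w R in auto)
    then have "(Re w / 2 * norm (deriv \<Phi> w))\<^sup>2 \<le> (\<epsilon> / 2)\<^sup>2" using R by simp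
    then have "Re w / 2 * norm (deriv \<Phi> w) \<le> \<epsilon> / 2" using assms by (simp add: power2_le_iff_abs_le)
    then show "Re w * norm (deriv \<Phi> w) \<le> \<epsilon>" by simp
  qed
qed

text \<open>The length-area method. There are \<open>n\<close> horizontal lines at distance \<open>h = r / n\<close>, each cut into segments of
length \<open>h\<close>. Discs of radius \<open>h / 4\<close> about the points where the derivative is largest on its segment give a
bound, by area, for the sum over all segments of the squares of \<open>h\<close> times the maximal derivative. Some line
carries at most the \<open>n\<close>-th part of the sum, and the inequality of Cauchy and Schwarz, applied to the fewer
than \<open>n\<close> segments on it, bounds the length of its image independently of \<open>n\<close>. The discs reach slightly beyond
\<open>r\<close>, hence the collar of width \<open>2 r\<close>; the constant is \<open>16 \<sqdot> 2 \<sqdot> 144\<close>, for the radius \<open>h / 4\<close>, the two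
parities and Bloch's constant.\<close>
lemma quiet_line_discrete:
  assumes r: "0 < r" "2 * r \<le> 1" and n: "0 < (n::nat)"
  shows "\<exists>y. y0 \<le> y \<and> y \<le> y0 + r \<and> (\<forall>x x'. r / real n \<le> x \<and> x \<le> r \<and> r / real n \<le> x' \<and> x' \<le> r \<longrightarrow>
    dist (\<Phi> (Complex x y)) (\<Phi> (Complex x' y)) \<le> 2 * sqrt (4608 * measure lborel (collar (2 * r))))"
proof -
  define m where "m = measure lborel (collar (2 * r))"
  define h where "h = r / real n"
  have h: "0 < h" "real n * h = r" using r n by (auto simp: h_def)
  define Y where "Y = (\<lambda>k::nat. y0 + (real k + 1/2) * h)"
  define Seg where "Seg = (\<lambda>(k::nat, j::nat). (\<lambda>x. Complex x (Y k)) ` {real j * h..real (Suc j) * h})"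
  have Seg_Re: "Re z \<ge> h" if "z \<in> Seg (k, j)" "j \<ge> 1" for z k j
  proof -
    have "real j * h \<ge> 1 * h" using that h by (intro mult_right_mono) auto
    then show ?thesis using that by (auto simp: Seg_def)
  qed
  have contd: "continuous_on {w. 0 < Re w} (deriv \<Phi>)"
    by (intro holomorphic_on_imp_continuous_on holomorphic_deriv holo open_RH)
  have ex: "\<exists>z\<in>Seg (k, j). \<forall>z'\<in>Seg (k, j). norm (deriv \<Phi> z') \<le> norm (deriv \<Phi> z)" if "j \<ge> 1" for k j
  proof (rule continuous_attains_sup)
    show "compact (Seg (k, j))" unfolding Seg_def split
      by (intro compact_continuous_image compact_Icc continuous_intros)
    show "Seg (k, j) \<noteq> {}" using h by (auto simp: Seg_def algebra_simps)
    have "Seg (k, j) \<subseteq> {w. 0 < Re w}" using Seg_Re[OF _ that] h by force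
    then show "continuous_on (Seg (k, j)) (\<lambda>z. norm (deriv \<Phi> z))"
      by (intro continuous_on_norm continuous_on_subset[OF contd])
  qed
  define c0 where "c0 = (\<lambda>k j. SOME z. z \<in> Seg (k, j) \<and> (\<forall>z'\<in>Seg (k, j). norm (deriv \<Phi> z') \<le> norm (deriv \<Phi> z)))"
  have c0: "c0 k j \<in> Seg (k, j) \<and> (\<forall>z'\<in>Seg (k, j). norm (deriv \<Phi> z') \<le> norm (deriv \<Phi> (c0 k j)))" if "j \<ge> 1" for k j
    unfolding c0_def by (rule someI_ex) (use ex[OF that, of k] in blast)
  define c where "c = (\<lambda>(k, j). c0 k j)"
  define M where "M = (\<lambda>k j. norm (deriv \<Phi> (c0 k j)))"
  have cIm: "Im (c0 k j) = Y k" and cRe: "real j * h \<le> Re (c0 k j)" "Re (c0 k j) \<le> real (Suc j) * h" if "j \<ge> 1" for k j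
    using c0[OF that, of k] by (auto simp: Seg_def)
  \<comment> \<open>Neighbouring segments may have close maximum points; segments of equal parity do not.\<close>
  have par: "(\<Sum>i\<in>{..<n} \<times> {j\<in>{1..<n}. j mod 2 = p}. (h / 4 * norm (deriv \<Phi> (c i)))\<^sup>2) \<le> 144 * m" for p :: nat
    unfolding m_def
  proof (rule area_lower_bound)
    show "finite ({..<n} \<times> {j\<in>{1..<n}. j mod 2 = p})" by auto
    show "0 < h / 4" using h by simp
    show "2 * r \<le> 1" by (rule r)
    have loc: "0 < Re z \<and> Re z < 2 * r \<and> y0 < Im z \<and> Im z < y0 + r"
      if i: "i \<in> {..<n} \<times> {j\<in>{1..<n}. j mod 2 = p}" and z: "z \<in> ball (c i) (h / 4)" for i z
    proof -
      obtain k j where kj: "i = (k, j)" "k < n" "1 \<le> j" "j < n" using i by auto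
      have "norm (c0 k j - z) < h / 4" using z kj by (simp add: c_def dist_norm)
      then have re: "\<bar>Re (c0 k j) - Re z\<bar> < h / 4" and im: "\<bar>Im (c0 k j) - Im z\<bar> < h / 4"
        using abs_Re_le_cmod[of "c0 k j - z"] abs_Im_le_cmod[of "c0 k j - z"] by auto
      have "1 * h \<le> real j * h" using kj h by (intro mult_right_mono) auto
      moreover have "real (Suc j) * h \<le> real n * h" using kj h by (intro mult_right_mono) auto
      moreover have "1 * h \<le> real n * h" using n h by (intro mult_right_mono) auto
      ultimately have A: "0 < Re z" "Re z < 2 * r" using re cRe[OF kj(3), of k] h by linarith+
      have "real (Suc k) * h \<le> real n * h" using kj h by (intro mult_right_mono) auto
      then have B: "real k * h + h \<le> r" "0 \<le> real k * h" using h by (auto simp: algebra_simps)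
      have "Y k = y0 + real k * h + h / 2" by (simp add: Y_def algebra_simps)
      then have "y0 < Im z" "Im z < y0 + r" using im cIm[OF kj(3), of k] B h by linarith+
      then show ?thesis using A by simp
    qed
    show "ball (c i) (h / 4) \<subseteq> {w. 0 < Re w \<and> Re w < 2 * r}" if "i \<in> {..<n} \<times> {j\<in>{1..<n}. j mod 2 = p}" for i
      using loc[OF that] by blast
    fix i i' assume ii: "i \<in> {..<n} \<times> {j\<in>{1..<n}. j mod 2 = p}" "i' \<in> {..<n} \<times> {j\<in>{1..<n}. j mod 2 = p}" "i \<noteq> i'"
    obtain k j where kj: "i = (k, j)" "1 \<le> j" "j mod 2 = p" using ii(1) by auto
    obtain k' j' where kj': "i' = (k', j')" "1 \<le> j'" "j' mod 2 = p" using ii(2) by auto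
    have far: "h \<le> norm (c0 k j - c0 k' j')"
    proof (cases "k = k'")
      case False
      then have "1 \<le> \<bar>real k - real k'\<bar>" by linarith
      then have "1 * h \<le> \<bar>real k - real k'\<bar> * h" using h by (intro mult_right_mono) auto
      also have "\<dots> = \<bar>Y k - Y k'\<bar>" using h by (simp add: Y_def abs_mult flip: left_diff_distrib)
      also have "\<dots> = \<bar>Im (c0 k j - c0 k' j')\<bar>" using cIm kj kj' by simp
      finally show ?thesis using abs_Im_le_cmod[of "c0 k j - c0 k' j'"] by simp
    next
      case True
      then have "j \<noteq> j'" using ii kj kj' by auto
      then have "Suc (Suc j) \<le> j' \<or> Suc (Suc j') \<le> j" using kj(3) kj'(3)
        by presburger
      then have "h \<le> \<bar>Re (c0 k j) - Re (c0 k' j')\<bar>"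
      proof
        assume "Suc (Suc j) \<le> j'"
        then have "real (Suc (Suc j)) * h \<le> real j' * h" using h by (intro mult_right_mono) auto
        then show ?thesis using cRe[OF kj(2), of k] cRe[OF kj'(2), of k'] by (simp add: algebra_simps)
      next
        assume "Suc (Suc j') \<le> j"
        then have "real (Suc (Suc j')) * h \<le> real j * h" using h by (intro mult_right_mono) auto
        then show ?thesis using cRe[OF kj(2), of k] cRe[OF kj'(2), of k'] by (simp add: algebra_simps)
      qed
      then show ?thesis using abs_Re_le_cmod[of "c0 k j - c0 k' j'"] by simp
    qed
    show "\<Phi> ` ball (c i) (h / 4) \<inter> \<Phi> ` ball (c i') (h / 4) = {}"
    proof (rule ccontr)
      assume "\<not> ?thesis"
      then obtain z z' where z: "z \<in> ball (c i) (h / 4)" "z' \<in> ball (c i') (h / 4)" "\<Phi> z = \<Phi> z'" by auto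
      have l: "0 < Re z" "0 < Re z'" "y0 < Im z" "Im z < y0 + r" "y0 < Im z'" "Im z' < y0 + r"
        using loc[OF ii(1) z(1)] loc[OF ii(2) z(2)] by blast+
      have "\<bar>Im z - Im z'\<bar> < 2 * pi" using l r pi_gt3 by linarith
      with l(1,2) z(3) have "z = z'" by (rule inj_narrow)
      then have "dist (c i) (c i') < h / 4 + h / 4" using z by (metis dist_commute dist_triangle_less_add mem_ball)
      then show False using far kj kj' h by (simp add: c_def dist_norm)
    qed
  qed
  have tot: "(\<Sum>k<n. \<Sum>j=1..<n. (h / 4 * M k j)\<^sup>2) \<le> 288 * m"
  proof -
    have "(\<Sum>k<n. \<Sum>j=1..<n. (h / 4 * M k j)\<^sup>2) = (\<Sum>i\<in>{..<n} \<times> {1..<n}. (h / 4 * norm (deriv \<Phi> (c i)))\<^sup>2)"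
      by (simp add: sum.cartesian_product c_def M_def case_prod_beta)
    also have "{..<n} \<times> {1..<n} = {..<n} \<times> {j\<in>{1..<n}. j mod 2 = 0} \<union> {..<n} \<times> {j\<in>{1..<n}. j mod 2 = 1}"
      by auto
    also have "(\<Sum>i\<in>\<dots>. (h / 4 * norm (deriv \<Phi> (c i)))\<^sup>2) = (\<Sum>i\<in>{..<n} \<times> {j\<in>{1..<n}. j mod 2 = 0}. (h / 4 * norm (deriv \<Phi> (c i)))\<^sup>2)
       + (\<Sum>i\<in>{..<n} \<times> {j\<in>{1..<n}. j mod 2 = 1}. (h / 4 * norm (deriv \<Phi> (c i)))\<^sup>2)"
      by (rule sum.union_disjoint) auto
    also have "\<dots> \<le> 144 * m + 144 * m" by (intro add_mono par)
    finally show ?thesis by simp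
  qed
  have "\<exists>k<n. (\<Sum>j=1..<n. (h / 4 * M k j)\<^sup>2) \<le> 288 * m / real n"
  proof (rule ccontr)
    assume "\<not> ?thesis"
    then have "(\<Sum>k<n. 288 * m / real n) < (\<Sum>k<n. \<Sum>j=1..<n. (h / 4 * M k j)\<^sup>2)"
      using n by (intro sum_strict_mono) auto
    then show False using tot n by simp
  qed
  then obtain k where k: "k < n" "(\<Sum>j=1..<n. (h / 4 * M k j)\<^sup>2) \<le> 288 * m / real n" by blast
  define L where "L = (\<Sum>j=1..<n. h * M k j)"
  have M0: "0 \<le> h * M k j" for j using h by (simp add: M_def)
  have "(\<Sum>j=1..<n. h / 4 * M k j)\<^sup>2 \<le> (\<Sum>j=1..<n. (h / 4 * M k j)\<^sup>2) * real (card {1..<n})"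
    using sum_squared_le_sum_of_squares[of "\<lambda>j. h / 4 * M k j" "{1..<n}"] by simp
  also have "\<dots> \<le> 288 * m / real n * real n"
  proof (rule mult_mono)
    show "0 \<le> 288 * m / real n" by (simp add: m_def)
  qed (use k in auto)
  also have "\<dots> = 288 * m" using n by simp
  finally have "(L / 4)\<^sup>2 \<le> 288 * m" by (simp add: L_def sum_divide_distrib)
  then have "L\<^sup>2 \<le> 4608 * m" by (simp add: power_divide)
  then have L: "L \<le> sqrt (4608 * m)" by (rule real_le_rsqrt)
  define g where "g = (\<lambda>x. \<Phi> (Complex x (Y k)))"
  have step: "norm (g x - g (real j * h)) \<le> h * M k j" if j: "1 \<le> j" and x: "real j * h \<le> x" "x \<le> real (Suc j) * h" for j x
  proof -
    have seg: "convex (Seg (k, j))"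
    proof -
      have "Seg (k, j) = {z. real j * h \<le> Re z \<and> Re z \<le> real (Suc j) * h \<and> Im z = Y k}"
        by (force simp: Seg_def complex_eq_iff image_iff)
      also have "\<dots> = {z. real j * h \<le> Re z} \<inter> {z. Re z \<le> real (Suc j) * h} \<inter> {z. Im z = Y k}" by auto
      finally show ?thesis
        by (simp only:) (intro convex_Int convex_halfspace_Re_ge convex_halfspace_Re_le, simp add: convex_def algebra_simps flip: distrib_right)
    qed
    have "norm (\<Phi> (Complex x (Y k)) - \<Phi> (Complex (real j * h) (Y k))) \<le> M k j * norm (Complex x (Y k) - Complex (real j * h) (Y k))"
    proof (rule field_differentiable_bound[OF seg])
      fix z assume z: "z \<in> Seg (k, j)"
      have "0 < Re z" using Seg_Re[OF z j] h by simp
      then show "(\<Phi> has_field_derivative deriv \<Phi> z) (at z within Seg (k, j))"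
        using holomorphic_derivI[OF holo open_RH, of z] by (simp add: has_field_derivative_at_within)
      show "norm (deriv \<Phi> z) \<le> M k j" using c0[OF j, of k] z by (simp add: M_def)
    next
      show "Complex x (Y k) \<in> Seg (k, j)" using x by (auto simp: Seg_def)
      show "Complex (real j * h) (Y k) \<in> Seg (k, j)" using h by (auto simp: Seg_def algebra_simps)
    qed
    also have "norm (Complex x (Y k) - Complex (real j * h) (Y k)) = x - real j * h"
      using x by (simp add: cmod_def)
    also have "M k j * (x - real j * h) \<le> M k j * h"
      using x by (intro mult_left_mono) (auto simp: M_def algebra_simps)
    finally show ?thesis by (simp add: g_def mult.commute)
  qed
  note seg_step = step
  have chain: "h \<le> x \<Longrightarrow> x \<le> real j * h \<Longrightarrow> norm (g x - g h) \<le> (\<Sum>i=1..<j. h * M k i)" if "1 \<le> j" for j x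
    using that
  proof (induction j arbitrary: x rule: dec_induct)
    case base
    then show ?case by simp
  next
    case (step j)
    have "1 * h \<le> real j * h" using step.hyps h by (intro mult_right_mono) auto
    then have jh: "norm (g (real j * h) - g h) \<le> (\<Sum>i=1..<j. h * M k i)" using step.IH[of "real j * h"] by simp
    show ?case
    proof (cases "x \<le> real j * h")
      case True
      then have "norm (g x - g h) \<le> (\<Sum>i=1..<j. h * M k i)" using step.IH step.prems by blast
      also have "\<dots> \<le> (\<Sum>i=1..<Suc j. h * M k i)" using step.hyps M0[of j] by simp
      finally show ?thesis .
    next
      case False
      have "norm (g x - g (real j * h)) \<le> h * M k j" by (rule seg_step) (use False step.prems step.hyps in auto)
      then have "norm (g x - g h) \<le> h * M k j + (\<Sum>i=1..<j. h * M k i)"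
        using jh norm_diff_triangle_le by blast
      then show ?thesis using step.hyps by simp
    qed
  qed
  have near: "norm (g x - g h) \<le> sqrt (4608 * m)" if "h \<le> x" "x \<le> r" for x
    using chain[of n x] that n h L by (simp add: L_def)
  show ?thesis
  proof (intro exI[of _ "Y k"] conjI allI impI)
    have "real (Suc k) * h \<le> real n * h" using k h by (intro mult_right_mono) auto
    then show "y0 \<le> Y k" "Y k \<le> y0 + r" using h by (auto simp: Y_def algebra_simps)
    fix x x' assume "r / real n \<le> x \<and> x \<le> r \<and> r / real n \<le> x' \<and> x' \<le> r"
    then have "norm (g x - g h) \<le> sqrt (4608 * m)" "norm (g x' - g h) \<le> sqrt (4608 * m)"
      using near by (auto simp: h_def)
    then have "dist (g x) (g x') \<le> sqrt (4608 * m) + sqrt (4608 * m)"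
      by (metis dist_norm dist_commute dist_triangle_le add_mono)
    then show "dist (\<Phi> (Complex x (Y k))) (\<Phi> (Complex x' (Y k))) \<le> 2 * sqrt (4608 * measure lborel (collar (2 * r)))"
      by (simp add: g_def m_def)
  qed
qed

text \<open>The half-open horizontal segment at height \<open>y\<close>, from the imaginary axis to distance \<open>r\<close>, has an image of small
diameter. The image may still cluster on a nondegenerate part of \<open>K\<close>.\<close>
definition quiet :: "real \<Rightarrow> real \<Rightarrow> real \<Rightarrow> bool" where
  "quiet \<kappa> r y \<longleftrightarrow> (\<forall>x x'. 0 < x \<and> x \<le> r \<and> 0 < x' \<and> x' \<le> r \<longrightarrow> dist (\<Phi> (Complex x y)) (\<Phi> (Complex x' y)) \<le> \<kappa>)"

text \<open>The lines found for finer and finer subdivisions form nested nonempty compact sets.\<close>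
lemma quiet_line:
  assumes "\<kappa> > 0"
  obtains r0 where "0 < r0" "\<And>r y0. 0 < r \<Longrightarrow> r \<le> r0 \<Longrightarrow> \<exists>y. y0 \<le> y \<and> y \<le> y0 + r \<and> quiet \<kappa> r y"
proof -
  obtain R where R: "0 < R" "R \<le> 1" "measure lborel (collar R) < (\<kappa> / 2)\<^sup>2 / 4608"
    using small_collar[of "(\<kappa> / 2)\<^sup>2 / 4608"] assms by auto
  show ?thesis
  proof (rule that[of "R / 2"])
    show "0 < R / 2" using R by simp
    fix r y0 assume r: "0 < r" "r \<le> R / 2"
    have "measure lborel (collar (2 * r)) \<le> measure lborel (collar R)"
    proof (rule measure_mono_fmeasurable)
      show "collar (2 * r) \<subseteq> collar R" using r by (intro collar_mono) auto
      show "collar R \<in> fmeasurable lborel" by (rule collar_fmeasurable[OF R(2)])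
      show "collar (2 * r) \<in> sets lborel" using collar_fmeasurable[of "2 * r"] r R by (auto simp: fmeasurable_def)
    qed
    then have "4608 * measure lborel (collar (2 * r)) \<le> (\<kappa> / 2)\<^sup>2" using R by simp
    then have "sqrt (4608 * measure lborel (collar (2 * r))) \<le> \<kappa> / 2" using assms by (intro real_le_lsqrt) auto
    then have \<kappa>: "2 * sqrt (4608 * measure lborel (collar (2 * r))) \<le> \<kappa>" by simp
    define F where "F = (\<lambda>n. {y\<in>{y0..y0 + r}. \<forall>x x'. r / real (Suc n) \<le> x \<and> x \<le> r \<and> r / real (Suc n) \<le> x' \<and> x' \<le> r \<longrightarrow>
       dist (\<Phi> (Complex x y)) (\<Phi> (Complex x' y)) \<le> \<kappa>})"
    have "\<Inter>(range F) \<noteq> {}"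
    proof (rule compact_nest)
      show "F n \<noteq> {}" for n
        using quiet_line_discrete[of r "Suc n" y0] r R \<kappa> unfolding F_def by (auto intro: order_trans)
      show "F n \<subseteq> F m" if "m \<le> n" for m n
      proof -
        have "r / real (Suc n) \<le> r / real (Suc m)" using that r by (intro divide_left_mono) auto
        then show ?thesis unfolding F_def by (auto intro: order_trans)
      qed
      show "compact (F n)" for n
      proof -
        define P where "P = {(x, x'). r / real (Suc n) \<le> x \<and> x \<le> r \<and> r / real (Suc n) \<le> x' \<and> x' \<le> r}"
        have eq: "F n = {y0..y0 + r} \<inter> (\<Inter>p\<in>P. {y. dist (\<Phi> (Complex (fst p) y)) (\<Phi> (Complex (snd p) y)) \<le> \<kappa>})"
          by (auto simp: F_def P_def)
        have "closed {y. dist (\<Phi> (Complex (fst p) y)) (\<Phi> (Complex (snd p) y)) \<le> \<kappa>}" if "p \<in> P" for p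
        proof (intro closed_Collect_le continuous_on_dist continuous_on_const)
          have "0 < r / real (Suc n)" using r by simp
          then have "0 < fst p" "0 < snd p" using that by (auto simp: P_def)
          then show "continuous_on UNIV (\<lambda>y. \<Phi> (Complex (fst p) y))" "continuous_on UNIV (\<lambda>y. \<Phi> (Complex (snd p) y))"
            by (auto intro!: continuous_on_compose2[OF cont] continuous_intros)
        qed
        then show ?thesis unfolding eq by (intro compact_Int_closed closed_INT) auto
      qed
    qed
    then obtain y where y: "\<And>n. y \<in> F n" by auto
    have "quiet \<kappa> r y"
      unfolding quiet_def
    proof (intro allI impI)
      fix x x' assume x: "0 < x \<and> x \<le> r \<and> 0 < x' \<and> x' \<le> r"
      then have "0 < min x x' / r" using r by simp
      then obtain n where "1 / real (Suc n) < min x x' / r" using reals_Archimedean by (metis inverse_eq_divide)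
      then have "r / real (Suc n) < min x x'" using r by (simp add: field_simps)
      then show "dist (\<Phi> (Complex x y)) (\<Phi> (Complex x' y)) \<le> \<kappa>" using y[of n] x by (auto simp: F_def)
    qed
    then show "\<exists>y. y0 \<le> y \<and> y \<le> y0 + r \<and> quiet \<kappa> r y" using y[of 0] by (auto simp: F_def)
  qed
qed

end

section \<open>Crosscuts\<close>

lemma uniformly_locally_connected:
  fixes J :: "'a::metric_space set"
  assumes J: "compact J" "locally connected J" and \<eta>: "\<eta> > 0"
  obtains \<delta> where "\<delta> > 0"
    "\<And>p. p \<in> J \<Longrightarrow> \<exists>E. connected E \<and> closed E \<and> E \<subseteq> J \<and> E \<subseteq> cball p \<eta> \<and> J \<inter> ball p \<delta> \<subseteq> E"
proof -
  have "\<exists>G V. open G \<and> connected V \<and> p \<in> G \<and> J \<inter> G \<subseteq> V \<and> V \<subseteq> J \<inter> ball p (\<eta>/2)" if "p \<in> J" for p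
  proof -
    have "openin (top_of_set J) (J \<inter> ball p (\<eta>/2))" "p \<in> J \<inter> ball p (\<eta>/2)" using that \<eta> by auto
    then obtain U V where UV: "openin (top_of_set J) U" "connected V" "p \<in> U" "U \<subseteq> V" "V \<subseteq> J \<inter> ball p (\<eta>/2)"
      using J(2) unfolding locally_def by meson
    then obtain G where "open G" "U = J \<inter> G" by (auto simp: openin_open)
    then show ?thesis using UV by blast
  qed
  then obtain G V where GV: "\<And>p. p \<in> J \<Longrightarrow> open (G p) \<and> connected (V p) \<and> p \<in> G p \<and> J \<inter> G p \<subseteq> V p \<and> V p \<subseteq> J \<inter> ball p (\<eta>/2)"
    by metis
  have cover: "J \<subseteq> \<Union>(G ` J)" using GV by blast
  have op: "open X" if "X \<in> G ` J" for X using that GV by blast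
  obtain \<delta> where \<delta>: "\<delta> > 0" "\<And>x. x \<in> J \<Longrightarrow> \<exists>X\<in>G ` J. ball x \<delta> \<subseteq> X"
    using Heine_Borel_lemma[OF J(1) cover op] by blast
  show ?thesis
  proof (rule that[OF \<delta>(1)])
    fix x assume x: "x \<in> J"
    then obtain p where p: "p \<in> J" "ball x \<delta> \<subseteq> G p" using \<delta>(2) by blast
    note g = GV[OF p(1)]
    have sub: "J \<inter> ball x \<delta> \<subseteq> V p" using g p by blast
    have "x \<in> V p" using sub x \<delta> by auto
    then have "V p \<subseteq> cball x \<eta>"
    proof -
      have "dist x y \<le> \<eta>" if "y \<in> V p" for y
      proof -
        have "dist p x < \<eta>/2" "dist p y < \<eta>/2" using g that \<open>x \<in> V p\<close> by (auto simp: subset_iff)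
        then show ?thesis using dist_triangle[of x y p] by (simp add: dist_commute)
      qed
      then show ?thesis by auto
    qed
    then have "closure (V p) \<subseteq> cball x \<eta>" by (rule closure_minimal) simp
    moreover have "closure (V p) \<subseteq> J" by (rule closure_minimal) (use g J compact_imp_closed in auto)
    moreover have "connected (closure (V p))" using g by (intro connected_imp_connected_closure) auto
    ultimately show "\<exists>E. connected E \<and> closed E \<and> E \<subseteq> J \<and> E \<subseteq> cball x \<eta> \<and> J \<inter> ball x \<delta> \<subseteq> E"
      using sub closure_subset[of "V p"] by (intro exI[of _ "closure (V p)"]) auto
  qed
qed

context exterior_coordinate
begin

lemma connected_complement: "connected (- K)"
proof -
  have "connected (\<Phi> ` {w. 0 < Re w})"
    by (intro connected_continuous_image cont convex_connected convex_halfspace_Re_gt)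
  then show ?thesis by (simp add: image)
qed

text \<open>The image of \<open>B\<close> is open, and away from \<open>X\<close> and \<open>K\<close> it is also closed: at a boundary point of \<open>B\<close> in the
half-plane the image lies in \<open>X\<close>, and at the imaginary axis images cluster only on \<open>K\<close>.\<close>
lemma trapped:
  assumes B: "open B" "bounded B" "B \<subseteq> {w. 0 < Re w}"
    and bd: "\<And>b. b \<in> closure B \<Longrightarrow> 0 < Re b \<Longrightarrow> b \<in> B \<or> \<Phi> b \<in> X"
    and Z: "connected Z" "Z \<inter> K = {}" "Z \<inter> X = {}" and z: "z \<in> Z" "z \<in> \<Phi> ` B"
  shows "Z \<subseteq> \<Phi> ` B"
proof -
  have op: "openin (top_of_set Z) (Z \<inter> \<Phi> ` B)"
    by (intro openin_open_Int open_Phi_image B)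
  have cl: "closedin (top_of_set Z) (Z \<inter> \<Phi> ` B)"
  proof (rule closedin_limpt[THEN iffD2], intro conjI allI impI)
    fix v assume v: "v islimpt Z \<inter> \<Phi> ` B \<and> v \<in> Z"
    then obtain g where g: "\<And>n. g n \<in> Z \<inter> \<Phi> ` B" "g \<longlonglongrightarrow> v" by (auto simp: islimpt_sequential)
    have "\<exists>w. w \<in> B \<and> g n = \<Phi> w" for n using g(1)[of n] by blast
    then obtain u where u: "\<And>n. u n \<in> B \<and> g n = \<Phi> (u n)" by metis
    have "bounded (range u)" using B(2) u by (meson bounded_subset image_subsetI)
    then obtain b s where b: "strict_mono s" "(u \<circ> s) \<longlonglongrightarrow> b" using bounded_imp_convergent_subsequence by blast
    have bcl: "b \<in> closure B" using b(2) u by (auto simp: closure_sequential intro!: exI[of _ "u \<circ> s"])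
    have "(g \<circ> s) \<longlonglongrightarrow> v" using g(2) b(1) by (rule LIMSEQ_subseq_LIMSEQ)
    then have lv: "(\<lambda>n. \<Phi> ((u \<circ> s) n)) \<longlonglongrightarrow> v" using u by (simp add: o_def)
    have pos: "0 < Re ((u \<circ> s) n)" for n using u B by auto
    have re: "(\<lambda>n. Re ((u \<circ> s) n)) \<longlonglongrightarrow> Re b" using b(2) by (rule tendsto_Re)
    then have "0 \<le> Re b" by (rule LIMSEQ_le_const) (use pos less_imp_le in blast)
    moreover have "Re b \<noteq> 0"
    proof
      assume "Re b = 0"
      then have "v \<in> frontier K" using cluster_at_boundary[OF pos _ lv] re by simp
      then have "v \<in> K" using compact_K frontier_subset_eq compact_imp_closed by blast
      then show False using v Z by auto
    qed
    ultimately have rb: "0 < Re b" by simp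
    have "isCont \<Phi> b" using cont rb open_RH by (simp add: continuous_on_eq_continuous_at)
    then have "(\<lambda>n. \<Phi> ((u \<circ> s) n)) \<longlonglongrightarrow> \<Phi> b" using b(2) by (rule isCont_tendsto_compose)
    then have "v = \<Phi> b" using lv LIMSEQ_unique by blast
    then show "v \<in> Z \<inter> \<Phi> ` B" using bd[OF bcl rb] v Z by auto
  qed auto
  show ?thesis using Z(1) op cl z by (metis connected_clopen disjoint_iff_not_equal Int_iff inf.absorb_iff1)
qed

text \<open>\<open>K\<close> does not separate \<open>z\<close> from \<open>q\<close>, whereas \<open>S \<union> K\<close> does, by \<open>trapped\<close>. As \<open>S \<inter> K\<close> is connected,
Janiszewski's theorem leaves only that \<open>S\<close> separates them.\<close>
lemma separated_by_crosscut:
  assumes B: "open B" "bounded B" "B \<subseteq> {w. 0 < Re w}"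
    and bd: "\<And>b. b \<in> closure B \<Longrightarrow> 0 < Re b \<Longrightarrow> b \<in> B \<or> \<Phi> b \<in> S"
    and S: "compact S" "connected (S \<inter> K)"
    and z: "z \<in> \<Phi> ` B" and q: "q \<notin> K" "q \<notin> \<Phi> ` B"
  shows "\<not> connected_component (- S) z q"
proof
  assume cS: "connected_component (- S) z q"
  have "z \<notin> K" using z B Phi_notin by auto
  then have cK: "connected_component (- K) z q"
    using connected_complement q(1) unfolding connected_component_def by blast
  have "connected_component (- (S \<union> K)) z q"
    by (rule Janiszewski[OF S(1) compact_imp_closed[OF compact_K] S(2) cS cK])
  then obtain Z where Z: "connected Z" "Z \<subseteq> - (S \<union> K)" "z \<in> Z" "q \<in> Z" by (auto simp: connected_component_def)
  have "Z \<subseteq> \<Phi> ` B" by (rule trapped[OF B, of S]) (use bd Z z in auto)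
  then show False using Z q by auto
qed

text \<open>Three sides of a rectangle; the fourth lies on the imaginary axis.\<close>
definition crosscut :: "real \<Rightarrow> real \<Rightarrow> real \<Rightarrow> complex set" where
  "crosscut r a b = {w. 0 \<le> Re w \<and> Re w \<le> r \<and> a \<le> Im w \<and> Im w \<le> b \<and> (Im w = a \<or> Im w = b \<or> Re w = r)}"

definition half_box :: "real \<Rightarrow> real \<Rightarrow> real \<Rightarrow> complex set" where
  "half_box r a b = {w. 0 < Re w \<and> Re w < r \<and> a < Im w \<and> Im w < b}"

lemma half_box:
  "open (half_box r a b)" "bounded (half_box r a b)" "half_box r a b \<subseteq> {w. 0 < Re w}"
  "b' \<in> closure (half_box r a b) \<Longrightarrow> 0 < Re b' \<Longrightarrow> b' \<in> half_box r a b \<or> b' \<in> crosscut r a b"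
proof -
  have eq: "half_box r a b = box (Complex 0 a) (Complex r b)"
    by (auto simp: half_box_def in_box_complex_iff)
  show "open (half_box r a b)" "bounded (half_box r a b)" unfolding eq by (auto simp: open_box bounded_box)
  show "half_box r a b \<subseteq> {w. 0 < Re w}" by (auto simp: half_box_def)
  assume b': "b' \<in> closure (half_box r a b)" "0 < Re b'"
  have "closure (half_box r a b) \<subseteq> cbox (Complex 0 a) (Complex r b)"
    unfolding eq by (intro closure_minimal box_subset_cbox closed_cbox)
  then have "b' \<in> cbox (Complex 0 a) (Complex r b)" using b' by auto
  then show "b' \<in> half_box r a b \<or> b' \<in> crosscut r a b" using b'(2)
    by (auto simp: in_cbox_complex_iff half_box_def crosscut_def)
qed

text \<open>Surround a boundary point by two quiet lines at heights \<open>a\<close> and \<open>b\<close> and a vertical segment at distance \<open>r\<close>.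
The image \<open>X\<close> of this crosscut has small diameter and clusters on \<open>K\<close> near a point \<open>p\<close> only. By local
connectivity all these cluster points lie in a small connected closed subset \<open>E\<close> of the frontier, so
\<open>S = closure X \<union> E\<close> is compact, lies in a small disc about \<open>p\<close> and meets \<open>K\<close> exactly in \<open>E\<close>. Hence \<open>S\<close>
separates the image of the box from a fixed point \<open>q0\<close> far from \<open>K\<close>. The complement of the disc is
connected, misses \<open>S\<close> and contains \<open>q0\<close>, so the image of the box lies inside the disc.\<close>
lemma crosscut_image_small:
  assumes lc: "locally connected (frontier K)" and \<eta>: "\<eta> > 0"
  obtains r where "r > 0"
    "\<And>w w'. 0 < Re w \<Longrightarrow> Re w < r \<Longrightarrow> 0 < Re w' \<Longrightarrow> Re w' < r \<Longrightarrow> \<bar>Im w - Im w'\<bar> < r \<Longrightarrow> dist (\<Phi> w) (\<Phi> w') \<le> \<eta>"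
proof -
  \<comment> \<open>The level 2 of q0 exceeds the width of the boxes below, which is at most 1.\<close>
  define q0 where "q0 = \<Phi> 2"
  have q0: "q0 \<notin> K" using Phi_notin[of 2] by (simp add: q0_def)
  have "open (- K)" using compact_K by (simp add: compact_imp_closed open_Compl)
  then obtain e0 where e0: "e0 > 0" "ball q0 e0 \<subseteq> - K" using q0 open_contains_ball by blast
  define \<eta>' where "\<eta>' = min (\<eta> / 2) (e0 / 2)"
  have \<eta>': "\<eta>' > 0" "\<eta>' < e0" using \<eta> e0 by (auto simp: \<eta>'_def)
  have cJ: "compact (frontier K)" using compact_K by (rule compact_frontier)
  obtain \<delta>0 where \<delta>0: "\<delta>0 > 0"
    "\<And>p. p \<in> frontier K \<Longrightarrow> \<exists>E. connected E \<and> closed E \<and> E \<subseteq> frontier K \<and> E \<subseteq> cball p \<eta>' \<and> frontier K \<inter> ball p \<delta>0 \<subseteq> E"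
    using uniformly_locally_connected[OF cJ lc \<eta>'(1)] by blast
  define \<delta> where "\<delta> = min \<delta>0 \<eta>'"
  have \<delta>: "\<delta> > 0" "\<delta> \<le> \<delta>0" "\<delta> \<le> \<eta>'" using \<delta>0 \<eta>' by (auto simp: \<delta>_def)
  have "\<delta> / 6 > 0" "\<delta> / 24 > 0" using \<delta> by auto
  obtain r1 where r1: "0 < r1" "\<And>r y0. 0 < r \<Longrightarrow> r \<le> r1 \<Longrightarrow> \<exists>y. y0 \<le> y \<and> y \<le> y0 + r \<and> quiet (\<delta> / 6) r y"
    using quiet_line[OF \<open>\<delta> / 6 > 0\<close>] by blast
  obtain r2 where r2: "0 < r2" "\<And>w. 0 < Re w \<Longrightarrow> Re w \<le> r2 \<Longrightarrow> Re w * norm (deriv \<Phi> w) \<le> \<delta> / 24"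
    using deriv_small[OF \<open>\<delta> / 24 > 0\<close>] by blast
  define r where "r = min (min r1 r2) 1"
  have r: "0 < r" "r \<le> r1" "r \<le> r2" "r \<le> 1" using r1 r2 by (auto simp: r_def)
  have main: "\<exists>p. \<forall>w. 0 < Re w \<and> Re w < r \<and> \<bar>Im w - y0\<bar> < r \<longrightarrow> \<Phi> w \<in> cball p \<eta>'" for y0
  proof -
    obtain a where a: "y0 - 2 * r \<le> a" "a \<le> y0 - r" "quiet (\<delta> / 6) r a"
      using r1(2)[OF r(1,2), of "y0 - 2 * r"] by (auto simp: algebra_simps)
    obtain b where b: "y0 + r \<le> b" "b \<le> y0 + 2 * r" "quiet (\<delta> / 6) r b"
      using r1(2)[OF r(1,2), of "y0 + r"] by (auto simp: algebra_simps)
    define X where "X = \<Phi> ` (crosscut r a b \<inter> {w. 0 < Re w})"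
    define x0 where "x0 = \<Phi> (Complex r a)"
    have vert: "dist (\<Phi> (Complex r y)) x0 \<le> \<delta> / 6" if "a \<le> y" "y \<le> b" for y
    proof -
      define V where "V = {z. Re z = r}"
      have cV: "convex V" unfolding V_def
        by (auto simp: convex_def simp flip: distrib_right)
      have "norm (\<Phi> (Complex r y) - \<Phi> (Complex r a)) \<le> (\<delta> / 24 / r) * norm (Complex r y - Complex r a)"
      proof (rule field_differentiable_bound[OF cV])
        fix z assume z: "z \<in> V"
        then have "0 < Re z" using r by (simp add: V_def)
        then show "(\<Phi> has_field_derivative deriv \<Phi> z) (at z within V)"
          using holomorphic_derivI[OF holo open_RH, of z] by (simp add: has_field_derivative_at_within)
        show "norm (deriv \<Phi> z) \<le> \<delta> / 24 / r" using r2(2)[of z] z r by (simp add: V_def field_simps)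
      qed (auto simp: V_def)
      also have "norm (Complex r y - Complex r a) = y - a" using that by (simp add: cmod_def)
      also have "\<delta> / 24 / r * (y - a) \<le> \<delta> / 24 / r * (4 * r)"
        using that a b r \<delta> by (intro mult_left_mono) auto
      also have "\<dots> = \<delta> / 6" using r by simp
      finally show ?thesis by (simp add: x0_def dist_norm)
    qed
    have near: "dist v x0 \<le> \<delta> / 3" if v: "v \<in> X" for v
    proof -
      obtain w where w: "w \<in> crosscut r a b" "0 < Re w" "v = \<Phi> w" using v by (auto simp: X_def)
      then have wi: "Re w \<le> r" "a \<le> Im w" "Im w \<le> b" by (auto simp: crosscut_def)
      have v: "v = \<Phi> (Complex (Re w) (Im w))" using w(3) by simp
      from w(1) consider "Im w = a" | "Im w = b" | "Re w = r" by (auto simp: crosscut_def)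
      then show ?thesis
      proof cases
        case 1
        then have "dist (\<Phi> (Complex (Re w) a)) x0 \<le> \<delta> / 6" unfolding x0_def
          using a(3)[unfolded quiet_def, rule_format, of "Re w" r] w(2) wi r by simp
        moreover have "v = \<Phi> (Complex (Re w) a)" using v unfolding 1 .
        ultimately show ?thesis using \<delta> by simp
      next
        case 2
        then have "dist (\<Phi> (Complex (Re w) b)) (\<Phi> (Complex r b)) \<le> \<delta> / 6"
          using b(3)[unfolded quiet_def, rule_format, of "Re w" r] w(2) wi r by simp
        moreover have "dist (\<Phi> (Complex r b)) x0 \<le> \<delta> / 6" by (rule vert) (use a b r in auto)
        moreover have "v = \<Phi> (Complex (Re w) b)" using v unfolding 2 .
        ultimately show ?thesis using dist_triangle[of v x0 "\<Phi> (Complex r b)"] by simp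
      next
        case 3
        have "v = \<Phi> (Complex r (Im w))" using v unfolding 3 .
        then show ?thesis using vert[OF wi(2,3)] \<delta> by simp
      qed
    qed
    have pair: "dist u v \<le> 2 * \<delta> / 3" if "u \<in> X" "v \<in> X" for u v
      using near[OF that(1)] near[OF that(2)] dist_triangle2[of u v x0] by simp
    \<comment> \<open>A point where the line at height a accumulates on K.\<close>
    define u where "u = (\<lambda>n::nat. Complex (r / real (Suc n)) a)"
    have u: "0 < Re (u n)" "Re (u n) \<le> r" for n
    proof -
      show "0 < Re (u n)" using r by (simp add: u_def)
      have "r / real (Suc n) \<le> r / 1" using r by (intro divide_left_mono) auto
      then show "Re (u n) \<le> r" by (simp add: u_def)
    qed
    have uX: "\<Phi> (u n) \<in> X" for n
    proof -
      have "u n \<in> crosscut r a b" using u[of n] a b r by (auto simp: crosscut_def) (simp_all add: u_def)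
      then show ?thesis using u[of n] by (auto simp: X_def)
    qed
    have "bounded X" using near by (metis bounded_def dist_commute)
    then have "bounded (range (\<lambda>n. \<Phi> (u n)))" using uX by (meson bounded_subset image_subsetI)
    then obtain p s where p: "strict_mono s" "((\<lambda>n. \<Phi> (u n)) \<circ> s) \<longlonglongrightarrow> p"
      using bounded_imp_convergent_subsequence by blast
    have "(\<lambda>n. r / real (Suc n)) \<longlonglongrightarrow> 0" using LIMSEQ_Suc[OF lim_const_over_n[of r]] by simp
    then have "(\<lambda>n. Re (u n)) \<longlonglongrightarrow> 0" by (simp add: u_def)
    then have "(\<lambda>n. Re ((u \<circ> s) n)) \<longlonglongrightarrow> 0" using LIMSEQ_subseq_LIMSEQ[OF _ p(1)] by (fastforce simp: o_def)
    then have pK: "p \<in> frontier K" using cluster_at_boundary[of "u \<circ> s" p] u p(2) by (simp add: o_def)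
    have pX: "p \<in> closure X" using p(2) uX by (auto simp: closure_sequential o_def intro!: exI[of _ "\<lambda>n. \<Phi> (u (s n))"])
    have "X \<subseteq> cball p (2 * \<delta> / 3)"
    proof
      fix x assume x: "x \<in> X"
      have "X \<subseteq> cball x (2 * \<delta> / 3)" using pair x by auto
      then have "closure X \<subseteq> cball x (2 * \<delta> / 3)" by (rule closure_minimal) simp
      then show "x \<in> cball p (2 * \<delta> / 3)" using pX by (auto simp: dist_commute)
    qed
    then have cX: "closure X \<subseteq> cball p (2 * \<delta> / 3)" by (rule closure_minimal) simp
    obtain E where E: "connected E" "closed E" "E \<subseteq> frontier K" "E \<subseteq> cball p \<eta>'" "frontier K \<inter> ball p \<delta>0 \<subseteq> E"
      using \<delta>0(2)[OF pK] by blast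
    define S where "S = closure X \<union> E"
    have fK: "frontier K \<subseteq> K" using compact_K frontier_subset_eq compact_imp_closed by blast
    have SK: "S \<inter> K = E"
    proof -
      have "closure X \<inter> K \<subseteq> E"
      proof
        fix v assume v: "v \<in> closure X \<inter> K"
        have "X \<subseteq> - K" using Phi_notin by (auto simp: X_def)
        then have "v \<in> closure (- K)" using v closure_mono by blast
        moreover have "v \<in> closure K" using v closure_subset by blast
        ultimately have "v \<in> frontier K" by (simp add: frontier_closures)
        moreover have "v \<in> ball p \<delta>0" using v cX \<delta> by (auto simp: subset_iff)
        ultimately show "v \<in> E" using E by blast
      qed
      then show ?thesis using E fK by (auto simp: S_def)
    qed
    have Sb: "S \<subseteq> cball p \<eta>'" using cX E \<delta> by (auto simp: S_def subset_iff)
    have cS: "compact S" unfolding S_def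
      using Sb E(2) by (intro compact_Un) (auto simp: compact_eq_bounded_closed S_def intro: bounded_subset[OF bounded_cball])
    have "\<Phi> w \<in> cball p \<eta>'" if w: "0 < Re w" "Re w < r" "\<bar>Im w - y0\<bar> < r" for w
    proof (rule ccontr)
      assume out: "\<Phi> w \<notin> cball p \<eta>'"
      have "p \<notin> ball q0 e0" using e0 pK fK by blast
      then have "q0 \<notin> cball p \<eta>'" using \<eta>' by (auto simp: dist_commute)
      moreover have "connected (- cball p \<eta>')" by (rule connected_complement_bounded_convex) auto
      ultimately have "connected_component (- S) (\<Phi> w) q0"
        unfolding connected_component_def using out Sb by (intro exI[of _ "- cball p \<eta>'"]) auto
      moreover
      \<comment> \<open>S cuts the image of the box off from q0, whose level 2 exceeds r.\<close>
      have "\<not> connected_component (- S) (\<Phi> w) q0"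
      proof (rule separated_by_crosscut[OF half_box(1-3)[of r a b]])
        show "v \<in> half_box r a b \<or> \<Phi> v \<in> S" if "v \<in> closure (half_box r a b)" "0 < Re v" for v
          using half_box(4)[OF that] that(2) closure_subset[of X] by (auto simp: S_def X_def)
        show "compact S" "connected (S \<inter> K)" using cS SK E by auto
        show "\<Phi> w \<in> \<Phi> ` half_box r a b" using w a b by (auto simp: half_box_def)
        show "q0 \<notin> K" by (rule q0)
        show "q0 \<notin> \<Phi> ` half_box r a b"
        proof
          assume "q0 \<in> \<Phi> ` half_box r a b"
          then obtain v where "v \<in> half_box r a b" "\<Phi> 2 = \<Phi> v" by (auto simp: q0_def)
          then show False using Re_eq[of 2 v] r by (auto simp: half_box_def)
        qed
      qed
      ultimately show False by blast
    qed
    then show ?thesis by blast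
  qed
  show ?thesis
  proof (rule that[OF r(1)])
    fix w w' assume w: "0 < Re w" "Re w < r" "0 < Re w'" "Re w' < r" "\<bar>Im w - Im w'\<bar> < r"
    obtain p where p: "\<And>v. 0 < Re v \<and> Re v < r \<and> \<bar>Im v - Im w\<bar> < r \<Longrightarrow> \<Phi> v \<in> cball p \<eta>'"
      using main[of "Im w"] by blast
    have "\<Phi> w \<in> cball p \<eta>'" "\<Phi> w' \<in> cball p \<eta>'" using p[of w] p[of w'] w by auto
    then have "dist (\<Phi> w) (\<Phi> w') \<le> \<eta>' + \<eta>'" using dist_triangle3[of "\<Phi> w" "\<Phi> w'" p] by simp
    then show "dist (\<Phi> w) (\<Phi> w') \<le> \<eta>" by (simp add: \<eta>'_def)
  qed
qed

end

section \<open>Boundary values\<close>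

locale locally_connected_exterior = exterior_coordinate +
  assumes lc: "locally connected (frontier K)"
begin

definition boundary_value :: "real \<Rightarrow> complex" where
  "boundary_value y = lim (\<lambda>n. \<Phi> (Complex (1 / real (Suc n)) y))"

definition extension :: "complex \<Rightarrow> complex" where
  "extension w = (if 0 < Re w then \<Phi> w else boundary_value (Im w))"

lemma inverse_Suc_null: "(\<lambda>n. 1 / real (Suc n)) \<longlonglongrightarrow> 0"
  using LIMSEQ_Suc[OF lim_const_over_n[of "1::real"]] by simp

lemma boundary_value_LIMSEQ: "(\<lambda>n. \<Phi> (Complex (1 / real (Suc n)) y)) \<longlonglongrightarrow> boundary_value y"
proof -
  have "Cauchy (\<lambda>n. \<Phi> (Complex (1 / real (Suc n)) y))"
  proof (rule metric_CauchyI)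
    fix e :: real assume "e > 0"
    then have "e / 2 > 0" by simp
    then obtain r where r: "r > 0"
      "\<And>w w'. 0 < Re w \<Longrightarrow> Re w < r \<Longrightarrow> 0 < Re w' \<Longrightarrow> Re w' < r \<Longrightarrow> \<bar>Im w - Im w'\<bar> < r \<Longrightarrow> dist (\<Phi> w) (\<Phi> w') \<le> e / 2"
      using crosscut_image_small[OF lc] by blast
    have "eventually (\<lambda>n. 1 / real (Suc n) < r) sequentially" using order_tendstoD(2)[OF inverse_Suc_null r(1)] .
    then obtain N where N: "\<And>n. n \<ge> N \<Longrightarrow> 1 / real (Suc n) < r" by (auto simp: eventually_sequentially)
    show "\<exists>M. \<forall>m\<ge>M. \<forall>n\<ge>M. dist (\<Phi> (Complex (1 / real (Suc m)) y)) (\<Phi> (Complex (1 / real (Suc n)) y)) < e"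
    proof (intro exI[of _ N] allI impI)
      fix m n assume "m \<ge> N" "n \<ge> N"
      then have "dist (\<Phi> (Complex (1 / real (Suc m)) y)) (\<Phi> (Complex (1 / real (Suc n)) y)) \<le> e / 2"
        using N r(1) by (intro r(2)) auto
      then show "dist (\<Phi> (Complex (1 / real (Suc m)) y)) (\<Phi> (Complex (1 / real (Suc n)) y)) < e" using \<open>e > 0\<close> by simp
    qed
  qed
  then show ?thesis unfolding boundary_value_def by (simp add: Cauchy_convergent_iff convergent_LIMSEQ_iff)
qed

lemma boundary_value_uniform:
  assumes "\<eta> > 0"
  obtains r where "r > 0" "\<And>w y. 0 < Re w \<Longrightarrow> Re w < r \<Longrightarrow> \<bar>Im w - y\<bar> < r \<Longrightarrow> dist (\<Phi> w) (boundary_value y) \<le> \<eta>"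
proof -
  obtain r where r: "r > 0"
    "\<And>w w'. 0 < Re w \<Longrightarrow> Re w < r \<Longrightarrow> 0 < Re w' \<Longrightarrow> Re w' < r \<Longrightarrow> \<bar>Im w - Im w'\<bar> < r \<Longrightarrow> dist (\<Phi> w) (\<Phi> w') \<le> \<eta>"
    using crosscut_image_small[OF lc assms] by blast
  show ?thesis
  proof (rule that[OF r(1)])
    fix w y assume w: "0 < Re w" "Re w < r" "\<bar>Im w - y\<bar> < r"
    have "eventually (\<lambda>n. 1 / real (Suc n) < r) sequentially" using order_tendstoD(2)[OF inverse_Suc_null r(1)] .
    then have ev: "eventually (\<lambda>n. dist (\<Phi> w) (\<Phi> (Complex (1 / real (Suc n)) y)) \<le> \<eta>) sequentially"
      by eventually_elim (use r(2) w in auto)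
    show "dist (\<Phi> w) (boundary_value y) \<le> \<eta>"
      by (rule tendsto_upperbound[OF tendsto_dist[OF tendsto_const boundary_value_LIMSEQ] ev]) simp
  qed
qed

lemma boundary_value_in_frontier: "boundary_value y \<in> frontier K"
proof (rule cluster_at_boundary[OF _ _ boundary_value_LIMSEQ])
  show "(\<lambda>n. Re (Complex (1 / real (Suc n)) y)) \<longlonglongrightarrow> 0" using inverse_Suc_null by simp
qed auto

lemma frontier_subset_K: "frontier K \<subseteq> K"
  using compact_K frontier_subset_eq compact_imp_closed by blast

lemma extension_eq: "0 < Re w \<Longrightarrow> extension w = \<Phi> w"
  by (simp add: extension_def)

lemma extension_boundary: "extension (Complex 0 y) = boundary_value y"
  by (simp add: extension_def)

lemma continuous_on_extension: "continuous_on {w. 0 \<le> Re w} extension"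
  unfolding continuous_on_iff
proof (intro ballI allI impI)
  fix w0 :: complex and e :: real assume w0: "w0 \<in> {w. 0 \<le> Re w}" and e: "e > 0"
  show "\<exists>d>0. \<forall>w\<in>{w. 0 \<le> Re w}. dist w w0 < d \<longrightarrow> dist (extension w) (extension w0) < e"
  proof (cases "Re w0 = 0")
    case False
    then have p: "0 < Re w0" using w0 by simp
    have "isCont \<Phi> w0" using cont p open_RH by (simp add: continuous_on_eq_continuous_at)
    then obtain d where d: "d > 0" "\<And>w. dist w w0 < d \<Longrightarrow> dist (\<Phi> w) (\<Phi> w0) < e"
      using e by (auto simp: continuous_at_eps_delta)
    show ?thesis
    proof (intro exI[of _ "min d (Re w0)"] conjI ballI impI)
      show "min d (Re w0) > 0" using d p by simp
      fix w assume w: "dist w w0 < min d (Re w0)"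
      have "\<bar>Re w - Re w0\<bar> \<le> dist w w0" using abs_Re_le_cmod[of "w - w0"] by (simp add: dist_norm)
      then have "0 < Re w" using w by linarith
      then show "dist (extension w) (extension w0) < e" using d(2) w p by (simp add: extension_eq)
    qed
  next
    case True
    have "e / 3 > 0" using e by simp
    then obtain r where r: "r > 0" "\<And>w y. 0 < Re w \<Longrightarrow> Re w < r \<Longrightarrow> \<bar>Im w - y\<bar> < r \<Longrightarrow> dist (\<Phi> w) (boundary_value y) \<le> e / 3"
      using boundary_value_uniform by blast
    show ?thesis
    proof (intro exI[of _ r] conjI ballI impI)
      show "r > 0" by (rule r)
      fix w assume w: "w \<in> {w. 0 \<le> Re w}" "dist w w0 < r"
      have re: "\<bar>Re w\<bar> < r" using abs_Re_le_cmod[of "w - w0"] w True by (simp add: dist_norm)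
      have im: "\<bar>Im w - Im w0\<bar> < r" using abs_Im_le_cmod[of "w - w0"] w by (simp add: dist_norm)
      show "dist (extension w) (extension w0) < e"
      proof (cases "Re w = 0")
        case False
        then have "dist (\<Phi> w) (boundary_value (Im w0)) \<le> e / 3" using re im w by (intro r(2)) auto
        then show ?thesis using False True w e by (simp add: extension_def)
      next
        case T2: True
        define v where "v = Complex (r / 2) (Im w)"
        have "dist (\<Phi> v) (boundary_value (Im w)) \<le> e / 3" "dist (\<Phi> v) (boundary_value (Im w0)) \<le> e / 3"
          by (rule r(2); use im r(1) in \<open>simp add: v_def\<close>)+
        then have "dist (boundary_value (Im w)) (boundary_value (Im w0)) \<le> e / 3 + e / 3"
          using dist_triangle3[of "boundary_value (Im w)" "boundary_value (Im w0)" "\<Phi> v"] by simp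
        then show ?thesis using e by (simp add: extension_def True T2)
      qed
    qed
  qed
qed

lemma boundary_value_periodic: "boundary_value (y + 2 * pi * of_int k) = boundary_value y"
proof -
  have "\<Phi> (Complex (1 / real (Suc n)) (y + 2 * pi * of_int k)) = \<Phi> (Complex (1 / real (Suc n)) y)" for n
  proof -
    have "Complex (1 / real (Suc n)) (y + 2 * pi * of_int k) = Complex (1 / real (Suc n)) y + 2 * of_real pi * of_int k * \<i>"
      by (simp add: complex_eq_iff)
    then show ?thesis using Phi_periodic[of "Complex (1 / real (Suc n)) y" k] by simp
  qed
  then show ?thesis unfolding boundary_value_def by simp
qed

text \<open>Approximate \<open>p\<close> from the complement of \<open>K\<close>. Lifts with imaginary part in one period are bounded, because
\<open>\<Phi>\<close> tends to infinity with the real part, and a limit of lifts is on the axis because \<open>p\<close> is in \<open>K\<close>.\<close>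
lemma boundary_value_onto:
  assumes "p \<in> frontier K"
  shows "\<exists>y. boundary_value y = p"
proof -
  have "p \<in> closure (- K)" using assms by (simp add: frontier_closures)
  then obtain v where v: "\<And>n. v n \<in> - K" "v \<longlonglongrightarrow> p" by (auto simp: closure_sequential)
  have "\<exists>w. 0 < Re w \<and> 0 \<le> Im w \<and> Im w \<le> 2 * pi \<and> \<Phi> w = v n" for n
  proof -
    obtain w where w: "0 < Re w" "\<Phi> w = v n" using v(1)[of n] Phi_onto by blast
    define k where "k = - \<lfloor>Im w / (2 * pi)\<rfloor>"
    define w' where "w' = w + 2 * of_real pi * of_int k * \<i>"
    have im: "Im w' = 2 * pi * frac (Im w / (2 * pi))"
      by (simp add: w'_def k_def frac_def field_simps)
    have "0 \<le> frac (Im w / (2 * pi))" "frac (Im w / (2 * pi)) \<le> 1" using frac_lt_1 less_imp_le by auto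
    then have "0 \<le> Im w'" "Im w' \<le> 2 * pi * 1" unfolding im by (auto intro!: mult_left_mono simp: mult_left_le)
    moreover have "Re w' = Re w" by (simp add: w'_def)
    moreover have "\<Phi> w' = v n" using Phi_periodic[OF w(1)] w(2) by (simp add: w'_def)
    ultimately show ?thesis using w(1) by (intro exI[of _ w']) auto
  qed
  then obtain w where w: "\<And>n. 0 < Re (w n) \<and> 0 \<le> Im (w n) \<and> Im (w n) \<le> 2 * pi \<and> \<Phi> (w n) = v n" by metis
  obtain M where M: "\<And>n. norm (v n) \<le> M" using convergent_imp_bounded[OF v(2)] by (auto simp: bounded_iff)
  obtain R where R: "\<And>z. R < Re z \<Longrightarrow> M < norm (\<Phi> z)" using to_infinity[of M] by blast
  have "norm (w n) \<le> R + 2 * pi" for n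
  proof -
    have "Re (w n) \<le> R" using R[of "w n"] M[of n] w[of n] by force
    then show ?thesis using cmod_le[of "w n"] w[of n] by linarith
  qed
  then have "bounded (range w)" by (auto simp: bounded_iff)
  then obtain b s where b: "strict_mono s" "(w \<circ> s) \<longlonglongrightarrow> b" using bounded_imp_convergent_subsequence by blast
  have "(\<lambda>n. Re ((w \<circ> s) n)) \<longlonglongrightarrow> Re b" using b(2) by (rule tendsto_Re)
  then have "0 \<le> Re b" by (rule LIMSEQ_le_const) (use w less_imp_le in auto)
  then have "(\<lambda>n. extension ((w \<circ> s) n)) \<longlonglongrightarrow> extension b"
    using w by (intro continuous_on_tendsto_compose[OF continuous_on_extension b(2)]) (auto simp: less_imp_le)
  moreover have "(\<lambda>n. extension ((w \<circ> s) n)) = v \<circ> s" using w by (auto simp: extension_eq)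
  moreover have "(v \<circ> s) \<longlonglongrightarrow> p" using v(2) b(1) by (rule LIMSEQ_subseq_LIMSEQ)
  ultimately have eb: "extension b = p" using LIMSEQ_unique by metis
  have "Re b = 0"
  proof (rule ccontr)
    assume "Re b \<noteq> 0"
    then have "0 < Re b" using \<open>0 \<le> Re b\<close> by simp
    then have "p \<notin> K" using eb Phi_notin by (auto simp: extension_eq)
    then show False using assms frontier_subset_K by blast
  qed
  then show ?thesis using eb by (auto simp: extension_def)
qed

lemma extension_in_K_iff: "0 \<le> Re w \<Longrightarrow> extension w \<in> K \<longleftrightarrow> Re w = 0"
  using Phi_notin[of w] boundary_value_in_frontier frontier_subset_K by (auto simp: extension_def)

text \<open>Together with \<open>C\<close>, the image of the crosscut from height \<open>a\<close> to height \<open>b\<close> is a compact set that meets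
\<open>K\<close> in \<open>C\<close>; by \<open>separated_by_crosscut\<close> it separates points near the boundary value at \<open>a'\<close> from points near
the one at \<open>b'\<close>. But \<open>C'\<close> and two short segments ending at these boundary values connect such points without
meeting it.\<close>
proposition boundary_values_unlinked:
  assumes C: "compact C" "connected C" "C \<subseteq> K" and C': "compact C'" "connected C'" "C' \<subseteq> K"
    and disj: "C \<inter> C' = {}"
    and ord: "a < a'" "a' < b" "b < b'" "b' < a + 2 * pi"
    and ab: "boundary_value a \<in> C" "boundary_value b \<in> C" and ab': "boundary_value a' \<in> C'" "boundary_value b' \<in> C'"
  shows False
proof -
  define S where "S = extension ` crosscut 1 a b \<union> C"
  have pos: "crosscut 1 a b \<subseteq> {w. 0 \<le> Re w}" by (auto simp: crosscut_def)
  have "compact (crosscut 1 a b)"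
  proof -
    have "crosscut 1 a b = cbox (Complex 0 a) (Complex 1 b) \<inter> ({w. Im w = a} \<union> {w. Im w = b} \<union> {w. Re w = 1})"
      by (auto simp: crosscut_def in_cbox_complex_iff)
    moreover have "closed ({w. Im w = a} \<union> {w. Im w = b} \<union> {w::complex. Re w = 1})"
      by (intro closed_Un closed_Collect_eq continuous_intros)
    ultimately show ?thesis by (metis compact_Int_closed compact_cbox)
  qed
  then have cS: "compact S" unfolding S_def
    using continuous_on_subset[OF continuous_on_extension pos] C by (intro compact_Un compact_continuous_image) auto
  have crossK: "extension w \<in> C" if "w \<in> crosscut 1 a b" "extension w \<in> K" for w
  proof -
    have "Re w = 0" using extension_in_K_iff[of w] pos that by auto
    then show ?thesis using that ab by (auto simp: crosscut_def extension_def)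
  qed
  have SK: "S \<inter> K = C" using crossK C by (auto simp: S_def)
  define L where "L = (\<lambda>c. extension ` ((\<lambda>x. Complex x c) ` {0..1/2}))"
  define Z where "Z = L a' \<union> C' \<union> L b'"
  have conL: "connected (L c)" for c
    unfolding L_def by (intro connected_continuous_image continuous_on_subset[OF continuous_on_extension] continuous_intros) auto
  have inL: "boundary_value c \<in> L c" for c
    unfolding L_def using extension_boundary[of c] by (intro image_eqI[of _ _ "Complex 0 c"]) auto
  have "connected (L a' \<union> C')" using inL ab' by (intro connected_Un conL C') auto
  then have conZ: "connected Z" unfolding Z_def
    by (rule connected_Un[OF _ conL]) (use inL ab' in blast)
  have noint: "extension (Complex x c) \<notin> S" if x: "0 \<le> x" "x \<le> 1/2" and c: "c = a' \<or> c = b'" for x c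
  proof
    assume inS: "extension (Complex x c) \<in> S"
    show False
    proof (cases "x = 0")
      case True
      then have "extension (Complex x c) \<in> C'" using c ab' by (auto simp: extension_boundary)
      then have "extension (Complex x c) \<in> S \<inter> K" "extension (Complex x c) \<notin> C" using inS C' disj by auto
      then show False using SK by simp
    next
      case False
      then have notK: "extension (Complex x c) \<notin> K" using extension_in_K_iff[of "Complex x c"] x by simp
      then obtain u where u: "u \<in> crosscut 1 a b" "extension (Complex x c) = extension u" using inS C by (auto simp: S_def)
      then have ru: "0 < Re u" using notK extension_in_K_iff[of u] pos by force
      have x0: "0 < x" using False x by simp
      have eq: "\<Phi> (Complex x c) = \<Phi> u" using u(2) ru x0 by (simp add: extension_eq)
      have "x = Re u" using Re_eq[of "Complex x c" u] eq ru x0 by simp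
      then have "Im u = a \<or> Im u = b" using u(1) x by (auto simp: crosscut_def)
      then have near: "\<bar>c - Im u\<bar> < 2 * pi" "c \<noteq> Im u" using c ord by auto
      have "Complex x c = u" using inj_narrow[of "Complex x c" u] eq ru x0 near by simp
      then show False using near by auto
    qed
  qed
  have "Z \<inter> S = {}"
  proof -
    have "C' \<inter> S = {}" using SK C' disj by blast
    moreover have "L c \<inter> S = {}" if "c = a' \<or> c = b'" for c
      using noint[OF _ _ that] by (auto simp: L_def)
    ultimately show ?thesis unfolding Z_def by blast
  qed
  define z where "z = \<Phi> (Complex (1/2) a')"
  define q where "q = \<Phi> (Complex (1/2) b')"
  have "z \<in> L a'" "q \<in> L b'"
    unfolding L_def z_def q_def by (rule image_eqI[of _ _ "Complex (1/2) _"]; auto simp: extension_eq)+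
  then have "connected_component (- S) z q"
    unfolding connected_component_def using conZ \<open>Z \<inter> S = {}\<close> by (intro exI[of _ Z]) (auto simp: Z_def)
  moreover have "\<not> connected_component (- S) z q"
  proof (rule separated_by_crosscut[OF half_box(1-3)[of 1 a b]])
    show "v \<in> half_box 1 a b \<or> \<Phi> v \<in> S" if "v \<in> closure (half_box 1 a b)" "0 < Re v" for v
    proof -
      have "v \<in> half_box 1 a b \<or> v \<in> crosscut 1 a b" using half_box(4)[OF that] .
      moreover have "\<Phi> v = extension v" using that by (simp add: extension_eq)
      ultimately show ?thesis by (auto simp: S_def)
    qed
    show "compact S" "connected (S \<inter> K)" using cS SK C by auto
    show "z \<in> \<Phi> ` half_box 1 a b" using ord by (auto simp: z_def half_box_def)
    show "q \<notin> K" using Phi_notin by (simp add: q_def)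
    show "q \<notin> \<Phi> ` half_box 1 a b"
    proof
      assume "q \<in> \<Phi> ` half_box 1 a b"
      then obtain u where u: "u \<in> half_box 1 a b" "\<Phi> (Complex (1/2) b') = \<Phi> u" by (auto simp: q_def)
      then have ru: "0 < Re u" and iu: "a < Im u" "Im u < b" by (auto simp: half_box_def)
      have p: "0 < Re (Complex (1/2) b')" by simp
      have "\<bar>Im (Complex (1/2) b') - Im u\<bar> < 2 * pi" unfolding complex.sel using iu ord by linarith
      from inj_narrow[OF p ru u(2) this] have "Im u = b'" by auto
      then show False using iu ord by linarith
    qed
  qed
  ultimately show False by blast
qed

end

section \<open>The basin of infinity of a polynomial\<close>

lemma poly_superlinear:
  fixes p :: "complex poly"
  assumes "degree p \<ge> 2"
  shows "\<exists>r. \<forall>z. r \<le> norm z \<longrightarrow> M * norm z \<le> norm (poly p z)"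
proof -
  obtain a q where p: "p = pCons a q" by (cases p)
  have dq: "degree q > 0" using assms p by (auto split: if_splits)
  have "filterlim (poly q) at_infinity at_infinity" by (rule filterlim_poly_at_infinity[OF dq])
  then have "eventually (\<lambda>z. \<bar>M\<bar> + 1 \<le> norm (poly q z)) at_infinity"
    using filterlim_at_infinity[of 0 "poly q" at_infinity] by (metis abs_ge_zero add_strict_increasing2 less_eq_real_def order_refl zero_less_one)
  then obtain r where r: "\<And>z. r \<le> norm z \<Longrightarrow> \<bar>M\<bar> + 1 \<le> norm (poly q z)" by (auto simp: eventually_at_infinity)
  show ?thesis
  proof (intro exI[of _ "max r (norm a)"] allI impI)
    fix z :: complex assume z: "max r (norm a) \<le> norm z"
    have "(\<bar>M\<bar> + 1) * norm z \<le> norm (poly q z) * norm z" using r[of z] z by (intro mult_right_mono) auto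
    also have "\<dots> = norm (z * poly q z)" by (simp add: norm_mult)
    also have "\<dots> \<le> norm (poly p z) + norm a" using norm_triangle_ineq4[of "poly p z" a] by (simp add: p)
    finally have "(\<bar>M\<bar> + 1) * norm z \<le> norm (poly p z) + norm z" using z by simp
    then have "\<bar>M\<bar> * norm z \<le> norm (poly p z)" by (simp add: algebra_simps)
    moreover have "M * norm z \<le> \<bar>M\<bar> * norm z" by (intro mult_right_mono) auto
    ultimately show "M * norm z \<le> norm (poly p z)" by simp
  qed
qed

text \<open>The components are relatively open, and a compact set has no infinite partition into relatively open sets.\<close>
lemma finite_components_locally_connected:
  fixes J :: "'a::real_normed_vector set"
  assumes "compact J" "locally connected J"
  shows "finite (components J)"
proof -
  have "\<exists>G. open G \<and> c = J \<inter> G" if "c \<in> components J" for c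
    using openin_components_locally_connected[OF assms(2) that] by (auto simp: openin_open)
  then obtain G where G: "\<And>c. c \<in> components J \<Longrightarrow> open (G c) \<and> c = J \<inter> G c" by metis
  have "J \<subseteq> (\<Union>c\<in>components J. G c)" using G Union_components[of J] by blast
  then obtain T where T: "T \<subseteq> components J" "finite T" "J \<subseteq> (\<Union>c\<in>T. G c)"
    using compactE_image[OF assms(1), of "components J" G] G by metis
  have "components J \<subseteq> T"
  proof
    fix c assume c: "c \<in> components J"
    then obtain x where x: "x \<in> c" using in_components_nonempty by blast
    then have "x \<in> J" using c in_components_subset by blast
    then obtain c' where c': "c' \<in> T" "x \<in> G c'" using T by blast
    then have "x \<in> c'" using G T \<open>x \<in> J\<close> by blast
    then have "c = c'" using components_nonoverlap[OF c, of c'] c' T x by blast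
    then show "c \<in> T" using c' by simp
  qed
  then show ?thesis using T finite_subset by blast
qed

locale polynomial_basin =
  fixes p :: "complex poly"
  assumes deg: "degree p \<ge> 2"
begin

abbreviation f :: "complex \<Rightarrow> complex" where "f \<equiv> poly p"

definition basin :: "complex set" where "basin = escaping_set f"

definition escape_radius :: real where
  "escape_radius = (SOME r. r \<ge> 1 \<and> (\<forall>z. r \<le> norm z \<longrightarrow> 2 * norm z \<le> norm (f z)))"

lemma escape_radius: "escape_radius \<ge> 1" "escape_radius \<le> norm z \<Longrightarrow> 2 * norm z \<le> norm (f z)"
proof -
  obtain r where r: "\<forall>z. r \<le> norm z \<longrightarrow> 2 * norm z \<le> norm (f z)" using poly_superlinear[OF deg] by blast
  have "\<exists>r. r \<ge> 1 \<and> (\<forall>z. r \<le> norm z \<longrightarrow> 2 * norm z \<le> norm (f z))"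
    by (rule exI[of _ "max r 1"]) (use r in auto)
  from someI_ex[OF this] show "escape_radius \<ge> 1" "escape_radius \<le> norm z \<Longrightarrow> 2 * norm z \<le> norm (f z)" by (auto simp: escape_radius_def)
qed

lemma outside_grows: "escape_radius \<le> norm z \<Longrightarrow> 2 ^ n * norm z \<le> norm ((f ^^ n) z)"
proof (induction n)
  case (Suc n)
  have "1 * escape_radius \<le> 2 ^ n * norm z" using Suc.prems escape_radius(1) by (intro mult_mono) auto
  then have "escape_radius \<le> norm ((f ^^ n) z)" using Suc by linarith
  then have "2 * norm ((f ^^ n) z) \<le> norm (f ((f ^^ n) z))" by (rule escape_radius(2))
  then show ?case using Suc by simp
qed simp

lemma basin_iff: "z \<in> basin \<longleftrightarrow> (\<exists>n. escape_radius < norm ((f ^^ n) z))"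
proof
  assume "z \<in> basin"
  then have "filterlim (\<lambda>n. (f ^^ n) z) at_infinity sequentially" by (simp add: basin_def escaping_set_def)
  then have "eventually (\<lambda>n. escape_radius < norm ((f ^^ n) z)) sequentially" by (simp add: filterlim_at_infinity_conv_norm_at_top filterlim_at_top_dense)
  then show "\<exists>n. escape_radius < norm ((f ^^ n) z)" by (auto simp: eventually_sequentially)
next
  assume "\<exists>n. escape_radius < norm ((f ^^ n) z)"
  then obtain n where n: "escape_radius < norm ((f ^^ n) z)" by blast
  have "filterlim (\<lambda>k. norm ((f ^^ (k + n)) z)) at_top sequentially"
  proof (rule filterlim_at_top_mono)
    show "filterlim (\<lambda>k::nat. (2::real) ^ k) at_top sequentially"
      using filterlim_at_infinity_imp_norm_at_top[OF filterlim_realpow_sequentially_gt1[of "2::real"]]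
      by (simp add: norm_power)
    show "eventually (\<lambda>k. 2 ^ k \<le> norm ((f ^^ (k + n)) z)) sequentially"
    proof (rule always_eventually, rule allI)
      fix k
      have "2 ^ k * 1 \<le> 2 ^ k * norm ((f ^^ n) z)" using n escape_radius(1) by (intro mult_left_mono) auto
      also have "\<dots> \<le> norm ((f ^^ k) ((f ^^ n) z))" using n by (intro outside_grows) simp
      finally show "2 ^ k \<le> norm ((f ^^ (k + n)) z)" by (simp add: funpow_add)
    qed
  qed
  then have "eventually (\<lambda>k. M < norm ((f ^^ (k + n)) z)) sequentially" for M
    by (simp add: filterlim_at_top_dense)
  then have "eventually (\<lambda>k. M < norm ((f ^^ k) z)) sequentially" for M
    using eventually_sequentially_seg[of "\<lambda>k. M < norm ((f ^^ k) z)" n for M] by blast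
  then have "filterlim (\<lambda>k. (f ^^ k) z) at_infinity sequentially"
    by (simp add: filterlim_at_infinity_conv_norm_at_top filterlim_at_top_dense)
  then show "z \<in> basin" by (simp add: basin_def escaping_set_def)
qed

lemma iter_mono: "norm ((f ^^ Suc n) z) \<le> escape_radius \<Longrightarrow> norm ((f ^^ n) z) \<le> escape_radius"
proof (rule ccontr)
  assume a: "norm ((f ^^ Suc n) z) \<le> escape_radius" "\<not> norm ((f ^^ n) z) \<le> escape_radius"
  then have "2 * norm ((f ^^ n) z) \<le> norm (f ((f ^^ n) z))" by (intro escape_radius(2)) simp
  then show False using a escape_radius(1) by simp
qed

lemma basin_invariant: "f z \<in> basin \<longleftrightarrow> z \<in> basin"
proof
  assume "f z \<in> basin"
  then obtain n where "escape_radius < norm ((f ^^ n) (f z))" by (auto simp: basin_iff)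
  then have "escape_radius < norm ((f ^^ Suc n) z)" by (simp only: funpow_Suc_right o_apply)
  then show "z \<in> basin" unfolding basin_iff by blast
next
  assume "z \<in> basin"
  then obtain n where n: "escape_radius < norm ((f ^^ n) z)" by (auto simp: basin_iff)
  then have "escape_radius < norm ((f ^^ Suc n) z)" using iter_mono[of n z] by linarith
  then have "escape_radius < norm ((f ^^ n) (f z))" by (simp only: funpow_Suc_right o_apply)
  then show "f z \<in> basin" unfolding basin_iff by blast
qed

lemma basin_invariant_iter: "(f ^^ n) z \<in> basin \<longleftrightarrow> z \<in> basin"
  by (induction n) (auto simp: basin_invariant)

lemma continuous_iter: "continuous_on A (f ^^ n)"
proof (induction n)
  case (Suc n)
  have "continuous_on A (\<lambda>z. f ((f ^^ n) z))" by (intro continuous_on_poly Suc)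
  then show ?case by (simp add: o_def)
qed (auto intro: continuous_on_id simp: id_def)

lemma holomorphic_iter: "(f ^^ n) holomorphic_on A"
proof (induction n)
  case (Suc n)
  have "(\<lambda>z. f ((f ^^ n) z)) holomorphic_on A"
    by (intro holomorphic_intros Suc)
  then show ?case by (simp add: o_def)
qed (auto intro: holomorphic_on_id simp: id_def)

lemma not_const: "\<not> f constant_on UNIV"
proof
  assume "f constant_on UNIV"
  then obtain c where c: "\<And>z. f z = c" by (auto simp: constant_on_def)
  obtain r where r: "\<And>z. r \<le> norm z \<Longrightarrow> 1 * norm z \<le> norm (f z)" using poly_superlinear[OF deg] by blast
  have "\<bar>r\<bar> + norm c + 1 \<le> norm (f (of_real (\<bar>r\<bar> + norm c + 1)))"
  proof -
    have n: "norm (of_real (\<bar>r\<bar> + norm c + 1) :: complex) = \<bar>r\<bar> + norm c + 1" by (simp only: norm_of_real) simp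
    have "r \<le> \<bar>r\<bar> + norm c + 1" using norm_ge_zero[of c] abs_ge_self[of r] by linarith
    then show ?thesis using r[of "of_real (\<bar>r\<bar> + norm c + 1)"] unfolding n by simp
  qed
  then show False using c by simp
qed

lemma open_iter: "open U \<Longrightarrow> open ((f ^^ n) ` U)"
proof (induction n)
  case (Suc n)
  have "open (f ` (f ^^ n) ` U)"
    by (rule open_mapping_thm[of f UNIV]) (use Suc not_const in \<open>auto intro: holomorphic_intros\<close>)
  then show ?case by (simp add: image_comp)
qed simp

lemma outside_in_basin: "escape_radius < norm z \<Longrightarrow> z \<in> basin"
  unfolding basin_iff by (rule exI[of _ 0]) simp

lemma open_basin: "open basin"
proof -
  have "basin = (\<Union>n. {z. escape_radius < norm ((f ^^ n) z)})" by (auto simp: basin_iff)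
  moreover have "open {z. escape_radius < norm ((f ^^ n) z)}" for n
    by (intro open_Collect_less continuous_intros continuous_iter)
  ultimately show ?thesis by (metis (no_types, lifting) open_UN)
qed

lemma filled_julia_subset_cball: "- basin \<subseteq> cball 0 escape_radius"
  using outside_in_basin by force

lemma compact_filled_julia: "compact (- basin)"
  using open_basin bounded_subset[OF bounded_cball filled_julia_subset_cball] by (simp add: compact_eq_bounded_closed closed_Compl)

lemma filled_julia_nonempty: "- basin \<noteq> {}"
proof -
  have "degree (p + [:0, -1:]) = degree p" by (rule degree_add_eq_left) (use deg in simp)
  then have "\<not> constant (poly (p + [:0, -1:]))" using deg by (simp add: constant_degree)
  then obtain z where "poly (p + [:0, -1:]) z = 0" using fundamental_theorem_of_algebra by blast
  then have fz: "f z = z" by simp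
  have "(f ^^ n) z = z" for n by (induction n) (auto simp: fz)
  then have "z \<in> basin \<longleftrightarrow> escape_radius < norm z" by (simp add: basin_iff)
  moreover have "\<not> escape_radius < norm z"
  proof
    assume "escape_radius < norm z"
    then have "2 * norm z \<le> norm z" using escape_radius(2)[of z] fz by simp
    then show False using \<open>escape_radius < norm z\<close> escape_radius(1) by simp
  qed
  ultimately show ?thesis by blast
qed

text \<open>On the frontier of a component all orbits stay in the disc given by the escape radius; by the maximum
principle the same would hold in a bounded component.\<close>
lemma basin_component_unbounded:
  assumes W: "W \<in> components basin"
  shows "\<not> bounded W"
proof
  assume b: "bounded W"
  have oW: "open W" using W open_basin open_components by blast
  have fr: "frontier W \<subseteq> - basin"
    using frontier_of_components_subset[OF W] open_basin by (auto simp: frontier_def interior_open)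
  obtain w where w: "w \<in> W" using W in_components_nonempty by blast
  then have "w \<in> basin" using W in_components_subset by blast
  then obtain n where n: "escape_radius < norm ((f ^^ n) w)" by (auto simp: basin_iff)
  have "norm ((f ^^ n) w) \<le> escape_radius"
  proof (rule maximum_modulus_frontier[of "f ^^ n" W])
    show "f ^^ n holomorphic_on interior W" by (rule holomorphic_iter)
    show "continuous_on (closure W) (f ^^ n)" by (rule continuous_iter)
    show "bounded W" by (rule b)
    show "norm ((f ^^ n) z) \<le> escape_radius" if "z \<in> frontier W" for z
      using fr that basin_iff[of z] by (metis ComplD linorder_not_le subsetD)
    show "w \<in> W" by (rule w)
  qed
  then show False using n by simp
qed

lemma connected_basin: "connected basin"
proof -
  have con: "connected (- cball (0::complex) escape_radius)" by (rule connected_complement_bounded_convex) auto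
  have sub: "- cball 0 escape_radius \<subseteq> basin" using outside_in_basin by force
  have "W = W'" if W: "W \<in> components basin" "W' \<in> components basin" for W W'
  proof -
    have "W \<inter> - cball 0 escape_radius \<noteq> {}" "W' \<inter> - cball 0 escape_radius \<noteq> {}"
      using basin_component_unbounded[OF W(1)] basin_component_unbounded[OF W(2)] bounded_subset[OF bounded_cball] by blast+
    then have "- cball 0 escape_radius \<subseteq> W" "- cball 0 escape_radius \<subseteq> W'"
      using components_maximal[OF W(1) con sub] components_maximal[OF W(2) con sub] by auto
    then have "W \<inter> W' \<noteq> {}" using \<open>W \<inter> - cball 0 escape_radius \<noteq> {}\<close> by blast
    then show ?thesis using components_nonoverlap[OF W] by blast
  qed
  then show ?thesis unfolding connected_eq_connected_components_eq by blast
qed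

text \<open>Write \<open>K\<close> for the complement of the basin. Every component of \<open>K\<close> contains a component of the
frontier of \<open>K\<close>, so there are finitely many, and a component \<open>A\<close> is open in \<open>K\<close>. The sets \<open>D n\<close> of points whose \<open>n\<close>-th image is in the
closed disc \<open>D 0\<close> decrease to \<open>K\<close>, so for some \<open>n\<close> a neighbourhood of \<open>A\<close> cuts a piece \<open>Q\<close> out of \<open>D n\<close>
that is open and closed in it. The \<open>n\<close>-th iterate maps \<open>Q\<close> onto the disc, as the image is open and closed
in the disc, and thus maps \<open>A\<close> onto \<open>K\<close>.\<close>
lemma connected_filled_julia:
  assumes lc: "locally connected (frontier (- basin))"
  shows "connected (- basin)"
proof -
  define K where "K = - basin"
  have cK: "compact K" and Kne: "K \<noteq> {}" using compact_filled_julia filled_julia_nonempty by (auto simp: K_def)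
  have fJ: "finite (components (frontier K))"
    using finite_components_locally_connected[of "frontier K"] lc compact_frontier[OF cK] by (simp add: K_def)
  have fK: "frontier K \<subseteq> K" using cK frontier_subset_eq compact_imp_closed by blast
  have "\<exists>c. c \<in> components (frontier K) \<and> c \<subseteq> Y" if Y: "Y \<in> components K" for Y
  proof -
    have cY: "compact Y" using Y cK by (simp add: compact_components)
    have "Y \<noteq> {}" using Y in_components_nonempty by blast
    have "Y \<inter> frontier K \<noteq> {}"
    proof -
      have "frontier Y \<noteq> {}" using cY \<open>Y \<noteq> {}\<close> by (metis frontier_eq_empty compact_imp_bounded not_bounded_UNIV)
      moreover have "frontier Y \<subseteq> frontier K" by (rule frontier_of_components_subset[OF Y])
      moreover have "frontier Y \<subseteq> Y" using cY frontier_subset_eq compact_imp_closed by blast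
      ultimately show ?thesis by blast
    qed
    then obtain x where x: "x \<in> Y" "x \<in> frontier K" by blast
    define c where "c = connected_component_set (frontier K) x"
    have c: "c \<in> components (frontier K)" "x \<in> c" using x by (auto simp: c_def components_def)
    have "c \<subseteq> Y"
      by (rule components_maximal[OF Y]) (use c x fK in_components_connected in_components_subset in blast)+
    then show ?thesis using c by blast
  qed
  then obtain \<gamma> where \<gamma>: "\<And>Y. Y \<in> components K \<Longrightarrow> \<gamma> Y \<in> components (frontier K) \<and> \<gamma> Y \<subseteq> Y" by metis
  have "inj_on \<gamma> (components K)"
  proof (rule inj_onI)
    fix Y Y' assume Y: "Y \<in> components K" "Y' \<in> components K" "\<gamma> Y = \<gamma> Y'"
    have "\<gamma> Y \<noteq> {}" using \<gamma>[OF Y(1)] in_components_nonempty by blast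
    then have "Y \<inter> Y' \<noteq> {}" using \<gamma>[OF Y(1)] \<gamma>[OF Y(2)] Y(3) by blast
    then show "Y = Y'" using components_nonoverlap[OF Y(1,2)] by blast
  qed
  moreover have "\<gamma> ` components K \<subseteq> components (frontier K)" using \<gamma> by blast
  ultimately have fin: "finite (components K)" using fJ inj_on_finite by blast
  obtain A where A: "A \<in> components K" using Kne by (metis components_eq_empty ex_in_conv)
  define B where "B = \<Union>(components K - {A})"
  have cA: "compact A" using A cK by (simp add: compact_components)
  have cB: "compact B" unfolding B_def using fin cK by (intro compact_Union) (auto simp: compact_components)
  have AB: "A \<union> B = K" unfolding B_def using A Union_components[of K] by blast
  have disj: "A \<inter> B = {}" unfolding B_def using A components_nonoverlap by fastforce
  obtain OA OB where O: "open OA" "open OB" "A \<subseteq> OA" "B \<subseteq> OB" "OA \<inter> OB = {}"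
    using separation_normal[OF compact_imp_closed[OF cA] compact_imp_closed[OF cB] disj] by blast
  define D where "D = (\<lambda>n. {z. norm ((f ^^ n) z) \<le> escape_radius})"
  have clD: "closed (D n)" for n unfolding D_def by (intro closed_Collect_le continuous_intros continuous_iter)
  have decD: "D n \<subseteq> D m" if "m \<le> n" for m n
    using that by (induction rule: dec_induct) (use iter_mono in \<open>auto simp: D_def\<close>)
  have cD: "compact (D n)" for n
  proof -
    have "D n \<subseteq> D 0" by (rule decD) simp
    also have "D 0 = cball 0 escape_radius" by (auto simp: D_def)
    finally show ?thesis using clD by (simp add: compact_eq_bounded_closed bounded_subset[OF bounded_cball])
  qed
  have KD: "K = (\<Inter>n. D n)" 
  proof (intro set_eqI)
    fix z show "z \<in> K \<longleftrightarrow> z \<in> (\<Inter>n. D n)" unfolding K_def D_def Compl_iff basin_iff by (auto simp: not_less)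
  qed
  have "\<exists>n. D n \<subseteq> OA \<union> OB"
  proof (rule ccontr)
    assume "\<not> ?thesis"
    then have ne: "D n - (OA \<union> OB) \<noteq> {}" for n by blast
    have "\<Inter>(range (\<lambda>n. D n - (OA \<union> OB))) \<noteq> {}"
      by (rule compact_nest[OF _ ne]) (use cD O subsetD[OF decD] in \<open>auto intro!: compact_diff\<close>)
    then show False using KD AB O by blast
  qed
  then obtain n where n: "D n \<subseteq> OA \<union> OB" by blast
  define Q where "Q = D n \<inter> OA"
  have "Q = D n - OB" using n O by (auto simp: Q_def)
  then have cQ: "compact Q" using cD O by (auto intro: compact_diff)
  have im: "(f ^^ n) ` Q = cball 0 escape_radius \<inter> (f ^^ n) ` OA" unfolding Q_def D_def by auto
  have "A \<noteq> {}" using A in_components_nonempty by blast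
  then have Qne: "Q \<noteq> {}" using AB KD O unfolding Q_def by blast
  have "(f ^^ n) ` Q = cball 0 escape_radius"
  proof (rule connected_clopen[THEN iffD1, rule_format, of "cball 0 escape_radius" "(f ^^ n) ` Q", THEN disjE])
    show "connected (cball (0::complex) escape_radius)" by (intro convex_connected convex_cball)
    have "closed ((f ^^ n) ` Q)" using cQ continuous_iter compact_continuous_image compact_imp_closed by blast
    then show "openin (top_of_set (cball 0 escape_radius)) ((f ^^ n) ` Q) \<and> closedin (top_of_set (cball 0 escape_radius)) ((f ^^ n) ` Q)"
      using im open_iter[OF O(1)] by (auto simp: openin_open intro!: closed_subset)
  qed (use Qne in auto)
  then have "K \<subseteq> (f ^^ n) ` A"
  proof -
    assume sur: "(f ^^ n) ` Q = cball 0 escape_radius"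
    show ?thesis
    proof
      fix k assume k: "k \<in> K"
      then have "k \<in> cball 0 escape_radius" using filled_julia_subset_cball by (auto simp: K_def)
      then obtain q where q: "q \<in> Q" "k = (f ^^ n) q" using sur by blast
      then have "q \<in> K" using k basin_invariant_iter by (auto simp: K_def)
      moreover have "q \<notin> B" using q O by (auto simp: Q_def)
      ultimately show "k \<in> (f ^^ n) ` A" using q AB by blast
    qed
  qed
  moreover have "(f ^^ n) ` A \<subseteq> K" using AB basin_invariant_iter by (auto simp: K_def)
  ultimately have "K = (f ^^ n) ` A" by blast
  then show ?thesis using A in_components_connected connected_continuous_image[OF continuous_iter] by (metis K_def)
qed

end

section \<open>The Boettcher coordinate\<close>

lemma disc_maximum_modulus:
  fixes h k :: "complex \<Rightarrow> complex"
  assumes k: "k holomorphic_on ball 0 1"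
    and bd: "\<And>\<epsilon>. \<epsilon> > 0 \<Longrightarrow> \<exists>r<1. \<forall>z. r \<le> norm z \<and> norm z < 1 \<longrightarrow> norm (k z) \<le> 1 + \<epsilon>"
    and z: "norm z < 1"
  shows "norm (k z) \<le> 1"
proof (rule field_le_epsilon)
  fix e :: real assume "e > 0"
  then obtain r where r: "r < 1" "\<And>z. r \<le> norm z \<Longrightarrow> norm z < 1 \<Longrightarrow> norm (k z) \<le> 1 + e" using bd by blast
  define s where "s = (1 + max (max r (norm z)) 0) / 2"
  have s: "r \<le> s" "norm z < s" "0 < s" "s < 1" using r(1) z by (auto simp: s_def max_def)
  have sub: "cball 0 s \<subseteq> ball (0::complex) 1" using s by auto
  show "norm (k z) \<le> 1 + e"
  proof (rule maximum_modulus_frontier[of k "cball 0 s"])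
    show "k holomorphic_on interior (cball 0 s)"
      by (rule holomorphic_on_subset[OF k]) (use sub interior_subset in blast)
    show "continuous_on (closure (cball 0 s)) k"
      using holomorphic_on_imp_continuous_on[OF k] continuous_on_subset sub by auto
    show "norm (k v) \<le> 1 + e" if "v \<in> frontier (cball 0 s)" for v
      using that s r(2)[of v] by (simp add: frontier_cball)
  qed (use s in auto)
qed

text \<open>As 0 is the only zero, \<open>h z = z ^ n * k z\<close> without zeros of \<open>k\<close>. Near the unit circle the moduli of \<open>h\<close> and
of \<open>z ^ n\<close> tend to 1, so the maximum principle for \<open>k\<close> and for \<open>1 / k\<close> shows that \<open>k\<close> has modulus 1.\<close>
lemma proper_disc_self_map:
  fixes h :: "complex \<Rightarrow> complex"
  assumes h: "h holomorphic_on ball 0 1" and h1: "\<And>z. norm z < 1 \<Longrightarrow> norm (h z) < 1"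
    and h0: "h 0 = 0" and zero: "\<And>z. norm z < 1 \<Longrightarrow> h z = 0 \<Longrightarrow> z = 0"
    and proper: "\<And>s. s < 1 \<Longrightarrow> \<exists>r<1. \<forall>z. r \<le> norm z \<and> norm z < 1 \<longrightarrow> s < norm (h z)"
  obtains c n where "norm c = 1" "n > 0" "\<And>z. norm z < 1 \<Longrightarrow> h z = c * z ^ n"
proof -
  have nc: "\<not> h constant_on ball 0 1"
  proof
    assume "h constant_on ball 0 1"
    then have "h (1/2) = h 0" by (auto simp: constant_on_def)
    then show False using zero[of "1/2"] h0 by simp
  qed
  have z1: "(0::complex) \<in> ball 0 1" by simp
  obtain g r n where g: "0 < n" "0 < r" "ball 0 r \<subseteq> ball (0::complex) 1" "g holomorphic_on ball 0 r"
    "\<And>w. w \<in> ball 0 r \<Longrightarrow> h w = (w - 0) ^ n * g w" "\<And>w. w \<in> ball 0 r \<Longrightarrow> g w \<noteq> 0"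
    by (rule holomorphic_factor_zero_nonconstant[OF h open_ball connected_ball z1 h0 nc]) (rule that)
  define k where "k = (\<lambda>z. if z \<in> ball 0 r then g z else h z / z ^ n)"
  have hk: "h z = z ^ n * k z" if "norm z < 1" for z
  proof (cases "z \<in> ball 0 r")
    case True
    then show ?thesis using g(5) by (simp add: k_def)
  next
    case False
    then have "z \<noteq> 0" using g(2) by auto
    then show ?thesis using False by (simp add: k_def)
  qed
  have k0: "k z \<noteq> 0" if "norm z < 1" for z
  proof (cases "z \<in> ball 0 r")
    case True
    then show ?thesis using g(6) by (simp add: k_def)
  next
    case False
    then have "z \<noteq> 0" using g(2) by auto
    then have "h z \<noteq> 0" using zero that by blast
    then show ?thesis using hk[OF that] by auto
  qed
  have holk: "k holomorphic_on ball 0 1"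
  proof -
    have "(\<lambda>z. if z \<in> ball 0 r then g z else h z / z ^ n) holomorphic_on (ball 0 r \<union> (ball 0 1 - {0}))"
    proof (rule holomorphic_on_If_Un[OF g(4)])
      show "(\<lambda>z. h z / z ^ n) holomorphic_on ball 0 1 - {0}"
        by (intro holomorphic_intros holomorphic_on_subset[OF h]) auto
      show "g z = h z / z ^ n" if "z \<in> ball 0 r" "z \<in> ball 0 1 - {0}" for z
        using g(5)[OF that(1)] that by simp
    qed (auto intro: open_delete)
    moreover have "ball 0 r \<union> (ball 0 1 - {0}) = ball (0::complex) 1" using g(2,3) by auto
    ultimately show ?thesis by (simp add: k_def)
  qed
  have power_lim: "\<exists>r<1. \<forall>t. r \<le> t \<and> t < 1 \<longrightarrow> b < t ^ n" if "b < 1" for b :: real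
  proof -
    have "isCont (\<lambda>t::real. t ^ n) 1" by (intro continuous_intros)
    then have "((\<lambda>t::real. t ^ n) \<longlongrightarrow> 1) (at 1)" by (simp add: isCont_def)
    then have "eventually (\<lambda>t::real. b < t ^ n) (at 1)" using that order_tendstoD(1) by fastforce
    then obtain d where d: "d > 0" "\<And>t. t \<noteq> 1 \<Longrightarrow> dist t 1 < d \<Longrightarrow> b < t ^ n" by (auto simp: eventually_at)
    show ?thesis
      by (rule exI[of _ "1 - d / 2"]) (use d in \<open>auto simp: dist_real_def\<close>)
  qed
  have le: "norm (k z) \<le> 1" if "norm z < 1" for z
  proof (rule disc_maximum_modulus[OF holk _ that])
    fix e :: real assume e: "e > 0"
    have "1 / (1 + e) < 1" using e by simp
    then obtain q where q: "q < 1" "\<And>t. q \<le> t \<Longrightarrow> t < 1 \<Longrightarrow> 1 / (1 + e) < t ^ n" using power_lim by blast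
    show "\<exists>r<1. \<forall>z. r \<le> norm z \<and> norm z < 1 \<longrightarrow> norm (k z) \<le> 1 + e"
    proof (intro exI[of _ q] conjI allI impI q(1))
      fix z :: complex assume z: "q \<le> norm z \<and> norm z < 1"
      have p: "1 / (1 + e) < norm z ^ n" using q(2) z by blast
      have "norm (k z) * (1 / (1 + e)) \<le> norm (k z) * norm z ^ n" using p by (intro mult_left_mono) auto
      also have "\<dots> = norm (h z)" using hk[of z] z by (simp add: norm_mult norm_power)
      also have "\<dots> \<le> 1" using h1[of z] z by simp
      finally show "norm (k z) \<le> 1 + e" using e by (simp add: field_simps)
    qed
  qed
  have ge: "norm (inverse (k z)) \<le> 1" if "norm z < 1" for z
  proof (rule disc_maximum_modulus[OF _ _ that])
    show "(\<lambda>z. inverse (k z)) holomorphic_on ball 0 1" using k0 by (intro holomorphic_intros holk) auto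
    fix e :: real assume e: "e > 0"
    have "1 / (1 + e) < 1" using e by simp
    then obtain q where q: "q < 1" "\<And>z. q \<le> norm z \<and> norm z < 1 \<Longrightarrow> 1 / (1 + e) < norm (h z)" using proper by blast
    show "\<exists>r<1. \<forall>z. r \<le> norm z \<and> norm z < 1 \<longrightarrow> norm (inverse (k z)) \<le> 1 + e"
    proof (intro exI[of _ q] conjI allI impI q(1))
      fix z :: complex assume z: "q \<le> norm z \<and> norm z < 1"
      have "1 / (1 + e) < norm (h z)" using q(2) z by blast
      also have "\<dots> = norm z ^ n * norm (k z)" using hk[of z] z by (simp add: norm_mult norm_power)
      also have "\<dots> \<le> 1 * norm (k z)" using z by (intro mult_right_mono power_le_one) auto
      finally have "1 / (1 + e) < norm (k z)" by simp
      then have "inverse (norm (k z)) \<le> inverse (1 / (1 + e))" using e by (intro le_imp_inverse_le) auto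
      then show "norm (inverse (k z)) \<le> 1 + e" using e by (simp add: norm_inverse)
    qed
  qed
  have one: "norm (k z) = 1" if "norm z < 1" for z
  proof -
    have "0 < norm (k z)" using k0[OF that] by simp
    then have "1 \<le> norm (k z)" using ge[OF that] by (auto simp: norm_inverse inverse_le_1_iff)
    then show ?thesis using le[OF that] by simp
  qed
  have "k constant_on ball 0 1"
    by (rule maximum_modulus_principle[OF holk open_ball connected_ball open_ball order_refl, of 0]) (auto simp: one)
  then obtain c where c: "\<And>z. z \<in> ball 0 1 \<Longrightarrow> k z = c" by (auto simp: constant_on_def)
  show ?thesis
  proof (rule that[of c n])
    show "norm c = 1" using one[of 0] c[of 0] by simp
    show "n > 0" by (rule g)
    show "h z = c * z ^ n" if "norm z < 1" for z using hk[OF that] c[of z] that by simp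
  qed
qed

text \<open>The inversion \<open>u = 1 / (z - a)\<close> about a point \<open>a\<close> off the basin moves infinity to 0. The basin with infinity added
becomes the domain \<open>inverted_basin\<close>, and \<open>f\<close> becomes \<open>inverted_map\<close>. The value at 0 is prescribed
separately because \<open>inverse 0 = 0\<close>.\<close>
locale boettcher = polynomial_basin +
  fixes a :: complex
  assumes a: "a \<notin> basin" and nontrivial: "\<exists>b. b \<notin> basin \<and> b \<noteq> a" and conK: "connected (- basin)"
begin

definition inverted_basin :: "complex set" where
  "inverted_basin = insert 0 {u. u \<noteq> 0 \<and> a + inverse u \<in> basin}"

definition inverted_map :: "complex \<Rightarrow> complex" where
  "inverted_map u = (if u = 0 then 0 else inverse (f (a + inverse u) - a))"

lemma near_infinity:
  assumes "u \<noteq> 0" "norm u < 1 / (\<bar>M\<bar> + norm a + 1)"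
  shows "M < norm (a + inverse u)"
proof -
  have X: "0 < \<bar>M\<bar> + norm a + 1" by (simp add: add_nonneg_pos)
  then have "norm u * (\<bar>M\<bar> + norm a + 1) < 1" using assms(2) by (simp only: pos_less_divide_eq)
  then have "\<bar>M\<bar> + norm a + 1 < 1 / norm u" using assms(1) by (simp add: pos_less_divide_eq mult.commute)
  also have "1 / norm u = norm (inverse u)" by (simp add: norm_inverse inverse_eq_divide norm_divide)
  also have "\<dots> \<le> norm (a + inverse u) + norm a" using norm_triangle_ineq4[of "a + inverse u" a] by simp
  finally show ?thesis by linarith
qed

lemma inverted_basin_ball: "\<exists>c>0. ball 0 c \<subseteq> inverted_basin"
proof (intro exI[of _ "1 / (\<bar>escape_radius\<bar> + norm a + 1)"] conjI)
  show "0 < 1 / (\<bar>escape_radius\<bar> + norm a + 1)" using norm_ge_zero[of a] abs_ge_zero[of escape_radius] by (simp add: add_nonneg_pos)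
  show "ball 0 (1 / (\<bar>escape_radius\<bar> + norm a + 1)) \<subseteq> inverted_basin"
    using near_infinity[of _ escape_radius] outside_in_basin by (auto simp: inverted_basin_def)
qed

lemma open_inverted_basin: "open inverted_basin"
proof -
  obtain c where c: "c > 0" "ball 0 c \<subseteq> inverted_basin" using inverted_basin_ball by blast
  have "open ((- {0}) \<inter> (\<lambda>u. a + inverse u) -` basin)"
    by (intro continuous_open_preimage continuous_intros open_basin) auto
  moreover have "inverted_basin = ball 0 c \<union> ((- {0}) \<inter> (\<lambda>u. a + inverse u) -` basin)"
    using c by (auto simp: inverted_basin_def)
  ultimately show ?thesis by (metis open_Un open_ball)
qed

lemma inverted_basin_eq_image: "inverted_basin = insert 0 ((\<lambda>z. inverse (z - a)) ` basin)"
proof -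
  have "u \<in> (\<lambda>z. inverse (z - a)) ` basin" if "a + inverse u \<in> basin" for u
    by (rule image_eqI[of _ _ "a + inverse u"]) (use that in auto)
  moreover have "inverse (z - a) \<noteq> 0 \<and> a + inverse (inverse (z - a)) \<in> basin" if "z \<in> basin" for z
    using that a by auto
  ultimately show ?thesis unfolding inverted_basin_def by blast
qed

lemma connected_inverted_basin: "connected inverted_basin"
proof -
  obtain c where c: "c > 0" "ball 0 c \<subseteq> inverted_basin" using inverted_basin_ball by blast
  define I where "I = (\<lambda>z. inverse (z - a)) ` basin"
  have I: "connected I" unfolding I_def
    using a by (intro connected_continuous_image connected_basin continuous_intros) auto
  have "of_real (c / 2) \<in> ball (0::complex) c" "of_real (c / 2) \<noteq> (0::complex)" using c by auto
  moreover have "inverted_basin = insert 0 I" using inverted_basin_eq_image I_def by simp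
  ultimately have "of_real (c / 2) \<in> I" using c(2) by blast
  with \<open>of_real (c / 2) \<in> ball (0::complex) c\<close> have "ball 0 c \<inter> I \<noteq> {}" by blast
  then have "connected (ball 0 c \<union> I)" by (intro connected_Un I connected_ball)
  moreover have "ball 0 c \<union> I = inverted_basin" using c \<open>inverted_basin = insert 0 I\<close> by auto
  ultimately show ?thesis by simp
qed

text \<open>If the complement of the domain had a bounded component, it would have a nonempty compact and relatively open
subset \<open>T\<close>. Undoing the inversion, \<open>T\<close> becomes a nonempty open and closed subset of the connected
complement of the basin, and it misses \<open>a\<close>.\<close>
lemma simply_connected_inverted_basin: "simply_connected inverted_basin"
proof -
  have "\<not> bounded Y" if Y: "Y \<in> components (- inverted_basin)" for Y
  proof
    assume bY: "bounded Y"
    have clO: "closed (- inverted_basin)" using open_inverted_basin by (simp add: closed_Compl)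
    have "closed Y" using closed_components[OF clO Y] .
    then have cY: "compact Y" using bY by (simp add: compact_eq_bounded_closed)
    obtain T where T: "openin (top_of_set (- inverted_basin)) T" "compact T" "Y \<subseteq> T"
      using Sura_Bura_clopen_subset[OF closed_imp_locally_compact[OF clO] Y cY open_UNIV] by auto
    obtain W where W: "open W" "T = - inverted_basin \<inter> W" using T(1) by (auto simp: openin_open)
    define L where "L = (\<lambda>u. a + inverse u) ` T"
    have T0: "0 \<notin> T" using W by (auto simp: inverted_basin_def)
    have "compact L" unfolding L_def using T0
      by (intro compact_continuous_image T continuous_intros) auto
    moreover have LK: "L \<subseteq> - basin" using W T0 by (auto simp: L_def inverted_basin_def)
    ultimately have cl: "closedin (top_of_set (- basin)) L" by (simp add: closed_subset compact_imp_closed)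
    have oW: "open ((- {a}) \<inter> (\<lambda>z. inverse (z - a)) -` W)"
      by (intro continuous_open_preimage continuous_intros W) auto
    have "L = - basin \<inter> ((- {a}) \<inter> (\<lambda>z. inverse (z - a)) -` W)"
    proof
      show "L \<subseteq> - basin \<inter> ((- {a}) \<inter> (\<lambda>z. inverse (z - a)) -` W)"
        using LK T0 W by (auto simp: L_def)
      show "- basin \<inter> ((- {a}) \<inter> (\<lambda>z. inverse (z - a)) -` W) \<subseteq> L"
      proof
        fix z assume z: "z \<in> - basin \<inter> ((- {a}) \<inter> (\<lambda>z. inverse (z - a)) -` W)"
        then have "inverse (z - a) \<in> T" unfolding W by (auto simp: inverted_basin_def)
        then show "z \<in> L" unfolding L_def by (intro image_eqI[of _ _ "inverse (z - a)"]) auto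
      qed
    qed
    then have op: "openin (top_of_set (- basin)) L" using oW by (auto simp: openin_open)
    have "L = {} \<or> L = - basin" using conK cl op by (meson connected_clopen)
    moreover have "L \<noteq> {}" using T(3) Y in_components_nonempty by (fastforce simp: L_def)
    moreover have "a \<notin> L" using T0 by (auto simp: L_def)
    ultimately show False using a by auto
  qed
  then show ?thesis
    using simply_connected_eq_unbounded_complement_components[OF open_inverted_basin] connected_inverted_basin by blast
qed

lemma inverted_basin_not_UNIV: "inverted_basin \<noteq> UNIV"
proof -
  obtain b where b: "b \<notin> basin" "b \<noteq> a" using nontrivial by blast
  have "inverse (b - a) \<notin> inverted_basin" using b by (auto simp: inverted_basin_def)
  then show ?thesis by blast
qed

lemma riemann_map:
  obtains \<psi> \<xi> where "\<psi> holomorphic_on ball 0 1" "\<xi> holomorphic_on inverted_basin" "\<psi> 0 = 0"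
    "\<And>u. u \<in> inverted_basin \<Longrightarrow> norm (\<xi> u) < 1 \<and> \<psi> (\<xi> u) = u"
    "\<And>z. norm z < 1 \<Longrightarrow> \<psi> z \<in> inverted_basin \<and> \<xi> (\<psi> z) = z"
proof -
  have "inverted_basin \<noteq> {}" by (auto simp: inverted_basin_def)
  then obtain F G where F: "F holomorphic_on inverted_basin" "G holomorphic_on ball 0 1"
    "\<And>u. u \<in> inverted_basin \<Longrightarrow> F u \<in> ball 0 1 \<and> G (F u) = u" "\<And>z. z \<in> ball 0 1 \<Longrightarrow> G z \<in> inverted_basin \<and> F (G z) = z"
    using Riemann_mapping_theorem[of inverted_basin] open_inverted_basin simply_connected_inverted_basin inverted_basin_not_UNIV by metis
  have 0: "0 \<in> inverted_basin" by (simp add: inverted_basin_def)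
  obtain A B where AB: "A (F 0) = 0" "A holomorphic_on ball 0 1" "A ` ball 0 1 \<subseteq> ball 0 1"
    "B holomorphic_on ball 0 1" "B ` ball 0 1 \<subseteq> ball 0 1"
    "\<And>z. z \<in> ball 0 1 \<Longrightarrow> A (B z) = z" "\<And>z. z \<in> ball 0 1 \<Longrightarrow> B (A z) = z"
    using ball_biholomorphism_exists[of "F 0"] F(3)[OF 0] by metis
  show ?thesis
  proof (rule that[of "\<lambda>z. G (B z)" "\<lambda>u. A (F u)"])
    show "(\<lambda>z. G (B z)) holomorphic_on ball 0 1"
      using holomorphic_on_compose_gen[OF AB(4) F(2) AB(5)] by (simp add: o_def)
    have "F ` inverted_basin \<subseteq> ball 0 1" using F(3) by auto
    then show "(\<lambda>u. A (F u)) holomorphic_on inverted_basin"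
      using holomorphic_on_compose_gen[OF F(1) AB(2)] by (simp add: o_def)
    show "G (B 0) = 0" using AB(1) AB(7)[of "F 0"] F(3)[OF 0] by simp
    fix u assume u: "u \<in> inverted_basin"
    then have "A (F u) \<in> ball 0 1" using F(3) AB(3) by blast
    then show "norm (A (F u)) < 1 \<and> G (B (A (F u))) = u" using AB(7) F(3)[OF u] by simp
  next
    fix z :: complex assume "norm z < 1"
    then have z: "z \<in> ball 0 1" by simp
    then have "B z \<in> ball 0 1" using AB(5) by blast
    then show "G (B z) \<in> inverted_basin \<and> A (F (G (B z))) = z" using F(4) AB(6)[OF z] by simp
  qed
qed

lemma f_inverted_basin:
  assumes "u \<in> inverted_basin" "u \<noteq> 0"
  shows "f (a + inverse u) \<in> basin" "f (a + inverse u) \<noteq> a"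
proof -
  have "a + inverse u \<in> basin" using assms by (auto simp: inverted_basin_def)
  then show "f (a + inverse u) \<in> basin" by (rule basin_invariant[THEN iffD2])
  then show "f (a + inverse u) \<noteq> a" using a by metis
qed

lemma inverted_map_eq_0:
  assumes "u \<in> inverted_basin" "inverted_map u = 0"
  shows "u = 0"
proof (rule ccontr)
  assume u: "u \<noteq> 0"
  then have "inverse (f (a + inverse u) - a) = 0" using assms(2) by (simp add: inverted_map_def)
  then show False using f_inverted_basin(2)[OF assms(1) u] by simp
qed

lemma inverted_map_in:
  assumes "u \<in> inverted_basin"
  shows "inverted_map u \<in> inverted_basin"
proof (cases "u = 0")
  case False
  note v = f_inverted_basin[OF assms False]
  have "inverted_map u \<noteq> 0" "a + inverse (inverted_map u) = f (a + inverse u)" using False v(2) by (simp_all add: inverted_map_def)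
  then show ?thesis using v(1) by (simp add: inverted_basin_def)
qed (simp add: inverted_map_def inverted_basin_def)

text \<open>This is the superlinear growth of \<open>f\<close> at infinity; it makes the derivative at 0 vanish.\<close>
lemma inverted_map_small:
  assumes "\<epsilon> > 0"
  shows "\<exists>\<delta>>0. \<forall>u::complex. norm u < \<delta> \<longrightarrow> norm (inverted_map u) \<le> \<epsilon> * norm u"
proof -
  define M where "M = 2 / \<epsilon> + 1"
  have M: "M > 1" "2 / M \<le> \<epsilon>" using assms by (auto simp: M_def field_simps)
  obtain r where r: "\<And>z. r \<le> norm z \<Longrightarrow> (2 * M) * norm z \<le> norm (f z)" using poly_superlinear[OF deg] by blast
  define Q where "Q = \<bar>r\<bar> + norm a + 1"
  define \<delta> where "\<delta> = 1 / (\<bar>Q\<bar> + norm a + 1)"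
  show ?thesis
  proof (intro exI[of _ \<delta>] conjI allI impI)
    show "\<delta> > 0" unfolding \<delta>_def by (simp add: add_nonneg_pos)
    fix u :: complex assume u: "norm u < \<delta>"
    show "norm (inverted_map u) \<le> \<epsilon> * norm u"
    proof (cases "u = 0")
      case False
      define z where "z = a + inverse u"
      have z: "Q < norm z" unfolding z_def by (rule near_infinity[OF False u[unfolded \<delta>_def]])
      have "norm a \<le> norm z" "r \<le> norm z" "1 \<le> norm z" using z norm_ge_zero[of a] abs_ge_self[of r] abs_ge_zero[of r] unfolding Q_def by linarith+
      have "inverse (norm u) \<le> norm z + norm a"
        using norm_triangle_ineq4[of z a] by (simp add: z_def norm_inverse)
      also have "\<dots> \<le> 2 * norm z" using \<open>norm a \<le> norm z\<close> by simp
      finally have iu: "inverse (norm u) \<le> 2 * norm z" .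
      have "(2 * M) * norm z \<le> norm (f z - a) + norm a"
        using r[OF \<open>r \<le> norm z\<close>] norm_triangle_ineq[of "f z - a" a] by simp
      moreover have "1 * norm z \<le> M * norm z" using M by (intro mult_right_mono) auto
      ultimately have fz: "M * norm z \<le> norm (f z - a)" using \<open>norm a \<le> norm z\<close> by simp
      have zp: "0 < norm z" using \<open>1 \<le> norm z\<close> by linarith
      have up: "0 < norm u" using False by simp
      have "norm (inverted_map u) = inverse (norm (f z - a))" using False by (simp add: inverted_map_def z_def norm_inverse)
      also have "\<dots> \<le> inverse (M * norm z)" using fz M zp by (intro le_imp_inverse_le) auto
      also have "\<dots> = (2 / M) * inverse (2 * norm z)" using M zp by (simp add: field_simps)
      also have "\<dots> \<le> (2 / M) * norm u"
      proof (rule mult_left_mono)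
        show "inverse (2 * norm z) \<le> norm u" using le_imp_inverse_le[OF iu] up by simp
      qed (use M in auto)
      also have "\<dots> \<le> \<epsilon> * norm u" using M by (intro mult_right_mono) auto
      finally show ?thesis .
    qed (simp add: inverted_map_def)
  qed
qed

lemma inverted_map_deriv_0: "(inverted_map has_field_derivative 0) (at 0)"
  unfolding has_field_derivative_def
proof (rule has_derivativeI)
  show "bounded_linear ((*) (0::complex))" by (rule bounded_linear_mult_right)
  show "((\<lambda>y. (inverted_map y - inverted_map 0 - 0 * (y - 0)) /\<^sub>R norm (y - 0)) \<longlongrightarrow> 0) (at 0)"
  proof (rule tendstoI)
    fix e :: real assume "e > 0"
    then obtain \<delta> where d: "\<delta> > 0" "\<And>u. norm u < \<delta> \<Longrightarrow> norm (inverted_map u) \<le> e / 2 * norm u"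
      using inverted_map_small[of "e / 2"] by auto
    show "eventually (\<lambda>y. dist ((inverted_map y - inverted_map 0 - 0 * (y - 0)) /\<^sub>R norm (y - 0)) 0 < e) (at 0)"
      unfolding eventually_at
    proof (intro exI[of _ \<delta>] conjI ballI impI d(1))
      fix y :: complex assume y: "y \<noteq> 0 \<and> dist y 0 < \<delta>"
      then have "norm (inverted_map y) \<le> e / 2 * norm y" using d(2) by simp
      then have "norm (inverted_map y) / norm y \<le> e / 2" using y by (simp add: field_simps)
      moreover have "norm (inverted_map y) / norm y = inverse (norm y) * norm (inverted_map y)" by (simp only: divide_inverse mult.commute)
      moreover have "inverted_map 0 = 0" by (simp add: inverted_map_def)
      ultimately show "dist ((inverted_map y - inverted_map 0 - 0 * (y - 0)) /\<^sub>R norm (y - 0)) 0 < e"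
        using \<open>e > 0\<close> by simp
    qed
  qed
qed

lemma inverted_map_holomorphic: "inverted_map holomorphic_on inverted_basin"
proof (rule no_isolated_singularity'[where K = "{0}"])
  show "(inverted_map \<longlongrightarrow> inverted_map z) (at z within inverted_basin)" if "z \<in> {0}" for z
  proof -
    have "isCont inverted_map 0" by (rule DERIV_isCont[OF inverted_map_deriv_0])
    then have "(inverted_map \<longlongrightarrow> inverted_map 0) (at 0)" by (simp add: isCont_def)
    then show ?thesis using that by (auto intro: tendsto_within_subset)
  qed
  have "(\<lambda>u. inverse (f (a + inverse u) - a)) holomorphic_on inverted_basin - {0}"
  proof (intro holomorphic_intros)
    show "f (a + inverse z) - a \<noteq> 0" if "z \<in> inverted_basin - {0}" for z
      using that f_inverted_basin[of z] by auto
  qed auto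
  then show "inverted_map holomorphic_on inverted_basin - {0}"
    by (rule holomorphic_transform) (auto simp: inverted_map_def)
qed (auto simp: open_inverted_basin)

text \<open>A subsequence either converges to 0, or it stays away from 0; in the latter case the points
\<open>a + inverse (u n)\<close> are bounded and accumulate at a point that \<open>f\<close> maps into the basin.\<close>
lemma inverted_map_proper:
  assumes u: "\<And>n. u n \<in> inverted_basin" and l: "l \<in> inverted_basin" and lim: "(\<lambda>n. inverted_map (u n)) \<longlonglongrightarrow> l"
  shows "\<exists>v\<in>inverted_basin. \<exists>s. strict_mono s \<and> (u \<circ> s) \<longlonglongrightarrow> v"
proof (cases "\<forall>\<delta>>0. \<exists>\<^sub>F n in sequentially. norm (u n) < \<delta>")
  case True
  have ex: "\<exists>n>m. norm (u n) < inverse (real (Suc k))" for m k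
  proof -
    have "\<exists>\<^sub>F n in sequentially. norm (u n) < inverse (real (Suc k))" using True by simp
    then show ?thesis unfolding frequently_sequentially by (meson Suc_le_lessD)
  qed
  obtain s where s: "strict_mono s" "\<And>k. norm (u (s (Suc k))) < inverse (real (Suc k))"
  proof -
    have "\<exists>s. \<forall>k. s k < s (Suc k) \<and> norm (u (s (Suc k))) < inverse (real (Suc k))"
      using dependent_nat_choice[of "\<lambda>_ _. True" "\<lambda>k m n. m < n \<and> norm (u n) < inverse (real (Suc k))"] ex by auto
    then show ?thesis using that by (auto simp: strict_mono_Suc_iff)
  qed
  have "(\<lambda>k. u (s (Suc k))) \<longlonglongrightarrow> 0"
  proof (rule Lim_null_comparison[OF _ LIMSEQ_inverse_real_of_nat])
    show "eventually (\<lambda>k. norm (u (s (Suc k))) \<le> inverse (real (Suc k))) sequentially"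
      using s(2) by (intro always_eventually allI less_imp_le)
  qed
  then have "(u \<circ> s) \<longlonglongrightarrow> 0" using LIMSEQ_imp_Suc[of "u \<circ> s" 0] by (simp add: o_def)
  moreover have "0 \<in> inverted_basin" by (simp add: inverted_basin_def)
  ultimately show ?thesis using s(1) by blast
next
  case False
  then obtain \<delta> where \<delta>: "\<delta> > 0" "eventually (\<lambda>n. \<not> norm (u n) < \<delta>) sequentially"
    by (auto simp: frequently_def)
  then obtain n0 where n0: "\<And>n. n \<ge> n0 \<Longrightarrow> \<delta> \<le> norm (u n)" by (auto simp: eventually_sequentially not_less)
  define y where "y = (\<lambda>n. a + inverse (u (n + n0)))"
  have u0: "u (n + n0) \<noteq> 0" for n using n0[of "n + n0"] \<delta>(1) by auto
  have yV: "y n \<in> basin" for n using u[of "n + n0"] u0[of n] by (auto simp: inverted_basin_def y_def)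
  have yb: "norm (y n) \<le> norm a + inverse \<delta>" for n
  proof -
    have "norm (inverse (u (n + n0))) \<le> inverse \<delta>" unfolding norm_inverse
      using n0[of "n + n0"] \<delta>(1) by (intro le_imp_inverse_le) auto
    then show ?thesis unfolding y_def using norm_triangle_ineq[of a "inverse (u (n + n0))"] by linarith
  qed
  then have "bounded (range y)" by (auto simp: bounded_iff)
  then obtain b s where b: "strict_mono s" "(y \<circ> s) \<longlonglongrightarrow> b" using bounded_imp_convergent_subsequence by blast
  have "isCont f b" by simp
  then have fl: "(\<lambda>n. f ((y \<circ> s) n)) \<longlonglongrightarrow> f b" using b(2) isCont_tendsto_compose by blast
  have Ny: "inverted_map (u (n + n0)) * (f (y n) - a) = 1" for n
  proof -
    have "f (y n) \<noteq> a" using yV[of n] basin_invariant a by metis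
    then show ?thesis using u0[of n] by (simp add: inverted_map_def y_def)
  qed
  have "(\<lambda>n. inverted_map (u (n + n0))) \<longlonglongrightarrow> l" using LIMSEQ_ignore_initial_segment[OF lim] .
  from LIMSEQ_subseq_LIMSEQ[OF this b(1)] have "(\<lambda>n. inverted_map (u (s n + n0))) \<longlonglongrightarrow> l" by (simp add: o_def)
  then have "(\<lambda>n. inverted_map (u (s n + n0)) * (f ((y \<circ> s) n) - a)) \<longlonglongrightarrow> l * (f b - a)"
    by (intro tendsto_mult tendsto_diff fl tendsto_const)
  then have "(\<lambda>n. 1::complex) \<longlonglongrightarrow> l * (f b - a)" using Ny by simp
  then have l1: "l * (f b - a) = 1" using LIMSEQ_unique tendsto_const by metis
  then have "l \<noteq> 0" and fb: "f b = a + inverse l" using inverse_unique[OF l1] by auto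
  then have "f b \<in> basin" using l by (auto simp: inverted_basin_def)
  then have bV: "b \<in> basin" using basin_invariant by simp
  then have ba: "b \<noteq> a" using a by auto
  have "(\<lambda>n. inverse ((y \<circ> s) n - a)) \<longlonglongrightarrow> inverse (b - a)"
    using ba by (intro tendsto_inverse tendsto_diff b tendsto_const) auto
  moreover have "(\<lambda>n. inverse ((y \<circ> s) n - a)) = u \<circ> (\<lambda>n. s n + n0)" by (auto simp: y_def)
  moreover have "inverse (b - a) \<in> inverted_basin" using bV ba by (auto simp: inverted_basin_def)
  moreover have "strict_mono (\<lambda>n. s n + n0)" using b(1) by (auto simp: strict_mono_def)
  ultimately show ?thesis by metis
qed

text \<open>The Riemann map conjugates \<open>inverted_map\<close> to a proper self-map \<open>h\<close> of the unit disc with its only zero at 0, so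
\<open>h z = c * z ^ m\<close> with \<open>c\<close> of modulus 1, and \<open>m\<close> is not 1 because the derivative at 0 vanishes. The
substitution \<open>z = exp (\<i> t - w)\<close> turns \<open>h\<close> into multiplication by \<open>m\<close>.\<close>
proposition boettcher_coordinate:
  obtains m \<Phi> where "m \<ge> 2" "exterior_coordinate (- basin) \<Phi>"
    "\<And>w. 0 < Re w \<Longrightarrow> f (\<Phi> w) = \<Phi> (of_nat m * w)"
proof -
  obtain \<psi> \<xi> where \<psi>: "\<psi> holomorphic_on ball 0 1" and \<xi>: "\<xi> holomorphic_on inverted_basin" and \<psi>0: "\<psi> 0 = 0"
    and \<xi>\<psi>: "\<And>u. u \<in> inverted_basin \<Longrightarrow> norm (\<xi> u) < 1 \<and> \<psi> (\<xi> u) = u"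
    and \<psi>\<xi>: "\<And>z. norm z < 1 \<Longrightarrow> \<psi> z \<in> inverted_basin \<and> \<xi> (\<psi> z) = z" using riemann_map by blast
  have \<psi>_inj: "z = z'" if "norm z < 1" "norm z' < 1" "\<psi> z = \<psi> z'" for z z' using that \<psi>\<xi> by metis
  have \<psi>_nz: "\<psi> z \<noteq> 0" if "norm z < 1" "z \<noteq> 0" for z using that \<psi>_inj[of z 0] \<psi>0 by auto
  have \<xi>0: "\<xi> 0 = 0" using \<psi>\<xi>[of 0] \<psi>0 by simp
  define h where "h = (\<lambda>z. \<xi> (inverted_map (\<psi> z)))"
  have im1: "\<psi> ` ball 0 1 \<subseteq> inverted_basin" using \<psi>\<xi> by auto
  have im2: "inverted_map ` inverted_basin \<subseteq> inverted_basin" using inverted_map_in by auto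
  have h_hol: "h holomorphic_on ball 0 1"
  proof -
    have "(inverted_map \<circ> \<psi>) holomorphic_on ball 0 1" by (rule holomorphic_on_compose_gen[OF \<psi> inverted_map_holomorphic im1])
    then have "(\<xi> \<circ> (inverted_map \<circ> \<psi>)) holomorphic_on ball 0 1" using \<xi> by (rule holomorphic_on_compose_gen) (use im1 im2 in auto)
    then show ?thesis by (simp add: h_def o_def)
  qed
  have inverted_map\<psi>: "inverted_map (\<psi> z) \<in> inverted_basin" if "norm z < 1" for z using \<psi>\<xi>[OF that] inverted_map_in by blast
  have h1: "norm (h z) < 1" if "norm z < 1" for z using \<xi>\<psi>[OF inverted_map\<psi>[OF that]] by (simp add: h_def)
  have \<psi>h: "\<psi> (h z) = inverted_map (\<psi> z)" if "norm z < 1" for z using \<xi>\<psi>[OF inverted_map\<psi>[OF that]] by (simp add: h_def)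
  have h0: "h 0 = 0" by (simp add: h_def \<psi>0 inverted_map_def \<xi>0)
  have hz: "z = 0" if "norm z < 1" "h z = 0" for z
  proof -
    have "inverted_map (\<psi> z) = 0" using \<psi>h[OF that(1)] that(2) \<psi>0 by simp
    then have "\<psi> z = 0" using inverted_map_eq_0 \<psi>\<xi>[OF that(1)] by blast
    then show ?thesis using \<psi>_nz that by blast
  qed
  have proper: "\<exists>r<1. \<forall>z. r \<le> norm z \<and> norm z < 1 \<longrightarrow> s < norm (h z)" if s: "s < 1" for s
  proof (rule ccontr)
    assume con: "\<not> ?thesis"
    have "\<exists>z. 1 - 1 / real (Suc n) \<le> norm z \<and> norm z < 1 \<and> norm (h z) \<le> s" for n
    proof -
      have "1 - 1 / real (Suc n) < 1" by simp
      then show ?thesis using con by (metis linorder_not_less)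
    qed
    then obtain z where z: "\<And>n. 1 - 1 / real (Suc n) \<le> norm (z n) \<and> norm (z n) < 1 \<and> norm (h (z n)) \<le> s" by metis
    have "bounded (range (\<lambda>n. h (z n)))" using z by (auto simp: bounded_iff)
    then obtain w t where w: "strict_mono t" "((\<lambda>n. h (z n)) \<circ> t) \<longlonglongrightarrow> w" using bounded_imp_convergent_subsequence by blast
    have "norm w \<le> s" by (rule LIMSEQ_le_const2[OF tendsto_norm[OF w(2)]]) (use z in auto)
    then have w1: "norm w < 1" using s by simp
    have "isCont \<psi> w"
      using holomorphic_on_imp_continuous_on[OF \<psi>] w1 by (simp add: continuous_on_eq_continuous_at)
    then have "(\<lambda>n. \<psi> (((\<lambda>n. h (z n)) \<circ> t) n)) \<longlonglongrightarrow> \<psi> w" using w(2) by (rule isCont_tendsto_compose)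
    then have "(\<lambda>n. inverted_map (\<psi> (z (t n)))) \<longlonglongrightarrow> \<psi> w" using z \<psi>h by (simp add: o_def)
    then obtain v q where v: "v \<in> inverted_basin" "strict_mono q" "((\<lambda>n. \<psi> (z (t n))) \<circ> q) \<longlonglongrightarrow> v"
      using inverted_map_proper[of "\<lambda>n. \<psi> (z (t n))" "\<psi> w"] \<psi>\<xi> z w1 by metis
    have "isCont \<xi> v"
      using holomorphic_on_imp_continuous_on[OF \<xi>] v(1) open_inverted_basin by (simp add: continuous_on_eq_continuous_at)
    then have "(\<lambda>n. \<xi> (((\<lambda>n. \<psi> (z (t n))) \<circ> q) n)) \<longlonglongrightarrow> \<xi> v" using v(3) by (rule isCont_tendsto_compose)
    then have "(\<lambda>n. z (t (q n))) \<longlonglongrightarrow> \<xi> v" using \<psi>\<xi> z by (simp add: o_def)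
    then have l1: "(\<lambda>n. norm (z (t (q n)))) \<longlonglongrightarrow> norm (\<xi> v)" by (rule tendsto_norm)
    have "(\<lambda>n. norm (z n)) \<longlonglongrightarrow> 1"
    proof (rule tendsto_sandwich[of "\<lambda>n. 1 - 1 / real (Suc n)" _ _ "\<lambda>n. 1"])
      show "(\<lambda>n. 1 - 1 / real (Suc n)) \<longlonglongrightarrow> 1"
        using tendsto_diff[OF tendsto_const LIMSEQ_Suc[OF lim_const_over_n[of "1::real"]], of 1] by simp
    qed (use z in \<open>auto intro!: always_eventually less_imp_le\<close>)
    then have "(\<lambda>n. norm (z (t (q n)))) \<longlonglongrightarrow> 1"
      using LIMSEQ_subseq_LIMSEQ[of "\<lambda>n. norm (z n)" 1 "t \<circ> q"] strict_mono_o[OF w(1) v(2)] by (simp add: o_def)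
    then have "norm (\<xi> v) = 1" using l1 LIMSEQ_unique by blast
    then show False using \<xi>\<psi>[OF v(1)] by simp
  qed
  obtain c m where c: "norm c = 1" "m > 0" "\<And>z. norm z < 1 \<Longrightarrow> h z = c * z ^ m"
    using proper_disc_self_map[OF h_hol h1 h0 hz proper] by blast
  have "m \<noteq> 1"
  proof
    assume m1: "m = 1"
    have d1: "(\<psi> has_field_derivative deriv \<psi> 0) (at 0)" by (rule holomorphic_derivI[OF \<psi>]) auto
    have d2: "(\<xi> has_field_derivative deriv \<xi> 0) (at 0)" by (rule holomorphic_derivI[OF \<xi> open_inverted_basin]) (simp add: inverted_basin_def)
    have "((\<lambda>z. inverted_map (\<psi> z)) has_field_derivative 0 * deriv \<psi> 0) (at 0)"
      by (rule DERIV_chain2[OF _ d1]) (simp add: \<psi>0 inverted_map_deriv_0)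
    then have "((\<lambda>z. \<xi> (inverted_map (\<psi> z))) has_field_derivative deriv \<xi> 0 * (0 * deriv \<psi> 0)) (at 0)"
      by (intro DERIV_chain2[where f = \<xi>]) (simp_all add: \<psi>0 inverted_map_def d2)
    then have h': "(h has_field_derivative 0) (at 0)" by (simp add: h_def)
    have "((\<lambda>z. c * z) has_field_derivative c) (at 0)" using DERIV_cmult_Id .
    then have "(h has_field_derivative c) (at 0)"
    proof (rule has_field_derivative_transform_within_open[of _ _ _ "ball 0 1"])
      show "c * z = h z" if "z \<in> ball 0 1" for z using c(3)[of z] that m1 by simp
    qed auto
    then have "c = 0" using h' DERIV_unique by blast
    then show False using c(1) by simp
  qed
  then have m: "m \<ge> 2" using c(2) by simp
  \<comment> \<open>The angle t solves Arg c + m t = t: the rotation by t absorbs the factor c.\<close>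
  define t where "t = - Arg c / (real m - 1)"
  have cexp: "c = exp (\<i> * of_real (Arg c))" using c(1) by (metis Arg_eq mult_1 of_real_1 norm_zero zero_neq_one)
  have tm: "Arg c + real m * t = t" using m by (simp add: t_def field_simps)
  define E where "E = (\<lambda>w. exp (\<i> * of_real t - w))"
  have En: "norm (E w) = exp (- Re w)" for w by (simp add: E_def norm_exp_eq_Re)
  have E1: "norm (E w) < 1" if "0 < Re w" for w using that by (simp add: En)
  have Ez: "E w \<noteq> 0" for w by (simp add: E_def)
  have EE: "c * E w ^ m = E (of_nat m * w)" for w
  proof -
    have "E w ^ m = exp (of_nat m * (\<i> * of_real t - w))" by (simp add: E_def exp_of_nat_mult)
    then have "c * E w ^ m = exp (\<i> * of_real (Arg c) + of_nat m * (\<i> * of_real t - w))"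
      by (subst cexp) (simp add: exp_add)
    also have "\<i> * of_real (Arg c) + of_nat m * (\<i> * of_real t - w) = \<i> * of_real (Arg c + real m * t) - of_nat m * w"
      by (simp add: algebra_simps)
    finally show ?thesis unfolding tm E_def .
  qed
  define \<Phi> where "\<Phi> = (\<lambda>w. a + inverse (\<psi> (E w)))"
  have nz: "\<psi> (E w) \<noteq> 0" if "0 < Re w" for w using \<psi>_nz[OF E1[OF that] Ez] .
  have conj: "f (\<Phi> w) = \<Phi> (of_nat m * w)" if w: "0 < Re w" for w
  proof -
    have "\<psi> (E (of_nat m * w)) = \<psi> (h (E w))" using c(3)[OF E1[OF w]] EE by simp
    also have "\<dots> = inverse (f (\<Phi> w) - a)" using \<psi>h[OF E1[OF w]] nz[OF w] by (simp add: inverted_map_def \<Phi>_def)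
    finally show ?thesis by (simp add: \<Phi>_def)
  qed
  have "exterior_coordinate (- basin) \<Phi>"
  proof
    show "compact (- basin)" by (rule compact_filled_julia)
    have "E ` {w. 0 < Re w} \<subseteq> ball 0 1" using E1 by auto
    moreover have "E holomorphic_on {w. 0 < Re w}" unfolding E_def by (intro holomorphic_intros)
    ultimately have "(\<psi> \<circ> E) holomorphic_on {w. 0 < Re w}" using holomorphic_on_compose_gen \<psi> by blast
    then show "\<Phi> holomorphic_on {w. 0 < Re w}" unfolding \<Phi>_def using nz by (intro holomorphic_intros) (auto simp: o_def)
    show "\<Phi> ` {w. 0 < Re w} = - (- basin)"
    proof (intro set_eqI iffI)
      fix v assume "v \<in> \<Phi> ` {w. 0 < Re w}"
      then obtain w where w: "0 < Re w" "v = \<Phi> w" by auto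
      then show "v \<in> - (- basin)" using \<psi>\<xi>[OF E1[OF w(1)]] nz[OF w(1)] by (simp add: inverted_basin_def \<Phi>_def)
    next
      fix v assume "v \<in> - (- basin)"
      then have v: "v \<in> basin" "v \<noteq> a" using a by auto
      define z where "z = \<xi> (inverse (v - a))"
      have "inverse (v - a) \<in> inverted_basin" using v by (auto simp: inverted_basin_def)
      then have z: "norm z < 1" "\<psi> z = inverse (v - a)" using \<xi>\<psi> by (auto simp: z_def)
      then have z0: "z \<noteq> 0" using \<psi>0 v by auto
      define w where "w = \<i> * of_real t - Ln z"
      have "E w = z" using z0 by (simp add: E_def w_def)
      moreover have "0 < Re w" using z(1) z0 by (simp add: w_def Re_Ln)
      ultimately show "v \<in> \<Phi> ` {w. 0 < Re w}" using z(2) by (intro image_eqI[of _ _ w]) (auto simp: \<Phi>_def)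
    qed
    show "\<Phi> w = \<Phi> w' \<longleftrightarrow> (\<exists>k::int. w - w' = 2 * of_real pi * of_int k * \<i>)" if w: "0 < Re w" "0 < Re w'" for w w'
    proof -
      have "\<Phi> w = \<Phi> w' \<longleftrightarrow> E w = E w'" using \<psi>_inj[OF E1[OF w(1)] E1[OF w(2)]] by (auto simp: \<Phi>_def)
      also have "\<dots> \<longleftrightarrow> (\<exists>n::int. \<i> * of_real t - w' = \<i> * of_real t - w + (of_int (2 * n) * pi) * \<i>)"
        unfolding E_def using exp_eq by metis
      also have "\<dots> \<longleftrightarrow> (\<exists>k::int. w - w' = 2 * of_real pi * of_int k * \<i>)"
        by (intro ex_cong1) (auto simp: algebra_simps)
      finally show ?thesis .
    qed
    have "open (\<psi> ` ball 0 (exp (-1)))"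
    proof (rule open_mapping_thm[OF \<psi>])
      show "\<not> \<psi> constant_on ball 0 1"
      proof
        assume "\<psi> constant_on ball 0 1"
        then have "\<psi> (1/2) = \<psi> 0" by (auto simp: constant_on_def)
        then show False using \<psi>_inj[of "1/2" 0] by simp
      qed
      show "ball 0 (exp (- 1)) \<subseteq> ball (0::complex) 1" by (rule subset_ball) simp
    qed auto
    moreover have "0 \<in> \<psi> ` ball 0 (exp (-1))" using \<psi>0 by (intro image_eqI[of _ _ 0]) auto
    ultimately obtain e where e: "e > 0" "ball 0 e \<subseteq> \<psi> ` ball 0 (exp (-1))" using open_contains_ball by blast
    show "bounded (\<Phi> ` {w. 0 < Re w \<and> Re w \<le> 1})"
    proof (rule boundedI[of _ "norm a + inverse e"])
      fix v assume "v \<in> \<Phi> ` {w. 0 < Re w \<and> Re w \<le> 1}"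
      then obtain w where w: "0 < Re w" "Re w \<le> 1" "v = \<Phi> w" by auto
      have "e \<le> norm (\<psi> (E w))"
      proof (rule ccontr)
        assume "\<not> ?thesis"
        then have "\<psi> (E w) \<in> ball 0 e" by simp
        then obtain z where z: "z \<in> ball 0 (exp (-1))" "\<psi> (E w) = \<psi> z" using e by blast
        have ez: "norm z < exp (-1)" using z(1) by simp
        also have "exp (-1) < exp (0::real)" by (subst exp_less_cancel_iff) simp
        finally have "norm z < 1" by simp
        then have "E w = z" using \<psi>_inj[OF E1[OF w(1)] _ z(2)] by blast
        then show False using ez En[of w] w(2) by simp
      qed
      then have "norm (inverse (\<psi> (E w))) \<le> inverse e" unfolding norm_inverse using e by (intro le_imp_inverse_le) auto
      then show "norm v \<le> norm a + inverse e"
        unfolding w(3) \<Phi>_def using norm_triangle_ineq[of a "inverse (\<psi> (E w))"] by linarith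
    qed
    show "\<exists>R. \<forall>w. R < Re w \<longrightarrow> M < norm (\<Phi> w)" for M
    proof -
      define \<eta> where "\<eta> = 1 / (\<bar>M\<bar> + norm a + 1)"
      have \<eta>: "\<eta> > 0" unfolding \<eta>_def by (simp add: add_nonneg_pos)
      have "isCont \<psi> 0" using holomorphic_on_imp_continuous_on[OF \<psi>] by (simp add: continuous_on_eq_continuous_at)
      then obtain d where d: "d > 0" "\<And>z. norm z < d \<Longrightarrow> norm (\<psi> z) < \<eta>"
        using \<eta> \<psi>0 by (auto simp: continuous_at_eps_delta)
      show ?thesis
      proof (intro exI[of _ "max 0 (- ln d)"] allI impI)
        fix w assume w: "max 0 (- ln d) < Re w"
        then have w0: "0 < Re w" and "- Re w < ln d" by auto
        then have "exp (- Re w) < exp (ln d)" by (subst exp_less_cancel_iff)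
        then have "norm (E w) < d" using d(1) by (simp add: En)
        then have "norm (\<psi> (E w)) < 1 / (\<bar>M\<bar> + norm a + 1)" using d(2) by (simp add: \<eta>_def)
        then show "M < norm (\<Phi> w)" unfolding \<Phi>_def by (rule near_infinity[OF nz[OF w0]])
      qed
    qed
  qed
  then show ?thesis using that m conj by blast
qed

end

section \<open>No wandering continua\<close>

lemma countable_angle_mult_orbit:
  assumes "m \<ge> 2"
  shows "countable {y. \<exists>n. (angle_mult m ^^ n) y = (angle_mult m ^^ n) x}"
proof -
  have one: "countable {y. angle_mult m y = v}" for v
  proof -
    have "{y. angle_mult m y = v} \<subseteq> range (\<lambda>k::int. (v + of_int k) / real m)"
    proof
      fix y assume "y \<in> {y. angle_mult m y = v}"
      then have "y = (v + of_int \<lfloor>real m * y\<rfloor>) / real m"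
        using assms by (auto simp: angle_mult_def frac_def)
      then show "y \<in> range (\<lambda>k::int. (v + of_int k) / real m)" by blast
    qed
    then show ?thesis by (rule countable_subset) simp
  qed
  have iter: "countable {y. (angle_mult m ^^ n) y = v}" for n v
  proof (induction n arbitrary: v)
    case (Suc n)
    have "{y. (angle_mult m ^^ Suc n) y = v} = (\<Union>w\<in>{w. angle_mult m w = v}. {y. (angle_mult m ^^ n) y = w})"
      by (intro set_eqI) simp
    then show ?case using countable_UN[OF one, of v "\<lambda>w. {y. (angle_mult m ^^ n) y = w}"] Suc by simp
  qed simp
  have "{y. \<exists>n. (angle_mult m ^^ n) y = (angle_mult m ^^ n) x}
    = (\<Union>n. {y. (angle_mult m ^^ n) y = (angle_mult m ^^ n) x})" by (intro set_eqI) simp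
  then show ?thesis by (simp only:) (rule countable_UN[OF countableI_type iter])
qed

text \<open>Each angle collides, at some time, with countably many others only, so the set can be enlarged by one point
at a time.\<close>
lemma uncountable_contains_independent:
  assumes A: "uncountable A" and m: "m \<ge> 2"
  shows "\<exists>F\<subseteq>A. finite F \<and> card F = N \<and> (\<forall>n. inj_on (angle_mult m ^^ n) F)"
proof (induction N)
  case 0
  show ?case by (intro exI[of _ "{}"]) auto
next
  case (Suc N)
  then obtain F where F: "F \<subseteq> A" "finite F" "card F = N" "\<And>n. inj_on (angle_mult m ^^ n) F" by blast
  have "countable (\<Union>x\<in>F. {y. \<exists>n. (angle_mult m ^^ n) y = (angle_mult m ^^ n) x})"
    using F(2) countable_angle_mult_orbit[OF m] by (intro countable_UN) (auto intro: countable_finite)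
  then have "\<not> A \<subseteq> (\<Union>x\<in>F. {y. \<exists>n. (angle_mult m ^^ n) y = (angle_mult m ^^ n) x})"
    using A countable_subset by blast
  then obtain y where y: "y \<in> A" "\<And>x n. x \<in> F \<Longrightarrow> (angle_mult m ^^ n) y \<noteq> (angle_mult m ^^ n) x" by blast
  have "y \<notin> F" using y(2)[of y 0] by auto
  moreover have "inj_on (angle_mult m ^^ n) (insert y F)" for n
    using F(4)[of n] y(2) by (auto simp: inj_on_insert)
  ultimately show ?case using F y(1) by (intro exI[of _ "insert y F"]) auto
qed

theorem corollary1p3:
  fixes p :: "complex poly" and f :: "complex \<Rightarrow> complex" and C :: "complex set"
  assumes "f = poly p" and "degree p \<ge> 2"
    and "locally connected (julia_set f)"
    and "continuum C" and "C \<subseteq> julia_set f"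
  shows "\<exists>(m::nat) (n::nat). n \<ge> 1 \<and> (f ^^ m) ` C \<inter> (f ^^ (m + n)) ` C \<noteq> {}"
proof (rule ccontr)
  assume wandering: "\<not> ?thesis"
  have disj: "(f ^^ i) ` C \<inter> (f ^^ j) ` C = {}" if "i \<noteq> j" for i j
  proof -
    have lt: "(f ^^ i) ` C \<inter> (f ^^ j) ` C = {}" if "i < j" for i j
    proof -
      have "1 \<le> j - i" "i + (j - i) = j" using that by auto
      then show ?thesis using wandering by metis
    qed
    show ?thesis
    proof (cases "i < j")
      case False
      then have "j < i" using that by simp
      from lt[OF this] show ?thesis by (simp only: Int_commute)
    qed (rule lt)
  qed
  interpret polynomial_basin p by unfold_locales (rule assms)
  have JV: "julia_set f = frontier basin" by (simp add: julia_set_def basin_def assms(1))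
  have fr: "frontier (- basin) = frontier basin" by (rule frontier_complement)
  have JK: "frontier basin \<subseteq> - basin" using open_basin by (auto simp: frontier_def interior_open)
  have lc: "locally connected (frontier (- basin))" using assms(3) JV fr by simp
  have C: "compact C" "connected C" using assms(4) by (auto simp: continuum_def)
  obtain a b where ab: "a \<in> C" "b \<in> C" "a \<noteq> b"
    using assms(4) unfolding continuum_def by (metis ex_in_conv is_singletonI' )
  have CK: "C \<subseteq> - basin" using assms(5) JV JK by simp
  interpret boettcher p a
  proof
    show "a \<notin> basin" using ab CK by blast
    show "\<exists>b. b \<notin> basin \<and> b \<noteq> a" using ab CK by blast
    show "connected (- basin)" by (rule connected_filled_julia[OF lc])
  qed
  obtain m \<Phi> where m: "m \<ge> 2" and coordinate: "exterior_coordinate (- basin) \<Phi>"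
    and conj: "\<And>w. 0 < Re w \<Longrightarrow> poly p (\<Phi> w) = \<Phi> (of_nat m * w)" using boettcher_coordinate by blast
  interpret L: locally_connected_exterior "- basin" \<Phi>
    by (intro locally_connected_exterior.intro locally_connected_exterior_axioms.intro coordinate lc)
  have fb: "f (L.boundary_value y) = L.boundary_value (real m * y)" for y
  proof -
    have "isCont f (L.boundary_value y)" using assms(1) by simp
    then have l1: "(\<lambda>n. f (\<Phi> (Complex (1 / real (Suc n)) y))) \<longlonglongrightarrow> f (L.boundary_value y)"
      using L.boundary_value_LIMSEQ by (rule isCont_tendsto_compose)
    have "(\<lambda>n. Complex (real m * (1 / real (Suc n))) (real m * y)) \<longlonglongrightarrow> Complex (real m * 0) (real m * y)"
      by (intro tendsto_Complex tendsto_mult tendsto_const L.inverse_Suc_null)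
    then have l2: "(\<lambda>n. L.extension (Complex (real m * (1 / real (Suc n))) (real m * y))) \<longlonglongrightarrow> L.extension (Complex (real m * 0) (real m * y))"
      by (rule continuous_on_tendsto_compose[OF L.continuous_on_extension]) (auto intro!: always_eventually)
    have "f (\<Phi> (Complex (1 / real (Suc n)) y)) = L.extension (Complex (real m * (1 / real (Suc n))) (real m * y))" for n
    proof -
      have "of_nat m * Complex (1 / real (Suc n)) y = Complex (real m * (1 / real (Suc n))) (real m * y)"
        by (simp add: complex_eq_iff)
      then show ?thesis using conj[of "Complex (1 / real (Suc n)) y"] m assms(1) by (simp add: L.extension_eq)
    qed
    then have "(\<lambda>n. f (\<Phi> (Complex (1 / real (Suc n)) y))) \<longlonglongrightarrow> L.boundary_value (real m * y)"
      using l2 by (simp add: L.extension_boundary)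
    then show ?thesis using l1 LIMSEQ_unique by blast
  qed
  define \<phi> where "\<phi> = (\<lambda>x. L.boundary_value (2 * pi * x))"
  have \<phi>frac: "\<phi> (frac x) = \<phi> x" for x
  proof -
    have "2 * pi * frac x = 2 * pi * x + 2 * pi * of_int (- \<lfloor>x\<rfloor>)" by (simp add: frac_def algebra_simps)
    then show ?thesis unfolding \<phi>_def using L.boundary_value_periodic[of "2 * pi * x" "- \<lfloor>x\<rfloor>"] by simp
  qed
  have \<phi>m: "\<phi> (angle_mult m x) = f (\<phi> x)" for x
    unfolding angle_mult_def \<phi>frac by (simp add: \<phi>_def fb ac_simps)
  have \<phi>n: "\<phi> ((angle_mult m ^^ n) x) = (f ^^ n) (\<phi> x)" for n x
    by (induction n) (auto simp: \<phi>m)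
  \<comment> \<open>The external angles of C, measured in turns.\<close>
  define A where "A = {x. 0 \<le> x \<and> x < 1 \<and> \<phi> x \<in> C}"
  have "C \<subseteq> \<phi> ` A"
  proof
    fix c assume c: "c \<in> C"
    then have "c \<in> frontier (- basin)" using assms(5) JV fr by blast
    then obtain y where y: "L.boundary_value y = c" using L.boundary_value_onto by blast
    define x where "x = frac (y / (2 * pi))"
    have "\<phi> x = c" unfolding x_def \<phi>frac using y by (simp add: \<phi>_def)
    moreover have "0 \<le> x" "x < 1" by (auto simp: x_def frac_lt_1)
    ultimately show "c \<in> \<phi> ` A" using c by (auto simp: A_def)
  qed
  moreover have "uncountable C" using connected_uncountable[OF C(2) ab] .
  ultimately have unc: "uncountable A" using countable_subset countable_image by metis
  define M where "M = 2 ^ card (wandering_angles.classes m) * (m + 1)"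
  obtain F where F: "F \<subseteq> A" "finite F" "card F = M" "\<And>n. inj_on (angle_mult m ^^ n) F"
    using uncountable_contains_independent[OF unc m, of M] by blast
  have Cn: "compact ((f ^^ n) ` C)" "connected ((f ^^ n) ` C)" for n
    using C continuous_iter[of C n] assms(1) by (auto intro: compact_continuous_image connected_continuous_image)
  have CnK: "(f ^^ n) ` C \<subseteq> - basin" for n
    using CK basin_invariant_iter assms(1) by auto
  have inC: "\<phi> x \<in> (f ^^ n) ` C" if "x \<in> (angle_mult m ^^ n) ` F" for x n
    using that F(1) \<phi>n by (auto simp: A_def)
  have in01: "0 \<le> x \<and> x < 1" if "x \<in> (angle_mult m ^^ n) ` F" for x n
  proof (cases n)
    case 0
    then show ?thesis using that F(1) by (auto simp: A_def)
  next
    case (Suc k)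
    then show ?thesis using that by (auto simp: angle_mult_def frac_lt_1)
  qed
  have nolink: "\<not> (a < c \<and> c < b \<and> b < e)"
    if "i \<noteq> j" "a \<in> (angle_mult m ^^ i) ` F" "b \<in> (angle_mult m ^^ i) ` F"
      "c \<in> (angle_mult m ^^ j) ` F" "e \<in> (angle_mult m ^^ j) ` F" for i j a b c e
  proof
    assume o: "a < c \<and> c < b \<and> b < e"
    have ea: "e < a + 1" using in01[OF that(2)] in01[OF that(5)] by simp
    show False
    proof (rule L.boundary_values_unlinked[OF Cn CnK Cn CnK disj[OF that(1)]])
      show "2 * pi * a < 2 * pi * c" "2 * pi * c < 2 * pi * b" "2 * pi * b < 2 * pi * e" using o by auto
      have "2 * pi * e < 2 * pi * (a + 1)" using ea by simp
      then show "2 * pi * e < 2 * pi * a + 2 * pi" by (simp add: algebra_simps)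
    qed (use inC that in \<open>auto simp: \<phi>_def\<close>)
  qed
  interpret W: wandering_angles m F
  proof
    show "m \<ge> 2" "finite F" "\<And>n. inj_on (angle_mult m ^^ n) F" using m F by auto
    show "F \<subseteq> {0..<1}" using F(1) by (auto simp: A_def)
    fix i j :: nat assume ij: "i \<noteq> j"
    have "(angle_mult m ^^ i) ` F \<inter> (angle_mult m ^^ j) ` F = {}"
      using inC disj[OF ij] by blast
    then show "unlinked ((angle_mult m ^^ i) ` F) ((angle_mult m ^^ j) ` F)"
      unfolding unlinked_def
    proof (intro conjI ballI)
      fix a b c e
      assume a: "a \<in> (angle_mult m ^^ i) ` F" and b: "b \<in> (angle_mult m ^^ i) ` F"
        and c: "c \<in> (angle_mult m ^^ j) ` F" and e: "e \<in> (angle_mult m ^^ j) ` F"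
      show "\<not> (a < c \<and> c < b \<and> b < e)" by (rule nolink[OF ij a b c e])
      show "\<not> (c < a \<and> a < e \<and> e < b)" by (rule nolink[OF ij[symmetric] c e a b])
    qed
  qed
  show False using W.card_wandering_angles F(3) by (simp add: M_def)
qed

end
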